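(* Let $p$ be an odd prime, let $P$ be a $p$-group, and let $\chi\in\mathrm{Irr}(P)$. Suppose there exists $x\in\mathrm{Supp}(\chi)$ such that the order of $x$ does not divide $|P|/\chi(1)^2$. Then $\chi(1)$ is divisible by $p^4$ and $|P|$ is divisible by $p^{10}$.
   Context: A $p$-group is a finite group whose order is a power of the prime $p$. $\mathrm{Irr}(P)$ denotes the set of complex irreducible characters of $P$. For $\chi\in\mathrm{Irr}(P)$, the support of $\chi$ is $\mathrm{Supp}(\chi)=\{g\in P:\chi(g)\neq 0\}$. *)

theory Defs
  imports
    "HOL-Algebra.Multiplicative_Group"
    "HOL-Computational_Algebra.Primes"
    "Jordan_Normal_Form.VS_Connect"
begin

definition p_group :: "nat \<Rightarrow> ('a, 'b) monoid_scheme \<Rightarrow> bool" where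
  "p_group p G \<longleftrightarrow> group G \<and> finite (carrier G) \<and> (\<exists>k. Coset.order G = p ^ k)"

definition GL :: "nat \<Rightarrow> complex mat monoid" where
  "GL n = units_of (ring_mat TYPE(complex) n ())"

definition invariant_subspace ::
    "('a, 'b) monoid_scheme \<Rightarrow> nat \<Rightarrow> ('a \<Rightarrow> complex mat) \<Rightarrow> complex vec set \<Rightarrow> bool" where
  "invariant_subspace G n \<rho> W \<longleftrightarrow>
     VectorSpace.subspace class_ring W (module_vec TYPE(complex) n) \<and>
     (\<forall>g\<in>carrier G. \<forall>w\<in>W. \<rho> g *\<^sub>v w \<in> W)"

definition irreducible_rep ::
    "('a, 'b) monoid_scheme \<Rightarrow> nat \<Rightarrow> ('a \<Rightarrow> complex mat) \<Rightarrow> bool" where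
  "irreducible_rep G n \<rho> \<longleftrightarrow>
     n > 0 \<and> \<rho> \<in> hom G (GL n) \<and>
     (\<forall>W. invariant_subspace G n \<rho> W \<longrightarrow> W = {0\<^sub>v n} \<or> W = carrier_vec n)"

definition mat_trace :: "'a :: comm_monoid_add mat \<Rightarrow> 'a" where
  "mat_trace A = (\<Sum>i<dim_row A. A $$ (i, i))"

text \<open>Characters are made extensional (\<open>undefined\<close> off the carrier), so that distinct elements
  of \<open>Irr G\<close> are distinct functions on the group.\<close>

definition character :: "('a, 'b) monoid_scheme \<Rightarrow> ('a \<Rightarrow> complex mat) \<Rightarrow> 'a \<Rightarrow> complex" where
  "character G \<rho> = (\<lambda>g\<in>carrier G. mat_trace (\<rho> g))"

definition Irr :: "('a, 'b) monoid_scheme \<Rightarrow> ('a \<Rightarrow> complex) set" where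
  "Irr G = {character G \<rho> | n \<rho>. irreducible_rep G n \<rho>}"

definition Supp :: "('a, 'b) monoid_scheme \<Rightarrow> ('a \<Rightarrow> complex) \<Rightarrow> 'a set" where
  "Supp G \<chi> = {g \<in> carrier G. \<chi> g \<noteq> 0}"

text \<open>Divisibility in the integers, for a complex number such as \<open>\<chi>(1)\<close> or \<open>|G| / \<chi>(1)\<^sup>2\<close>
  (with exact division); it is false if \<open>z\<close> is not a natural number. For irreducible characters
  of \<open>p\<close>-groups both numbers are natural numbers.\<close>

definition nat_dvd_complex :: "nat \<Rightarrow> complex \<Rightarrow> bool"  (infix \<open>dvd\<^sub>\<nat>\<close> 50) where
  "m dvd\<^sub>\<nat> z \<longleftrightarrow> (\<exists>k::nat. z = of_nat k \<and> m dvd k)"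

lemma hom_GL_iff:
  assumes "group G"
  shows "\<rho> \<in> hom G (GL n) \<longleftrightarrow>
    \<rho> \<in> carrier G \<rightarrow> carrier_mat n n \<and> \<rho> \<one>\<^bsub>G\<^esub> = 1\<^sub>m n \<and>
    (\<forall>x\<in>carrier G. \<forall>y\<in>carrier G. \<rho> (x \<otimes>\<^bsub>G\<^esub> y) = \<rho> x * \<rho> y)"
proof -
  interpret G: group G by fact
  interpret R: ring "ring_mat TYPE(complex) n ()" by (rule ring_mat)
  interpret U: group "GL n" unfolding GL_def by (rule R.units_group)
  have one: "\<one>\<^bsub>GL n\<^esub> = 1\<^sub>m n" and mult: "A \<otimes>\<^bsub>GL n\<^esub> B = A * B" for A B
    by (simp_all add: GL_def units_of_def ring_mat_simps)
  show ?thesis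
  proof
    assume h: "\<rho> \<in> hom G (GL n)"
    have "\<rho> \<one>\<^bsub>G\<^esub> = 1\<^sub>m n"
      using hom_one[OF h G.group_axioms U.group_axioms] one by simp
    moreover have "carrier (GL n) \<subseteq> carrier_mat n n"
      by (auto simp: GL_def units_of_def Units_def ring_mat_simps)
    ultimately show "\<rho> \<in> carrier G \<rightarrow> carrier_mat n n \<and> \<rho> \<one>\<^bsub>G\<^esub> = 1\<^sub>m n \<and>
        (\<forall>x\<in>carrier G. \<forall>y\<in>carrier G. \<rho> (x \<otimes>\<^bsub>G\<^esub> y) = \<rho> x * \<rho> y)"
      using h by (auto simp: hom_def mult)
  next
    assume h: "\<rho> \<in> carrier G \<rightarrow> carrier_mat n n \<and> \<rho> \<one>\<^bsub>G\<^esub> = 1\<^sub>m n \<and>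
        (\<forall>x\<in>carrier G. \<forall>y\<in>carrier G. \<rho> (x \<otimes>\<^bsub>G\<^esub> y) = \<rho> x * \<rho> y)"
    have "\<rho> x \<in> carrier (GL n)" if x: "x \<in> carrier G" for x
    proof -
      have "\<rho> x * \<rho> (inv\<^bsub>G\<^esub> x) = 1\<^sub>m n" "\<rho> (inv\<^bsub>G\<^esub> x) * \<rho> x = 1\<^sub>m n"
        using h x by (metis G.inv_closed G.r_inv, metis G.inv_closed G.l_inv x)
      moreover have "\<rho> x \<in> carrier_mat n n" "\<rho> (inv\<^bsub>G\<^esub> x) \<in> carrier_mat n n"
        using h x by auto
      ultimately show ?thesis
        by (auto simp: GL_def units_of_def Units_def ring_mat_simps)
    qed
    then show "\<rho> \<in> hom G (GL n)"
      using h by (auto simp: hom_def mult)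
  qed
qed

lemma character_one:
  assumes "group G" "irreducible_rep G n \<rho>"
  shows "character G \<rho> \<one>\<^bsub>G\<^esub> = of_nat n"
proof -
  interpret G: group G by fact
  have "\<rho> \<one>\<^bsub>G\<^esub> = 1\<^sub>m n"
    using assms by (simp add: irreducible_rep_def hom_GL_iff)
  then show ?thesis
    by (simp add: character_def mat_trace_def)
qed

end

theory Submission
  imports
    Defs
    "HOL-Algebra.Group_Action"
    "HOL-Number_Theory.Residues"
    "Jordan_Normal_Form.Spectral_Radius"
begin

text \<open>An irreducible character \<open>\<phi>\<close> is handled only through the identity
  \<open>\<phi>(1) \<Sum>\<^sub>h \<phi>(a h b h\<inverse>) = |G| \<phi>(a) \<phi>(b)\<close> and its norm. If \<open>y\<close> is central modulo the centre of \<open>\<phi>\<close>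
  but not in it, then \<open>\<phi>\<close> is induced from constituents of degree \<open>\<phi>(1)/p\<close> on a subgroup \<open>M\<close> of
  index \<open>p\<close> in which \<open>y\<close> is central modulo the kernels, and \<open>M\<close> contains the support of \<open>\<phi>\<close>.

  The key bound is: if \<open>\<phi>\<close> is not linear and \<open>\<phi>(x) \<noteq> 0\<close>, then \<open>|\<langle>x\<rangle>Z(G)| p\<^sup>2 \<le> |G|\<close>. For faithful
  \<open>\<phi>\<close> of degree \<open>p\<^sup>2\<close> apply it in \<open>M = C\<^sub>G(e)\<close>, with \<open>e\<close> of order \<open>p\<close> in the second centre of \<open>G\<close> but
  not central: \<open>e\<close> and a central \<open>z\<close> of order \<open>p\<close> cannot both be powers of \<open>x\<close>, which gains the
  missing factor \<open>p\<close>. In degree \<open>p\<^sup>3\<close>, a violation makes \<open>M/K\<close>, for \<open>K\<close> the kernel of a constituent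
  on \<open>M = C\<^sub>G(e)\<close> with \<open>e \<in> K\<close>, attain the degree \<open>p\<^sup>2\<close> bound, with \<open>K \<le> \<langle>x\<rangle>\<close> and \<open>\<langle>x\<rangle>K/K\<close>
  meeting the centre trivially. Such a group has no \<open>l\<close> in its second centre with \<open>l\<^sup>p\<close> central
  and nontrivial, but the image of some conjugate of an element of order \<open>p\<^sup>2\<close> of \<open>\<langle>x\<rangle>\<close> is one.\<close>

section \<open>Irreducible characters as functions\<close>

text \<open>All orders are powers of p, so a violation at x means ord x * \<phi>(1)^2 > |G|. It
  therefore suffices to prove ord x * p^(2k) <= |G| for \<phi>(1) = p^k with k <= 3. The exponent 10
  comes from p^(2k) |Z(\<phi>)| <= |G|: with k >= 4 and a nontrivial centre this gives p^9, and |G|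
  = p^9 would be an equality case, where \<phi> vanishes off its centre; then x lies in a group of
  order p and is no violation.

  Working with functions has a practical reason: constituents on \<open>M\<close> and characters of
  quotients have explicit formulas, so restriction, induction and complete reducibility are never
  carried out on modules. Matrices occur only at the end, where Schur's lemma supplies the two
  identities.

  Oddness of p enters only as p | 0 + 1 + ... + (p - 1), in three places: a geometric sum modulo
  p^2, p-th powers of products in class 2, and p-fold conjugation of an abelian normal
  subgroup.\<close>

context group
begin

lemma inv_cancel_left [simp]:
  "x \<in> carrier G \<Longrightarrow> y \<in> carrier G \<Longrightarrow> inv x \<otimes> (x \<otimes> y) = y"
  "x \<in> carrier G \<Longrightarrow> y \<in> carrier G \<Longrightarrow> x \<otimes> (inv x \<otimes> y) = y"
  by (simp_all add: m_assoc [symmetric])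

lemmas word_simps = m_assoc inv_mult_group

definition commutator :: "'a \<Rightarrow> 'a \<Rightarrow> 'a"
  where "commutator g y = g \<otimes> y \<otimes> inv g \<otimes> inv y"

lemma commutator_closed [simp, intro]:
  "g \<in> carrier G \<Longrightarrow> y \<in> carrier G \<Longrightarrow> commutator g y \<in> carrier G"
  by (simp add: commutator_def)

lemma conj_eq_commutator:
  "g \<in> carrier G \<Longrightarrow> y \<in> carrier G \<Longrightarrow> g \<otimes> y \<otimes> inv g = commutator g y \<otimes> y"
  by (simp add: commutator_def word_simps)

lemma sum_translate:
  assumes "c \<in> carrier G"
  shows "(\<Sum>h\<in>carrier G. f (h \<otimes> c)) = (\<Sum>h\<in>carrier G. f h)"
  by (rule sum.reindex_bij_witness [where i = "\<lambda>h. h \<otimes> inv c" and j = "\<lambda>h. h \<otimes> c"])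
    (use assms in \<open>auto simp: m_assoc\<close>)

lemma sum_conj:
  assumes "c \<in> carrier G"
  shows "(\<Sum>h\<in>carrier G. f (c \<otimes> h \<otimes> inv c)) = (\<Sum>h\<in>carrier G. f h)"
  by (rule sum.reindex_bij_witness [where i = "\<lambda>h. inv c \<otimes> h \<otimes> c" and j = "\<lambda>h. c \<otimes> h \<otimes> inv c"])
    (use assms in \<open>auto simp: m_assoc\<close>)

lemma conj_pow:
  assumes "g \<in> carrier G" "y \<in> carrier G"
  shows "g \<otimes> y [^] (j::nat) \<otimes> inv g = (g \<otimes> y \<otimes> inv g) [^] j"
proof (induction j)
  case (Suc j)
  have "g \<otimes> y [^] Suc j \<otimes> inv g = (g \<otimes> y [^] j \<otimes> inv g) \<otimes> (g \<otimes> y \<otimes> inv g)"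
    using assms by (simp add: word_simps)
  then show ?case using Suc by simp
qed (use assms in simp)

end

text \<open>The group usually called Z(\<phi>), of the elements represented by scalars.
  Multiplicativity against every \<open>a\<close> replaces the condition |\<phi>(z)| = \<phi>(1), so
  neither absolute values nor a representation are involved.\<close>

definition char_center :: "('a, 'b) monoid_scheme \<Rightarrow> ('a \<Rightarrow> complex) \<Rightarrow> 'a set" where
  "char_center G \<phi> = {z \<in> carrier G.
     \<forall>a\<in>carrier G. \<phi> \<one>\<^bsub>G\<^esub> * \<phi> (a \<otimes>\<^bsub>G\<^esub> z) = \<phi> a * \<phi> z}"

definition char_ker :: "('a, 'b) monoid_scheme \<Rightarrow> ('a \<Rightarrow> complex) \<Rightarrow> 'a set" where
  "char_ker G \<phi> = {z \<in> carrier G. \<forall>a\<in>carrier G. \<phi> (a \<otimes>\<^bsub>G\<^esub> z) = \<phi> a}"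

text \<open>The identity \<open>convolution\<close> characterises the nonzero multiples of irreducible characters;
  \<open>norm\<close> fixes the multiple up to sign.\<close>

locale irr_char = group G for G :: "('a, 'b) monoid_scheme" (structure) and \<phi> :: "'a \<Rightarrow> complex" +
  assumes fin: "finite (carrier G)"
    and convolution: "\<lbrakk>a \<in> carrier G; b \<in> carrier G\<rbrakk> \<Longrightarrow>
      \<phi> \<one> * (\<Sum>h\<in>carrier G. \<phi> (a \<otimes> (h \<otimes> b \<otimes> inv h))) = of_nat (card (carrier G)) * \<phi> a * \<phi> b"
    and norm: "(\<Sum>h\<in>carrier G. \<phi> h * \<phi> (inv h)) = of_nat (card (carrier G))"
begin

abbreviation "Z \<equiv> char_center G \<phi>"
abbreviation "K \<equiv> char_ker G \<phi>"

text \<open>The central character. On \<open>Z\<close> it is a homomorphism to the nonzero complex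
  numbers with kernel \<open>K\<close>.\<close>

definition "lam z = \<phi> z / \<phi> \<one>"

lemma card_pos: "card (carrier G) > 0"
  using fin by (simp add: card_gt_0_iff) blast

lemma deg_nonzero [simp]: "\<phi> \<one> \<noteq> 0"
proof
  assume "\<phi> \<one> = 0"
  then have "\<phi> a = 0" if "a \<in> carrier G" for a
    using convolution [of a a] that card_pos by auto
  then show False using norm card_pos by simp
qed

text \<open>With \<open>a = \<one>\<close> the convolution identity says that \<phi>(b) is the
  average of \<phi> over the conjugates of \<open>b\<close>, and conjugating \<open>b\<close> does
  not change that average.\<close>

lemma char_conj:
  assumes g: "g \<in> carrier G" and b: "b \<in> carrier G"
  shows "\<phi> (g \<otimes> b \<otimes> inv g) = \<phi> b"
proof -
  have avg: "(\<Sum>h\<in>carrier G. \<phi> (h \<otimes> x \<otimes> inv h)) = of_nat (card (carrier G)) * \<phi> x"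
    if "x \<in> carrier G" for x
  proof -
    have "(\<Sum>h\<in>carrier G. \<phi> (\<one> \<otimes> (h \<otimes> x \<otimes> inv h))) = (\<Sum>h\<in>carrier G. \<phi> (h \<otimes> x \<otimes> inv h))"
      by (rule sum.cong) (use that in auto)
    then show ?thesis using convolution [of \<one> x] that by simp
  qed
  have "(\<Sum>h\<in>carrier G. \<phi> (h \<otimes> (g \<otimes> b \<otimes> inv g) \<otimes> inv h))
      = (\<Sum>h\<in>carrier G. \<phi> ((h \<otimes> g) \<otimes> b \<otimes> inv (h \<otimes> g)))"
    by (rule sum.cong) (use g b in \<open>auto simp: word_simps\<close>)
  also have "\<dots> = (\<Sum>h\<in>carrier G. \<phi> (h \<otimes> b \<otimes> inv h))"
    using sum_translate [OF g, of "\<lambda>h. \<phi> (h \<otimes> b \<otimes> inv h)"] .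
  finally show ?thesis using avg [of b] avg [of "g \<otimes> b \<otimes> inv g"] g b card_pos by simp
qed

lemma char_comm: "a \<in> carrier G \<Longrightarrow> b \<in> carrier G \<Longrightarrow> \<phi> (a \<otimes> b) = \<phi> (b \<otimes> a)"
  using char_conj [of b "a \<otimes> b"] by (simp add: word_simps)

lemma center_closed [simp]: "z \<in> Z \<Longrightarrow> z \<in> carrier G"
  by (simp add: char_center_def)

lemma ker_closed [simp]: "z \<in> K \<Longrightarrow> z \<in> carrier G"
  by (simp add: char_ker_def)

lemma char_eq_lam: "\<phi> z = lam z * \<phi> \<one>"
  by (simp add: lam_def)

lemma center_mult_right: "z \<in> Z \<Longrightarrow> a \<in> carrier G \<Longrightarrow> \<phi> (a \<otimes> z) = lam z * \<phi> a"
proof -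
  assume "z \<in> Z" "a \<in> carrier G"
  then have "\<phi> \<one> * \<phi> (a \<otimes> z) = \<phi> a * \<phi> z"
    unfolding char_center_def by blast
  then show ?thesis by (simp add: lam_def field_simps)
qed

lemma center_mult:
  assumes "z \<in> Z" "u \<in> carrier G" "v \<in> carrier G"
  shows "\<phi> (u \<otimes> (z \<otimes> v)) = lam z * \<phi> (u \<otimes> v)"
proof -
  have "\<phi> (u \<otimes> (z \<otimes> v)) = \<phi> (v \<otimes> u \<otimes> z)"
    using char_comm [of "u \<otimes> z" v] assms by (simp add: m_assoc)
  also have "\<dots> = lam z * \<phi> (u \<otimes> v)"
    using assms char_comm [of u v] by (simp add: center_mult_right)
  finally show ?thesis .
qed

lemma centerI:
  assumes "z \<in> carrier G" "\<And>a. a \<in> carrier G \<Longrightarrow> \<phi> (a \<otimes> z) = c * \<phi> a"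
  shows "z \<in> Z" "lam z = c"
proof -
  have "\<phi> z = c * \<phi> \<one>" using assms(2) [of \<one>] assms(1) by simp
  then show "lam z = c" by (simp add: lam_def)
  show "z \<in> Z"
    unfolding char_center_def using assms \<open>\<phi> z = c * \<phi> \<one>\<close> by simp
qed

lemma ker_iff: "z \<in> K \<longleftrightarrow> z \<in> Z \<and> lam z = 1"
proof
  assume z: "z \<in> K"
  have "\<phi> (a \<otimes> z) = 1 * \<phi> a" if "a \<in> carrier G" for a
    using z that unfolding char_ker_def by simp
  then show "z \<in> Z \<and> lam z = 1" using centerI [of z 1] z by simp
next
  assume "z \<in> Z \<and> lam z = 1"
  then show "z \<in> K" unfolding char_ker_def using center_mult_right [of z] by simp
qed

lemma one_center [simp]: "\<one> \<in> Z" "lam \<one> = 1"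
  using centerI [of \<one> 1] by auto

lemma center_m_closed:
  assumes "y \<in> Z" "z \<in> Z"
  shows "y \<otimes> z \<in> Z" "lam (y \<otimes> z) = lam y * lam z"
proof -
  have *: "\<phi> (a \<otimes> (y \<otimes> z)) = (lam y * lam z) * \<phi> a" if "a \<in> carrier G" for a
    using that assms center_mult_right [of z "a \<otimes> y"] center_mult_right [of y a] by (simp add: m_assoc)
  show "y \<otimes> z \<in> Z" "lam (y \<otimes> z) = lam y * lam z"
    by (rule centerI [OF _ *], use assms in simp, assumption)+
qed

lemma lam_nonzero:
  assumes "z \<in> Z" shows "lam z \<noteq> 0"
  using center_mult_right [OF assms, of "inv z"] assms by auto

lemma center_inv:
  assumes "z \<in> Z"
  shows "inv z \<in> Z" "lam (inv z) = inverse (lam z)"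
proof -
  have *: "\<phi> (a \<otimes> inv z) = inverse (lam z) * \<phi> a" if "a \<in> carrier G" for a
    using that assms center_mult_right [OF assms, of "a \<otimes> inv z"] lam_nonzero [OF assms]
    by (simp add: m_assoc field_simps)
  show "inv z \<in> Z" "lam (inv z) = inverse (lam z)"
    by (rule centerI [OF _ *], use assms in simp, assumption)+
qed

lemma center_conj:
  assumes "z \<in> Z" "g \<in> carrier G"
  shows "g \<otimes> z \<otimes> inv g \<in> Z" "lam (g \<otimes> z \<otimes> inv g) = lam z"
proof -
  have *: "\<phi> (a \<otimes> (g \<otimes> z \<otimes> inv g)) = lam z * \<phi> a" if "a \<in> carrier G" for a
    using that assms center_mult [of z "a \<otimes> g" "inv g"] by (simp add: word_simps)
  show "g \<otimes> z \<otimes> inv g \<in> Z" "lam (g \<otimes> z \<otimes> inv g) = lam z"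
    by (rule centerI [OF _ *], use assms in simp, assumption)+
qed

lemma center_pow:
  assumes "z \<in> Z"
  shows "z [^] (n::nat) \<in> Z" "lam (z [^] n) = lam z ^ n"
  using assms by (induction n) (auto simp: center_m_closed)

lemma normal_center: "Z \<lhd> G"
proof -
  have "subgroup Z G"
  proof (rule subgroupI)
    show "Z \<noteq> {}" using one_center(1) by blast
  qed (auto simp: center_m_closed center_inv)
  then show ?thesis by (simp add: normal_inv_iff center_conj)
qed

lemma normal_ker: "K \<lhd> G"
proof -
  have "subgroup K G"
  proof (rule subgroupI)
    have "\<one> \<in> K" by (simp add: ker_iff)
    then show "K \<noteq> {}" by blast
  qed (auto simp: ker_iff center_m_closed center_inv)
  then show ?thesis by (simp add: normal_inv_iff ker_iff center_conj)
qed

text \<open>In other words, Z/K is the centre of G/K. If all commutators with \<open>z\<close> lie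
  in \<open>K\<close>, every term of the convolution sum for \<open>a\<close> and \<open>z\<close>
  equals \<phi>(a z), and the identity turns into the defining equation of \<open>Z\<close>.\<close>

lemma center_iff: "z \<in> Z \<longleftrightarrow> z \<in> carrier G \<and> (\<forall>g\<in>carrier G. commutator g z \<in> K)"
proof safe
  fix g assume z: "z \<in> Z" and g: "g \<in> carrier G"
  have "g \<otimes> z \<otimes> inv g \<in> Z" "lam (g \<otimes> z \<otimes> inv g) = lam z"
    using center_conj [OF z g] by auto
  then show "commutator g z \<in> K"
    using z g by (simp add: ker_iff commutator_def center_m_closed center_inv lam_nonzero)
next
  assume z: "z \<in> carrier G" and c: "\<forall>g\<in>carrier G. commutator g z \<in> K"
  have *: "\<phi> (a \<otimes> (h \<otimes> z \<otimes> inv h)) = \<phi> (a \<otimes> z)" if "a \<in> carrier G" "h \<in> carrier G" for a h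
    using that z c center_mult [of "commutator h z" a z] by (simp add: conj_eq_commutator ker_iff)
  have "\<phi> \<one> * \<phi> (a \<otimes> z) = \<phi> a * \<phi> z" if "a \<in> carrier G" for a
  proof -
    have "(\<Sum>h\<in>carrier G. \<phi> (a \<otimes> (h \<otimes> z \<otimes> inv h))) = of_nat (card (carrier G)) * \<phi> (a \<otimes> z)"
      using * [OF that] by simp
    then show ?thesis using convolution [OF that z] card_pos by simp
  qed
  then show "z \<in> Z" using z unfolding char_center_def by blast
qed auto

lemma group_center_subset:
  "z \<in> carrier G \<Longrightarrow> (\<And>g. g \<in> carrier G \<Longrightarrow> g \<otimes> z = z \<otimes> g) \<Longrightarrow> z \<in> Z"
  unfolding center_iff by (auto simp: commutator_def m_assoc ker_iff)

text \<open>Conjugation fixes \<phi>(x) and also multiplies it by the scalar of the commutator, so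
  that scalar is 1. Together with vanishing off \<open>M\<close>, this is how a nonzero value
  becomes information about the group.\<close>

lemma commutator_ker_if_nonzero:
  assumes x: "x \<in> carrier G" "\<phi> x \<noteq> 0" and g: "g \<in> carrier G" and c: "commutator g x \<in> Z"
  shows "commutator g x \<in> K"
proof -
  have "\<phi> x = \<phi> (commutator g x \<otimes> x)"
    using char_conj [OF g x(1)] g x by (simp add: conj_eq_commutator)
  also have "\<dots> = lam (commutator g x) * \<phi> x"
    using center_mult [OF c, of \<one> x] c x by simp
  finally show ?thesis using x c by (simp add: ker_iff)
qed

end

section \<open>Clifford constituents on a subgroup of index p\<close>

text \<open>For sums over residues modulo p whose exponents stay natural numbers and are never
  reduced.\<close>

lemma sum_periodic_shift:
  fixes f :: "nat \<Rightarrow> 'a :: ab_group_add"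
  assumes "\<And>j. f (j + p) = f j"
  shows "(\<Sum>j<p. f (j + l)) = (\<Sum>j<p. f j)"
proof (induction l)
  case (Suc l)
  have "(\<Sum>j<p. f (j + l)) + f (p + l) = f l + (\<Sum>j<p. f (j + Suc l))"
    using sum.lessThan_Suc_shift [of "\<lambda>j. f (j + l)" p] by simp
  then show ?case using Suc assms [of l] by (simp add: add.commute)
qed simp

lemma sum_root_of_unity:
  fixes w :: complex
  assumes "w ^ p = 1"
  shows "(\<Sum>j<p. w ^ j) = (if w = 1 then of_nat p else 0)"
  using assms by (simp add: sum_gp_strict)

lemma root_of_unity_power_neq_1:
  fixes w :: complex
  assumes "Factorial_Ring.prime (p :: nat)" "w ^ p = 1" "w \<noteq> 1" "0 < j" "j < p"
  shows "w ^ j \<noteq> 1"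
proof
  assume j: "w ^ j = 1"
  have "coprime j p"
    using assms by (metis coprime_commute nat_dvd_not_less prime_imp_coprime_nat)
  then obtain a b where "j * a = p * b + 1"
    using bezout_nat [of j p] assms(4) by auto
  then have "w ^ (j * a) = w ^ (p * b + 1)" by simp
  then show False using assms j by (simp only: power_add power_mult) simp
qed

text \<open>Modulo \<open>Z\<close>, \<open>y\<close> is central of order p. In a representation
  \<open>y\<close> would act by a nonscalar operator whose p-th power is scalar, and
  \<open>G\<close> would permute its eigenspaces; here this is expressed through values of \<phi>
  alone.\<close>

locale clifford = irr_char +
  fixes p :: nat and y
  assumes prime: "Factorial_Ring.prime p"
    and y: "y \<in> carrier G" "y \<notin> Z"
    and comm_y: "g \<in> carrier G \<Longrightarrow> commutator g y \<in> Z"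
    and y_pow: "y [^] p \<in> Z"
begin

text \<open>\<open>c\<close> is a linear character of \<open>G\<close> with values in the \<open>p\<close>-th roots of unity, and \<open>psi t\<close> is the
  constituent of the restriction of \<open>\<phi>\<close> to \<open>M\<close> on which \<open>y\<close> acts as the scalar \<open>t\<close>, a \<open>p\<close>-th root of
  \<open>lam (y\<^sup>p)\<close>.\<close>

definition "c g = lam (commutator g y)"
definition "M = {g \<in> carrier G. c g = 1}"
definition "psi t m = (\<Sum>j<p. inverse t ^ j * \<phi> (m \<otimes> y [^] j)) / of_nat p"

lemma p_pos: "p > 0" using prime by (rule prime_gt_0_nat)

lemma y_pow_closed [simp]: "y [^] (j::nat) \<in> carrier G"
  using y by simp

lemma M_closed: "g \<in> M \<Longrightarrow> g \<in> carrier G" by (simp add: M_def)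

text \<open>The conjugated power is a product of j factors [g,y] y, each contributing the scalar
  c(g). The free context \<open>u\<close>, \<open>v\<close> serves the induction, where
  \<open>v\<close> absorbs factors of \<open>y\<close>, and later words with the power in the
  middle.\<close>

lemma conj_y_pow:
  assumes "u \<in> carrier G" "g \<in> carrier G" "v \<in> carrier G"
  shows "\<phi> (u \<otimes> ((g \<otimes> y [^] (j::nat) \<otimes> inv g) \<otimes> v)) = c g ^ j * \<phi> (u \<otimes> (y [^] j \<otimes> v))"
  using assms(3)
proof (induction j arbitrary: v)
  case 0
  then show ?case using assms by simp
next
  case (Suc j)
  have "(g \<otimes> y [^] Suc j \<otimes> inv g) \<otimes> v = (g \<otimes> y [^] j \<otimes> inv g) \<otimes> (commutator g y \<otimes> (y \<otimes> v))"
    using assms Suc.prems y by (simp add: commutator_def word_simps)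
  then have "\<phi> (u \<otimes> ((g \<otimes> y [^] Suc j \<otimes> inv g) \<otimes> v))
      = c g ^ j * \<phi> (u \<otimes> (y [^] j \<otimes> (commutator g y \<otimes> (y \<otimes> v))))"
    using Suc.IH [of "commutator g y \<otimes> (y \<otimes> v)"] assms Suc.prems y by simp
  also have "\<dots> = c g ^ j * (c g * \<phi> (u \<otimes> y [^] j \<otimes> (y \<otimes> v)))"
    using center_mult [OF comm_y [OF assms(2)], of "u \<otimes> y [^] j" "y \<otimes> v"] assms Suc.prems y
    by (simp add: m_assoc c_def)
  finally show ?case using assms Suc.prems y by (simp add: m_assoc)
qed

lemma conj_y:
  assumes "u \<in> carrier G" "g \<in> carrier G" "v \<in> carrier G"
  shows "\<phi> (u \<otimes> ((g \<otimes> y \<otimes> inv g) \<otimes> v)) = c g * \<phi> (u \<otimes> (y \<otimes> v))"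
  using conj_y_pow [OF assms, of 1] y by simp

lemma c_eq:
  assumes "g \<in> carrier G"
  shows "\<phi> (inv y \<otimes> (g \<otimes> y \<otimes> inv g)) = c g * \<phi> \<one>"
  using conj_y [of "inv y" g \<one>] assms y by simp

text \<open>Evaluate \<phi> at y\<inverse> (g h) y (g h)\<inverse> and replace the inner conjugate
  of \<open>y\<close> first, then the outer one.\<close>

lemma c_mult:
  assumes g: "g \<in> carrier G" and h: "h \<in> carrier G"
  shows "c (g \<otimes> h) = c g * c h"
proof -
  have "c (g \<otimes> h) * \<phi> \<one> = \<phi> (inv y \<otimes> g \<otimes> (h \<otimes> y \<otimes> inv h) \<otimes> inv g)"
    using c_eq [of "g \<otimes> h"] g h y by (simp add: word_simps)
  also have "\<dots> = \<phi> (inv y \<otimes> g \<otimes> ((h \<otimes> y \<otimes> inv h) \<otimes> inv g))"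
    using g h y by (simp add: m_assoc)
  also have "\<dots> = c h * \<phi> (inv y \<otimes> (g \<otimes> y \<otimes> inv g))"
    using conj_y [of "inv y \<otimes> g" h "inv g"] g h y by (simp add: m_assoc)
  also have "\<dots> = c h * (c g * \<phi> \<one>)" using c_eq [OF g] by simp
  finally show ?thesis by simp
qed

lemma c_one: "c \<one> = 1"
  using c_eq [of \<one>] y by simp

lemma c_inv: "g \<in> carrier G \<Longrightarrow> c (inv g) = inverse (c g)"
  using c_mult [of g "inv g"] c_one by (intro inverse_unique [symmetric]) simp

text \<open>Conjugation by \<open>g\<close> multiplies \<phi>(y^p) by c(g)^p and yet fixes it; the
  value is nonzero because y^p lies in \<open>Z\<close>.\<close>

lemma c_pow_prime:
  assumes g: "g \<in> carrier G" shows "c g ^ p = 1"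
proof -
  have "\<phi> (g \<otimes> y [^] p \<otimes> inv g) = c g ^ p * \<phi> (y [^] p)"
    using conj_y_pow [of \<one> g \<one> p] g by simp
  then have "\<phi> (y [^] p) = c g ^ p * \<phi> (y [^] p)"
    by (simp only: char_conj [OF g y_pow_closed])
  moreover have "\<phi> (y [^] p) \<noteq> 0"
    using lam_nonzero [OF y_pow] by (simp add: lam_def)
  ultimately show ?thesis by simp
qed

lemma subgroup_M: "subgroup M G"
proof (rule subgroupI)
  show "M \<noteq> {}" using c_one by (auto simp: M_def)
qed (auto simp: M_def c_mult c_inv)

lemma M_conj: "g \<in> carrier G \<Longrightarrow> m \<in> M \<Longrightarrow> g \<otimes> m \<otimes> inv g \<in> M"
  using c_inv [of g] c_mult [of g "inv g"] c_one by (auto simp: M_def c_mult)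

lemma center_subset_M: "Z \<subseteq> M"
proof
  fix z assume z: "z \<in> Z"
  have "c z * \<phi> \<one> = lam z * \<phi> (inv y \<otimes> (y \<otimes> inv z))"
    using c_eq [of z] center_mult [OF z, of "inv y" "y \<otimes> inv z"] y z by (simp add: m_assoc)
  also have "\<dots> = \<phi> \<one>"
    using z y center_inv [OF z] lam_nonzero [OF z] by (simp add: char_eq_lam [of "inv z"])
  finally show "z \<in> M" using z by (simp add: M_def)
qed

lemma y_in_M: "y \<in> M"
  using c_eq [of y] y by (simp add: M_def m_assoc)

lemma obtain_c_neq_1: obtains g where "g \<in> carrier G" "c g \<noteq> 1"
  using y comm_y unfolding center_iff [of y] c_def by (auto simp: ker_iff)

lemma sum_c_power:
  assumes "0 < j" "j < p"
  shows "(\<Sum>g\<in>carrier G. c g ^ j) = 0"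
proof -
  obtain g1 where g1: "g1 \<in> carrier G" "c g1 \<noteq> 1" by (rule obtain_c_neq_1)
  have "(\<Sum>g\<in>carrier G. c g ^ j) = (\<Sum>g\<in>carrier G. c (g \<otimes> g1) ^ j)"
    using sum_translate [OF g1(1), of "\<lambda>g. c g ^ j"] by simp
  also have "\<dots> = (\<Sum>g\<in>carrier G. c g ^ j) * c g1 ^ j"
    using g1 by (simp add: c_mult power_mult_distrib sum_distrib_right)
  finally show ?thesis
    using root_of_unity_power_neq_1 [OF prime c_pow_prime [OF g1(1)] g1(2) assms] by simp
qed

text \<open>The average of c(g)^j over j < p is the indicator function of \<open>M\<close>. Summed
  over the group, only j = 0 contributes.\<close>

lemma index_M: "card (carrier G) = p * card M"
proof -
  have "(\<Sum>j<p. \<Sum>g\<in>carrier G. c g ^ j) = (\<Sum>j<p. if j = 0 then of_nat (card (carrier G)) else 0)"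
    by (rule sum.cong) (auto simp: sum_c_power)
  also have "\<dots> = of_nat (card (carrier G))" using p_pos by simp
  finally have "of_nat (card (carrier G)) = (\<Sum>g\<in>carrier G. \<Sum>j<p. c g ^ j)"
    by (simp add: sum.swap [of _ "carrier G"])
  also have "\<dots> = (\<Sum>g\<in>carrier G. if g \<in> M then of_nat p else 0)"
    by (rule sum.cong) (auto simp: sum_root_of_unity c_pow_prime M_def)
  also have "\<dots> = of_nat (p * card M)"
    using fin by (simp add: sum.If_cases M_def Int_def)
  finally show ?thesis by (simp only: of_nat_eq_iff)
qed

text \<open>Conjugating \<open>x\<close> by the inverse of \<open>y\<close> multiplies \<phi>(x) by
  c(x), which is not 1 off \<open>M\<close>.\<close>

lemma vanishes_off_M:
  assumes "x \<in> carrier G" "x \<notin> M"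
  shows "\<phi> x = 0"
proof -
  have "\<phi> x = \<phi> (inv y \<otimes> x \<otimes> y)"
    using char_conj [of "inv y" x] assms y by simp
  also have "\<dots> = \<phi> (inv y \<otimes> ((x \<otimes> y \<otimes> inv x) \<otimes> x))"
    using assms y by (simp add: m_assoc)
  also have "\<dots> = c x * \<phi> x" using conj_y [of "inv y" x x] assms y by simp
  finally show ?thesis using assms by (simp add: M_def)
qed

lemma y_pow_commute:
  assumes "u \<in> carrier G" "m \<in> M" "v \<in> carrier G"
  shows "\<phi> (u \<otimes> (y [^] (j::nat) \<otimes> (m \<otimes> v))) = \<phi> (u \<otimes> (m \<otimes> (y [^] j \<otimes> v)))"
  using conj_y_pow [of u m "m \<otimes> v" j] assms by (simp add: M_def m_assoc)

lemma psi_one: "psi t \<one> = \<phi> \<one> / of_nat p"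
proof -
  obtain g where g: "g \<in> carrier G" "c g \<noteq> 1" by (rule obtain_c_neq_1)
  have "\<phi> (y [^] j) = 0" if "0 < j" "j < p" for j
  proof -
    have "\<phi> (g \<otimes> y [^] j \<otimes> inv g) = c g ^ j * \<phi> (y [^] j)"
      using conj_y_pow [of \<one> g \<one> j] g by simp
    then have "\<phi> (y [^] j) = c g ^ j * \<phi> (y [^] j)"
      by (simp only: char_conj [OF g(1) y_pow_closed])
    then show ?thesis
      using root_of_unity_power_neq_1 [OF prime c_pow_prime [OF g(1)] g(2) that] by simp
  qed
  then have "(\<Sum>j<p. inverse t ^ j * \<phi> (\<one> \<otimes> y [^] j)) = (\<Sum>j<p. if j = 0 then \<phi> \<one> else 0)"
    by (intro sum.cong) auto
  then show ?thesis using p_pos by (simp add: psi_def)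
qed

context
  fixes t :: complex
  assumes t: "t ^ p = lam (y [^] p)"
begin

lemma t_nonzero: "t \<noteq> 0"
  using t lam_nonzero [OF y_pow] p_pos by (auto simp: power_0_left)

lemma periodic:
  assumes "u \<in> carrier G"
  shows "inverse t ^ (j + p) * \<phi> (u \<otimes> y [^] (j + p)) = inverse t ^ j * \<phi> (u \<otimes> y [^] j)"
proof -
  have "\<phi> (u \<otimes> y [^] (j + p)) = t ^ p * \<phi> (u \<otimes> y [^] j)"
    using center_mult_right [OF y_pow, of "u \<otimes> y [^] j"] assms y
    by (simp add: nat_pow_mult [symmetric] m_assoc t)
  then show ?thesis using t_nonzero by (simp add: power_add power_inverse)
qed

lemma psi_shift:
  assumes "u \<in> carrier G"
  shows "(\<Sum>j<p. inverse t ^ (j + l) * \<phi> (u \<otimes> y [^] (j + l))) = of_nat p * psi t u"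
  using sum_periodic_shift [of "\<lambda>j. inverse t ^ j * \<phi> (u \<otimes> y [^] j)" p l, OF periodic [OF assms]] p_pos
  by (simp add: psi_def)

lemma psi_mult_y:
  assumes "m \<in> carrier G"
  shows "psi t (m \<otimes> y) = t * psi t m"
proof -
  have "y \<otimes> y [^] j = y [^] (j + 1)" for j :: nat
    using y nat_pow_Suc2 [of y j] by simp
  then have "psi t (m \<otimes> y) = t * (\<Sum>j<p. inverse t ^ (j + 1) * \<phi> (m \<otimes> y [^] (j + 1))) / of_nat p"
    unfolding psi_def sum_distrib_left
    by (intro arg_cong2 [where f = "(/)"] sum.cong refl) (use assms y t_nonzero in \<open>simp add: m_assoc\<close>)
  then show ?thesis using psi_shift [OF assms, of 1] p_pos by simp
qed

lemma psi_mult_center: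
  assumes "m \<in> carrier G" "z \<in> Z"
  shows "psi t (m \<otimes> z) = lam z * psi t m"
  using assms center_mult [OF assms(2), of m] 
  by (simp add: psi_def m_assoc sum_distrib_left mult.left_commute)

text \<open>Expand the product of the two \<open>psi\<close> values and apply the identity for
  \<phi> to a y^j and b y^l. Conjugating y^l by \<open>g\<close> brings out c(g)^l; the sum over j
  gives p psi(a b^g) whatever l is, and the remaining sum of c(g)^l over l vanishes unless
  \<open>g\<close> is in \<open>M\<close>. Thus a sum over \<open>G\<close> becomes one over
  \<open>M\<close>, and the index p balances the constants.\<close>

lemma psi_convolution:
  assumes a: "a \<in> M" and b: "b \<in> M"
  shows "psi t \<one> * (\<Sum>h\<in>M. psi t (a \<otimes> (h \<otimes> b \<otimes> inv h))) = of_nat (card M) * psi t a * psi t b"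
proof -
  let ?i = "inverse t"
  have [simp]: "a \<in> carrier G" "b \<in> carrier G" using a b by (simp_all add: M_closed)
  have expand: "\<phi> (a \<otimes> y [^] j \<otimes> (g \<otimes> (b \<otimes> y [^] l) \<otimes> inv g))
      = c g ^ l * \<phi> (a \<otimes> (g \<otimes> b \<otimes> inv g) \<otimes> y [^] (j + l))"
    if g: "g \<in> carrier G" for g and j l :: nat
  proof -
    have w: "g \<otimes> b \<otimes> inv g \<in> M" using M_conj [OF g b] .
    have "\<phi> (a \<otimes> y [^] j \<otimes> (g \<otimes> (b \<otimes> y [^] l) \<otimes> inv g))
        = \<phi> (a \<otimes> y [^] j \<otimes> (g \<otimes> b \<otimes> inv g) \<otimes> ((g \<otimes> y [^] l \<otimes> inv g) \<otimes> \<one>))"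
      using a b g by (simp add: word_simps)
    also have "\<dots> = c g ^ l * \<phi> (a \<otimes> (y [^] j \<otimes> ((g \<otimes> b \<otimes> inv g) \<otimes> y [^] l)))"
      using conj_y_pow [of "a \<otimes> y [^] j \<otimes> (g \<otimes> b \<otimes> inv g)" g \<one> l] a b g by (simp add: m_assoc)
    also have "\<dots> = c g ^ l * \<phi> (a \<otimes> ((g \<otimes> b \<otimes> inv g) \<otimes> (y [^] j \<otimes> y [^] l)))"
      using y_pow_commute [OF _ w, of a "y [^] l" j] a by simp
    finally show ?thesis using a b g y by (simp add: m_assoc nat_pow_mult)
  qed
  have inner: "(\<Sum>j<p. \<Sum>l<p. ?i ^ j * ?i ^ l * \<phi> (a \<otimes> y [^] j \<otimes> (g \<otimes> (b \<otimes> y [^] l) \<otimes> inv g)))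
      = (if g \<in> M then of_nat p * of_nat p * psi t (a \<otimes> (g \<otimes> b \<otimes> inv g)) else 0)"
    if g: "g \<in> carrier G" for g
  proof -
    let ?u = "a \<otimes> (g \<otimes> b \<otimes> inv g)"
    have "(\<Sum>j<p. \<Sum>l<p. ?i ^ j * ?i ^ l * \<phi> (a \<otimes> y [^] j \<otimes> (g \<otimes> (b \<otimes> y [^] l) \<otimes> inv g)))
      = (\<Sum>l<p. \<Sum>j<p. c g ^ l * (?i ^ (j + l) * \<phi> (?u \<otimes> y [^] (j + l))))"
      by (subst sum.swap) (intro sum.cong refl, simp add: expand [OF g] power_add)
    also have "\<dots> = (\<Sum>l<p. c g ^ l * (of_nat p * psi t ?u))"
      by (intro sum.cong refl) (use a b g in \<open>simp add: psi_shift sum_distrib_left [symmetric]\<close>)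
    also have "\<dots> = (\<Sum>l<p. c g ^ l) * (of_nat p * psi t ?u)"
      by (simp add: sum_distrib_right)
    finally show ?thesis using g by (simp add: sum_root_of_unity c_pow_prime M_def)
  qed
  have "of_nat (card (carrier G)) * (of_nat p * psi t a) * (of_nat p * psi t b)
      = (\<Sum>j<p. \<Sum>l<p. ?i ^ j * ?i ^ l * (of_nat (card (carrier G)) * \<phi> (a \<otimes> y [^] j) * \<phi> (b \<otimes> y [^] l)))"
  proof -
    have "of_nat p * psi t u = (\<Sum>j<p. ?i ^ j * \<phi> (u \<otimes> y [^] j))" for u
      using p_pos by (simp add: psi_def)
    then show ?thesis by (simp only: sum_product sum_distrib_left mult_ac)
  qed
  also have "\<dots> = (\<Sum>j<p. \<Sum>l<p. ?i ^ j * ?i ^ l *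
      (\<phi> \<one> * (\<Sum>g\<in>carrier G. \<phi> (a \<otimes> y [^] j \<otimes> (g \<otimes> (b \<otimes> y [^] l) \<otimes> inv g)))))"
    using convolution a b by (intro sum.cong refl) simp
  also have "\<dots> = \<phi> \<one> * (\<Sum>g\<in>carrier G. \<Sum>j<p. \<Sum>l<p.
      ?i ^ j * ?i ^ l * \<phi> (a \<otimes> y [^] j \<otimes> (g \<otimes> (b \<otimes> y [^] l) \<otimes> inv g)))"
    by (simp add: sum_distrib_left sum.swap [of _ _ "carrier G"] mult_ac)
  also have "\<dots> = \<phi> \<one> * (\<Sum>g\<in>carrier G. if g \<in> M then of_nat p * of_nat p * psi t (a \<otimes> (g \<otimes> b \<otimes> inv g)) else 0)"
    using inner by simp
  also have "\<dots> = \<phi> \<one> * (of_nat p * of_nat p * (\<Sum>g\<in>M. psi t (a \<otimes> (g \<otimes> b \<otimes> inv g))))"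
    using fin by (simp add: sum.If_cases M_def Int_def sum_distrib_left)
  finally show ?thesis
    using p_pos by (simp add: index_M psi_one field_simps)
qed

text \<open>Expanding both factors leaves correlations of \<phi> with its shifts by y^s. They extend
  from \<open>M\<close> to \<open>G\<close> because \<phi> vanishes elsewhere, and only the shift s
  = 0 modulo p survives.\<close>

lemma psi_norm: "(\<Sum>h\<in>M. psi t h * psi t (inv h)) = of_nat (card M)"
proof -
  let ?i = "inverse t"
  obtain g1 where g1: "g1 \<in> carrier G" "c g1 \<noteq> 1" by (rule obtain_c_neq_1)
  define F where "F s = (\<Sum>g\<in>carrier G. \<phi> g * \<phi> (inv g \<otimes> y [^] s))" for s :: nat
  have F0: "F 0 = of_nat (card (carrier G))"
    using norm by (simp add: F_def)
  \<comment> \<open>Reindexing the sum by conjugation with \<open>g1\<close> multiplies it by a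
    power of c(g1) different from 1.\<close>
  have F: "F s = 0" if "0 < s" "s < p" for s
  proof -
    have "F s = (\<Sum>g\<in>carrier G. \<phi> (g1 \<otimes> g \<otimes> inv g1) * \<phi> (inv (g1 \<otimes> g \<otimes> inv g1) \<otimes> y [^] s))"
      unfolding F_def by (rule sum_conj [OF g1(1), symmetric])
    also have "\<dots> = (\<Sum>g\<in>carrier G. \<phi> g * (c (inv g1) ^ s * \<phi> (inv g \<otimes> y [^] s)))"
    proof (rule sum.cong)
      fix g assume g: "g \<in> carrier G"
      have "\<phi> (inv (g1 \<otimes> g \<otimes> inv g1) \<otimes> y [^] s) = \<phi> (g1 \<otimes> (inv g \<otimes> (inv g1 \<otimes> y [^] s \<otimes> g1)) \<otimes> inv g1)"
        using g g1 by (simp add: word_simps)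
      also have "\<dots> = \<phi> (inv g \<otimes> ((inv g1 \<otimes> y [^] s \<otimes> g1) \<otimes> \<one>))"
        using char_conj [OF g1(1)] g g1 by simp
      also have "\<dots> = c (inv g1) ^ s * \<phi> (inv g \<otimes> y [^] s)"
        using conj_y_pow [of "inv g" "inv g1" \<one> s] g g1 by simp
      finally show "\<phi> (g1 \<otimes> g \<otimes> inv g1) * \<phi> (inv (g1 \<otimes> g \<otimes> inv g1) \<otimes> y [^] s)
          = \<phi> g * (c (inv g1) ^ s * \<phi> (inv g \<otimes> y [^] s))"
        using char_conj [OF g1(1) g] by simp
    qed simp
    also have "\<dots> = c (inv g1) ^ s * F s"
      by (simp add: F_def sum_distrib_left mult_ac)
    finally have "F s = c (inv g1) ^ s * F s" .
    moreover have "c (inv g1) ^ s \<noteq> 1"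
      using root_of_unity_power_neq_1 [OF prime c_pow_prime [of "inv g1"] _ that] g1 by (simp add: c_inv)
    ultimately show ?thesis by simp
  qed
  have inner: "(\<Sum>h\<in>M. \<phi> (h \<otimes> y [^] j) * \<phi> (inv h \<otimes> y [^] l)) = F (j + l)" for j l :: nat
  proof -
    have yj: "y [^] j \<in> M"
      using y_in_M subgroup_M by (induction j) (auto simp: subgroup.one_closed subgroup.m_closed)
    have off: "\<phi> (h \<otimes> y [^] j) = 0" if "h \<in> carrier G - M" for h
    proof (rule vanishes_off_M)
      show "h \<otimes> y [^] j \<notin> M"
        using that yj c_mult [of h "y [^] j"] by (auto simp: M_def)
    qed (use that in simp)
    have "(\<Sum>h\<in>M. \<phi> (h \<otimes> y [^] j) * \<phi> (inv h \<otimes> y [^] l))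
        = (\<Sum>h\<in>carrier G. \<phi> (h \<otimes> y [^] j) * \<phi> (inv h \<otimes> y [^] l))"
      by (rule sum.mono_neutral_left) (use fin off subgroup.subset [OF subgroup_M] in auto)
    also have "\<dots> = (\<Sum>h\<in>carrier G. \<phi> (h \<otimes> y [^] j) * \<phi> (inv (h \<otimes> y [^] j) \<otimes> y [^] (j + l)))"
    proof (rule sum.cong)
      fix h assume h: "h \<in> carrier G"
      have "\<phi> (inv (h \<otimes> y [^] j) \<otimes> y [^] (j + l)) = \<phi> (inv (y [^] j) \<otimes> (inv h \<otimes> (y [^] l \<otimes> y [^] j)))"
        using h y by (simp add: word_simps nat_pow_mult add.commute)
      also have "\<dots> = \<phi> (inv h \<otimes> y [^] l)"
        using char_comm [of "inv (y [^] j)" "inv h \<otimes> (y [^] l \<otimes> y [^] j)"] h by (simp add: m_assoc)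
      finally show "\<phi> (h \<otimes> y [^] j) * \<phi> (inv h \<otimes> y [^] l)
          = \<phi> (h \<otimes> y [^] j) * \<phi> (inv (h \<otimes> y [^] j) \<otimes> y [^] (j + l))" by simp
    qed simp
    also have "\<dots> = F (j + l)"
      unfolding F_def by (rule sum_translate [of "y [^] j" "\<lambda>h. \<phi> h * \<phi> (inv h \<otimes> y [^] (j + l))"]) simp
    finally show ?thesis .
  qed
  have per: "?i ^ (j + p) * F (j + p) = ?i ^ j * F j" for j
    unfolding F_def sum_distrib_left
    by (intro sum.cong refl) (use periodic in \<open>simp add: mult.left_commute\<close>)
  have "of_nat p * of_nat p * (\<Sum>h\<in>M. psi t h * psi t (inv h))
      = (\<Sum>h\<in>M. (of_nat p * psi t h) * (of_nat p * psi t (inv h)))"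
    by (simp add: sum_distrib_left mult_ac)
  also have "\<dots> = (\<Sum>h\<in>M. \<Sum>j<p. \<Sum>l<p. ?i ^ (j + l) * (\<phi> (h \<otimes> y [^] j) * \<phi> (inv h \<otimes> y [^] l)))"
    using p_pos by (simp add: psi_def sum_product power_add mult_ac)
  also have "\<dots> = (\<Sum>j<p. \<Sum>l<p. ?i ^ (j + l) * F (j + l))"
    by (simp add: inner [symmetric] sum_distrib_left sum.swap [of _ _ M])
  also have "\<dots> = (\<Sum>l<p. \<Sum>j<p. ?i ^ (j + l) * F (j + l))" by (rule sum.swap)
  also have "\<dots> = (\<Sum>l<p. \<Sum>j<p. ?i ^ j * F j)"
    using sum_periodic_shift [of "\<lambda>j. ?i ^ j * F j" p, OF per] by simp
  also have "(\<Sum>j<p. ?i ^ j * F j) = (\<Sum>j<p. if j = 0 then of_nat (card (carrier G)) else 0)"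
    by (rule sum.cong) (auto simp: F F0)
  finally show ?thesis using p_pos by (simp add: index_M)
qed

lemma irr_char_psi: "irr_char (G\<lparr>carrier := M\<rparr>) (psi t)"
proof -
  interpret M: group "G\<lparr>carrier := M\<rparr>"
    by (rule subgroup_imp_group [OF subgroup_M])
  have inv: "inv\<^bsub>G\<lparr>carrier := M\<rparr>\<^esub> h = inv h" if "h \<in> M" for h
    using m_inv_consistent [OF subgroup_M that] .
  show ?thesis
  proof
    show "finite (carrier (G\<lparr>carrier := M\<rparr>))"
      using fin finite_subset [of M "carrier G"] M_closed by auto
  qed (use psi_convolution psi_norm in \<open>simp_all add: inv\<close>)
qed

end

text \<open>Fourier inversion: \<open>psi t\<close> is a discrete Fourier transform along the powers
  of \<open>y\<close>, and \<open>r\<close> runs through t w^i with w a nontrivial p-th root of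
  unity. Summing over i kills every term except j = 0.\<close>

lemma obtain_constituents:
  obtains r where "\<And>i. r i ^ p = lam (y [^] p)"
    "\<And>x. x \<in> carrier G \<Longrightarrow> \<phi> x = (\<Sum>i<p. psi (r i) x)"
proof -
  obtain g where g: "g \<in> carrier G" "c g \<noteq> 1" by (rule obtain_c_neq_1)
  define w where "w = c g"
  have w: "w ^ p = 1" "w \<noteq> 1" "w \<noteq> 0" using c_pow_prime [OF g(1)] g p_pos by (auto simp: w_def power_0_left)
  have "card {t. t ^ p = lam (y [^] p)} = p"
    using card_nth_roots [OF lam_nonzero [OF y_pow] p_pos] .
  then obtain t where t: "t ^ p = lam (y [^] p)" using p_pos by (metis (mono_tags) card.empty empty_Collect_eq less_irrefl)
  have roots: "(t * w ^ i) ^ p = lam (y [^] p)" for i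
    using t w by (simp add: power_mult_distrib) (simp flip: power_mult add: mult.commute [of _ p], simp add: power_mult)
  have "\<phi> x = (\<Sum>i<p. psi (t * w ^ i) x)" if x: "x \<in> carrier G" for x
  proof -
    have "of_nat p * (\<Sum>i<p. psi (t * w ^ i) x)
        = (\<Sum>i<p. \<Sum>j<p. (inverse w ^ j) ^ i * (inverse t ^ j * \<phi> (x \<otimes> y [^] j)))"
    proof -
      have "of_nat p * psi (t * w ^ i) x = (\<Sum>j<p. (inverse w ^ j) ^ i * (inverse t ^ j * \<phi> (x \<otimes> y [^] j)))" for i
        using p_pos by (simp add: psi_def power_mult_distrib power_inverse mult_ac flip: power_mult)
      then show ?thesis by (simp only: sum_distrib_left)
    qed
    also have "\<dots> = (\<Sum>j<p. (\<Sum>i<p. (inverse w ^ j) ^ i) * (inverse t ^ j * \<phi> (x \<otimes> y [^] j)))"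
      by (subst sum.swap) (simp add: sum_distrib_right)
    also have "\<dots> = (\<Sum>j<p. if j = 0 then of_nat p * \<phi> x else 0)"
    proof (rule sum.cong)
      fix j assume j: "j \<in> {..<p}"
      have "(inverse w ^ j) ^ p = 1"
        using w by (simp add: power_inverse flip: power_mult) (simp add: mult.commute [of j] power_mult)
      moreover have "inverse w ^ j \<noteq> 1" if "j > 0"
        using root_of_unity_power_neq_1 [OF prime w(1,2) that] j by (simp add: power_inverse)
      ultimately show "(\<Sum>i<p. (inverse w ^ j) ^ i) * (inverse t ^ j * \<phi> (x \<otimes> y [^] j))
          = (if j = 0 then of_nat p * \<phi> x else 0)"
        using x by (cases "j = 0") (auto simp: sum_root_of_unity)
    qed simp
    also have "\<dots> = of_nat p * \<phi> x" using p_pos by simp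
    finally show ?thesis using p_pos by simp
  qed
  with roots show ?thesis using that [of "\<lambda>i. t * w ^ i"] by blast
qed

lemma obtain_constituent:
  assumes x: "x \<in> carrier G" "\<phi> x \<noteq> 0"
  obtains t where "t ^ p = lam (y [^] p)" "psi t x \<noteq> 0"
proof -
  obtain r where r: "\<And>i. r i ^ p = lam (y [^] p)"
    "\<And>x. x \<in> carrier G \<Longrightarrow> \<phi> x = (\<Sum>i<p. psi (r i) x)"
    by (rule obtain_constituents) blast
  have "\<exists>i. psi (r i) x \<noteq> 0"
  proof (rule ccontr)
    assume "\<not> (\<exists>i. psi (r i) x \<noteq> 0)"
    then show False using r(2) [OF x(1)] x(2) by simp
  qed
  then show ?thesis using r(1) that by blast
qed

end

section \<open>Finite p-groups\<close>

lemma (in group) card_subgroup_dvd: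
  assumes "subgroup A G" "subgroup B G" "A \<subseteq> B" 
  shows "card A dvd card B"
proof -
  interpret B: group "G\<lparr>carrier := B\<rparr>" using assms by (simp add: subgroup_imp_group)
  have "card (rcosets\<^bsub>G\<lparr>carrier := B\<rparr>\<^esub> A) * card A = Coset.order (G\<lparr>carrier := B\<rparr>)"
    by (rule B.lagrange) (use assms subgroup_incl in blast)
  then have "card (rcosets\<^bsub>G\<lparr>carrier := B\<rparr>\<^esub> A) * card A = card B" by (simp add: Coset.order_def)
  then show ?thesis by (metis dvd_triv_right)
qed

locale pgroup = group G for G :: "('a, 'b) monoid_scheme" (structure) +
  fixes p :: nat
  assumes fin: "finite (carrier G)"
    and prime: "Factorial_Ring.prime p"
    and card_eq: "\<exists>n. card (carrier G) = p ^ n"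
begin

lemma p_gt_1: "p > 1" using prime by (rule prime_gt_1_nat)

lemma finite_subgroup: "subgroup A G \<Longrightarrow> finite A"
  using fin finite_subset subgroup.subset by blast

lemma card_subgroup: "subgroup A G \<Longrightarrow> \<exists>n. card A = p ^ n"
proof -
  assume A: "subgroup A G"
  obtain n where "card (carrier G) = p ^ n" using card_eq by blast
  then show ?thesis
    using card_subgroup_dvd [OF A subgroup_self subgroup.subset [OF A]] divides_primepow_nat [OF prime, of "card A" n] by auto
qed

lemma ord_eq_power: "x \<in> carrier G \<Longrightarrow> \<exists>n. ord x = p ^ n"
proof -
  assume x: "x \<in> carrier G"
  obtain n where "card (carrier G) = p ^ n" using card_eq by blast
  then show ?thesis
    using ord_dvd_group_order [OF x] divides_primepow_nat [OF prime, of "ord x" n] by (auto simp: Coset.order_def)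
qed

lemma card_proper_subgroup:
  assumes "subgroup A G" "subgroup B G" "A \<subset> B"
  shows "p * card A \<le> card B"
proof -
  obtain m n where mn: "card A = p ^ m" "card B = p ^ n" using card_subgroup assms by metis
  have "card A < card B" using assms finite_subgroup psubset_card_mono by blast
  then have "m < n" using mn p_gt_1 by simp
  then have "p ^ Suc m \<le> p ^ n" using p_gt_1 by (intro power_increasing) auto
  then show ?thesis using mn by simp
qed

lemma pgroup_subgroup: "subgroup A G \<Longrightarrow> pgroup (G\<lparr>carrier := A\<rparr>) p"
  using card_subgroup finite_subgroup prime subgroup_imp_group
  by (simp add: pgroup_def pgroup_axioms_def)

end

text \<open>The preimage in \<open>G\<close> of the centre of \<open>G/N\<close>; for \<open>N = {\<one>}\<close> it is the centre of \<open>G\<close>.\<close>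

definition (in group) center_mod :: "'a set \<Rightarrow> 'a set" where
  "center_mod N = {y \<in> carrier G. \<forall>g\<in>carrier G. commutator g y \<in> N}"

lemma (in group) normal_conj: "N \<lhd> G \<Longrightarrow> g \<in> carrier G \<Longrightarrow> h \<in> N \<Longrightarrow> g \<otimes> h \<otimes> inv g \<in> N"
  by (simp add: normal_inv_iff)

lemma (in group) subgroup_center_mod:
  assumes N: "N \<lhd> G"
  shows "subgroup (center_mod N) G"
proof -
  interpret N: normal N G by fact
  show ?thesis
  proof (rule subgroupI)
    show "center_mod N \<subseteq> carrier G" by (auto simp: center_mod_def)
    have "\<one> \<in> center_mod N" by (simp add: center_mod_def commutator_def)
    then show "center_mod N \<noteq> {}" by blast
  next
    fix x assume x: "x \<in> center_mod N"
    have "commutator g (inv x) = inv x \<otimes> inv (commutator g x) \<otimes> inv (inv x)" if "g \<in> carrier G" for g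
      using x that by (simp add: center_mod_def commutator_def word_simps)
    then show "inv x \<in> center_mod N"
      using x N.inv_op_closed1 by (simp add: center_mod_def)
  next
    fix x y assume x: "x \<in> center_mod N" and y: "y \<in> center_mod N"
    have "commutator g (x \<otimes> y) = commutator g x \<otimes> (x \<otimes> commutator g y \<otimes> inv x)" if "g \<in> carrier G" for g
      using x y that by (simp add: center_mod_def commutator_def word_simps)
    then show "x \<otimes> y \<in> center_mod N"
      using x y normal_conj [OF N] by (simp add: center_mod_def)
  qed
qed

lemma (in group) subset_center_mod:
  assumes N: "N \<lhd> G" shows "N \<subseteq> center_mod N"
proof -
  interpret N: normal N G by fact
  show ?thesis using normal_conj [OF N] by (auto simp: center_mod_def commutator_def)
qed

lemma (in group) center_mod_mono: "N \<subseteq> N' \<Longrightarrow> center_mod N \<subseteq> center_mod N'"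
  by (auto simp: center_mod_def)

lemma (in group) pow_mem_subgroup: "subgroup H G \<Longrightarrow> z \<in> H \<Longrightarrow> z [^] (k::nat) \<in> H"
  by (induction k) (auto simp: subgroup.one_closed subgroup.m_closed)

lemma (in group) subgroup_centralizer:
  assumes S: "S \<subseteq> carrier G"
  shows "subgroup {c \<in> carrier G. \<forall>a\<in>S. c \<otimes> a = a \<otimes> c} G" (is "subgroup ?C G")
proof (rule subgroupI)
  have "\<one> \<in> ?C" using S by auto
  then show "?C \<noteq> {}" by blast
  show "inv c \<in> ?C" if "c \<in> ?C" for c
  proof -
    have c: "c \<in> carrier G" using that by simp
    have "inv c \<otimes> a = a \<otimes> inv c" if a: "a \<in> S" for a
    proof -
      have aG: "a \<in> carrier G" using a S by blast
      have "inv c \<otimes> a = inv c \<otimes> (a \<otimes> c) \<otimes> inv c" using c aG by (simp add: m_assoc)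
      also have "a \<otimes> c = c \<otimes> a" using \<open>c \<in> ?C\<close> a by simp
      also have "inv c \<otimes> (c \<otimes> a) \<otimes> inv c = a \<otimes> inv c" using c aG by (simp add: m_assoc)
      finally show ?thesis .
    qed
    then show ?thesis using c by simp
  qed
  show "c \<otimes> c' \<in> ?C" if "c \<in> ?C" "c' \<in> ?C" for c c'
  proof -
    have c: "c \<in> carrier G" "c' \<in> carrier G" using that by simp_all
    have "c \<otimes> c' \<otimes> a = a \<otimes> (c \<otimes> c')" if a: "a \<in> S" for a
    proof -
      have aG: "a \<in> carrier G" using a S by blast
      have "c \<otimes> c' \<otimes> a = c \<otimes> (c' \<otimes> a)" using c aG by (simp add: m_assoc)
      also have "c' \<otimes> a = a \<otimes> c'" using \<open>c' \<in> ?C\<close> a by simp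
      also have "c \<otimes> (a \<otimes> c') = (c \<otimes> a) \<otimes> c'" using c aG by (simp add: m_assoc)
      also have "c \<otimes> a = a \<otimes> c" using \<open>c \<in> ?C\<close> a by simp
      finally show ?thesis using c aG by (simp add: m_assoc)
    qed
    then show ?thesis using c by simp
  qed
qed auto

lemma (in group) subgroup_cyclic_extension:
  assumes fin: "finite (carrier G)" and D: "subgroup D G" and x: "x \<in> carrier G"
    and xD: "\<And>z. z \<in> D \<Longrightarrow> z \<otimes> x = x \<otimes> z"
  shows "subgroup {x [^] (i::nat) \<otimes> z | i z. z \<in> D} G" (is "subgroup ?H G")
proof (rule subgroupI)
  interpret Z: subgroup D G by (rule D)
  have xz: "z \<otimes> x [^] (i::nat) = x [^] i \<otimes> z" if "z \<in> D" for i z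
    using group_commutes_pow [of x z i] xD [OF that] that x by simp
  show "?H \<subseteq> carrier G" using x by auto
  have "x [^] (0::nat) \<otimes> \<one> \<in> ?H" using Z.one_closed by blast
  then show "?H \<noteq> {}" by blast
  show "a \<otimes> b \<in> ?H" if a: "a \<in> ?H" and b: "b \<in> ?H" for a b
  proof -
    obtain i z where a: "a = x [^] (i::nat) \<otimes> z" "z \<in> D" using a by blast
    obtain j w where b: "b = x [^] (j::nat) \<otimes> w" "w \<in> D" using b by blast
    have "a \<otimes> b = x [^] i \<otimes> (z \<otimes> x [^] j) \<otimes> w" using a b x by (simp add: m_assoc)
    also have "\<dots> = x [^] i \<otimes> (x [^] j \<otimes> z) \<otimes> w" using xz [OF a(2), of j] by simp
    also have "\<dots> = (x [^] i \<otimes> x [^] j) \<otimes> (z \<otimes> w)" using a b x by (simp add: m_assoc)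
    also have "\<dots> = x [^] (i + j) \<otimes> (z \<otimes> w)" using x by (simp add: nat_pow_mult)
    finally show ?thesis using a b by blast
  qed
  show "inv a \<in> ?H" if a: "a \<in> ?H" for a
  proof -
    obtain i z where a: "a = x [^] (i::nat) \<otimes> z" "z \<in> D" using a by blast
    define n where "n = Coset.order G"
    have n: "n > 0" using fin order_gt_0_iff_finite by (simp add: n_def)
    \<comment> \<open>Exponents are natural numbers, so (n - 1) i with n the group order plays the
      part of -i.\<close>
    have "x [^] (i + (n - 1) * i) = (x [^] n) [^] i"
    proof -
      have "i + (n - 1) * i = n * i" using n by (cases n) auto
      then show ?thesis using x by (simp add: nat_pow_pow)
    qed
    also have "\<dots> = \<one>" using x pow_order_eq_1 by (simp add: n_def)
    finally have "x [^] i \<otimes> x [^] ((n - 1) * i) = \<one>" using x by (simp add: nat_pow_mult)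
    then have "inv (x [^] i) = x [^] ((n - 1) * i)" using x by (intro inv_equality inv_comm [of "x [^] i"]) auto
    then have "inv a = inv z \<otimes> x [^] ((n - 1) * i)" using a x by (simp add: inv_mult_group)
    also have "\<dots> = x [^] ((n - 1) * i) \<otimes> inv z" using xz [of "inv z"] a by simp
    finally show ?thesis using a by blast
  qed
qed

context pgroup
begin

text \<open>The \<open>p\<close>-group acts by conjugation on the cosets of \<open>N\<close> in \<open>L\<close>; the number of fixed
  points is divisible by \<open>p\<close>, and \<open>N\<close> itself is one.\<close>

lemma exists_central_mod:
  assumes N: "N \<lhd> G" and L: "L \<lhd> G" and NL: "N \<subset> L"
  obtains y where "y \<in> L" "y \<notin> N" "y \<in> center_mod N"
proof -
  interpret N: normal N G by fact
  interpret L: normal L G by fact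
  define act where "act = (\<lambda>g. \<lambda>H\<in>{H. H \<subseteq> carrier G}. g <# H #> inv g)"
  interpret A: group_action G "{H. H \<subseteq> carrier G}" act
    unfolding act_def by (rule action_by_conjugation_on_power_set)
  have act_coset: "act g (N #> y) = N #> (g \<otimes> y \<otimes> inv g)" if "g \<in> carrier G" "y \<in> carrier G" for g y
  proof -
    have "act g (N #> y) = g <# (N #> y) #> inv g"
      using that by (simp add: act_def r_coset_subset_G N.subset)
    also have "g <# (N #> y) = N #> (g \<otimes> y)"
      using that by (metis N.coset_eq N.subset coset_mult_assoc lcos_m_assoc l_coset_subset_G rcos_assoc_lcos coset_assoc)
    also have "\<dots> #> inv g = N #> (g \<otimes> y \<otimes> inv g)"
      using that by (simp add: coset_mult_assoc N.subset)
    finally show ?thesis .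
  qed
  define X where "X = (\<lambda>y. N #> y) ` L"
  have finX: "finite X" unfolding X_def using finite_subgroup [OF L.subgroup_axioms] by simp
  have X_sub: "H \<subseteq> carrier G" if "H \<in> X" for H
    using that by (auto simp: X_def dest!: r_coset_subset_G [OF N.subset, THEN subsetD, rotated])
  have orb: "orbit G act H \<subseteq> X" if "H \<in> X" for H
    using that normal_conj [OF L] by (auto simp: X_def orbit_def act_coset)
  have p_orb: "card (orbit G act H) = 1 \<or> p dvd card (orbit G act H)" if "H \<in> X" for H
  proof -
    have "card (orbit G act H) * card (stabilizer G act H) = Coset.order G"
      by (rule A.orbit_stabilizer_theorem) (use X_sub [OF that] in simp)
    then have "card (orbit G act H) dvd Coset.order G" by (metis dvd_triv_left)
    moreover obtain n where "card (carrier G) = p ^ n" using card_eq by blast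
    ultimately obtain k where "card (orbit G act H) = p ^ k"
      using divides_primepow_nat [OF prime, of _ n] by (auto simp: Coset.order_def)
    then show ?thesis by (cases k) auto
  qed
  have self: "H \<in> orbit G act H" if "H \<in> X" for H
    using A.orbit_refl X_sub that by simp
  have "p dvd card X"
  proof -
    interpret LG: group "G\<lparr>carrier := L\<rparr>" by (rule subgroup_imp_group [OF L.subgroup_axioms])
    have *: "card (rcosets\<^bsub>G\<lparr>carrier := L\<rparr>\<^esub> N) * card N = Coset.order (G\<lparr>carrier := L\<rparr>)"
      by (rule LG.lagrange) (use NL subgroup_incl N.subgroup_axioms L.subgroup_axioms in blast)
    then have eq: "card X * card N = card L"
    proof -
      have "rcosets\<^bsub>G\<lparr>carrier := L\<rparr>\<^esub> N = X" by (auto simp: RCOSETS_def X_def)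
      then show ?thesis using * by (simp add: Coset.order_def)
    qed
    obtain m where m: "card L = p ^ m" using card_subgroup L.subgroup_axioms by blast
    then obtain k where k: "card X = p ^ k" using eq divides_primepow_nat [OF prime, of "card X" m] by (metis dvd_triv_left)
    have "card N < card L" using NL finite_subgroup [OF L.subgroup_axioms] by (simp add: psubset_card_mono)
    then have "card X \<noteq> 1" using eq by auto
    then show ?thesis using k by (cases k) auto
  qed
  define F where "F = {H \<in> X. card (orbit G act H) = 1}"
  have "p dvd card (X - F)"
  proof -
    have eq: "X - F = \<Union> ((\<lambda>H. orbit G act H) ` (X - F))"
    proof (intro equalityI subsetI)
      fix H' assume "H' \<in> \<Union> ((\<lambda>H. orbit G act H) ` (X - F))"
      then obtain H where H: "H \<in> X - F" "H' \<in> orbit G act H" by blast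
      then have "H' \<in> X" using orb by blast
      moreover have "orbit G act H' = orbit G act H"
        using A.disjoint_union [of "orbit G act H'" "orbit G act H"] X_sub H \<open>H' \<in> X\<close> self [OF \<open>H' \<in> X\<close>]
        by (auto simp: orbits_def)
      ultimately show "H' \<in> X - F" using H by (simp add: F_def)
    qed (use self in blast)
    have "p dvd card (\<Union> ((\<lambda>H. orbit G act H) ` (X - F)))"
    proof (rule dvd_partition)
      show "\<forall>c\<in>(\<lambda>H. orbit G act H) ` (X - F). p dvd card c" using p_orb by (auto simp: F_def)
      show "\<forall>c1\<in>(\<lambda>H. orbit G act H) ` (X - F). \<forall>c2\<in>(\<lambda>H. orbit G act H) ` (X - F). c1 \<noteq> c2 \<longrightarrow> c1 \<inter> c2 = {}"
      proof (intro ballI impI)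
        fix c1 c2 assume "c1 \<in> (\<lambda>H. orbit G act H) ` (X - F)" "c2 \<in> (\<lambda>H. orbit G act H) ` (X - F)" "c1 \<noteq> c2"
        then have "c1 \<in> orbits G {H. H \<subseteq> carrier G} act" "c2 \<in> orbits G {H. H \<subseteq> carrier G} act"
          using X_sub unfolding orbits_def by blast+
        then show "c1 \<inter> c2 = {}" using A.disjoint_union [of c1 c2] \<open>c1 \<noteq> c2\<close> by blast
      qed
    qed (use eq finX in auto)
    then show ?thesis using eq by simp
  qed
  moreover have "card X = card F + card (X - F)"
    using finX by (metis (no_types, lifting) F_def card_Diff_subset card_mono finite_subset le_add_diff_inverse mem_Collect_eq subsetI)
  ultimately have "p dvd card F" using \<open>p dvd card X\<close> by (metis dvd_add_left_iff)
  have fixed: "y \<in> center_mod N" if "y \<in> L" "N #> y \<in> F" for y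
  proof -
    have yc: "y \<in> carrier G" using that by simp
    have "N #> (g \<otimes> y \<otimes> inv g) = N #> y" if g: "g \<in> carrier G" for g
    proof -
      have "act g (N #> y) \<in> orbit G act (N #> y)" using g by (auto simp: orbit_def)
      moreover have "card (orbit G act (N #> y)) = 1" using \<open>N #> y \<in> F\<close> by (simp add: F_def)
      ultimately have "act g (N #> y) = N #> y"
        using self \<open>N #> y \<in> F\<close> by (metis (no_types, lifting) F_def card_1_singletonE mem_Collect_eq singletonD)
      then show ?thesis using act_coset [OF g yc] by simp
    qed
    then have "commutator g y \<in> N" if g: "g \<in> carrier G" for g
      using g yc N.rcos_module [of y "g \<otimes> y \<otimes> inv g"] rcos_self [OF _ N.subgroup_axioms, of "g \<otimes> y \<otimes> inv g"]
      by (simp add: commutator_def)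
    then show ?thesis using yc by (simp add: center_mod_def)
  qed
  have "N #> \<one> \<in> F"
  proof -
    have "orbit G act (N #> \<one>) = {N #> \<one>}"
    proof -
      have "act g N = N" if "g \<in> carrier G" for g
        using act_coset [OF that, of \<one>] that N.subset by simp
      then show ?thesis using N.subset by (auto simp: orbit_def)
    qed
    then show ?thesis by (auto simp: F_def X_def)
  qed
  moreover have "finite F" using finX by (simp add: F_def)
  ultimately have "card F \<ge> p" using \<open>p dvd card F\<close> by (metis card_gt_0_iff dvd_imp_le empty_iff)
  then have "F \<noteq> {N #> \<one>}" using p_gt_1 by auto
  then obtain H where "H \<in> F" "H \<noteq> N #> \<one>" using \<open>N #> \<one> \<in> F\<close> by blast
  then obtain y where "y \<in> L" "N #> y \<in> F" "N #> y \<noteq> N" by (auto simp: F_def X_def N.subset)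
  moreover from this have "y \<notin> N" using coset_join2 N.subgroup_axioms by (metis N.mem_carrier)
  ultimately show ?thesis using that fixed by blast
qed

text \<open>In the sequence y, y^p, y^(p^2), ... take the last member before \<open>N\<close> is
  entered. It stays in \<open>L\<close> and in \<open>center_mod N\<close>, both being
  subgroups.\<close>

lemma exists_central_mod_prime:
  assumes N: "N \<lhd> G" and L: "L \<lhd> G" and NL: "N \<subset> L"
  obtains y where "y \<in> L" "y \<notin> N" "y \<in> center_mod N" "y [^] p \<in> N"
proof -
  interpret N: normal N G by fact
  interpret L: normal L G by fact
  interpret C: subgroup "center_mod N" G by (rule subgroup_center_mod [OF N])
  obtain y where y: "y \<in> L" "y \<notin> N" "y \<in> center_mod N"
    using exists_central_mod [OF assms] .
  then have yc: "y \<in> carrier G" by simp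
  obtain n where "card (carrier G) = p ^ n" using card_eq by blast
  then have ex: "\<exists>j. y [^] (p ^ j) \<in> N"
    using pow_order_eq_1 [OF yc] by (intro exI [of _ n]) (simp add: Coset.order_def)
  define j where "j = (LEAST j. y [^] (p ^ j) \<in> N)"
  have j: "y [^] (p ^ j) \<in> N" unfolding j_def using ex by (rule LeastI_ex)
  then obtain i where i: "j = Suc i" using y yc by (cases j) auto
  show ?thesis
  proof (rule that)
    show "y [^] (p ^ i) \<in> L" "y [^] (p ^ i) \<in> center_mod N"
      using pow_mem_subgroup y L.subgroup_axioms C.subgroup_axioms by auto
    show "y [^] (p ^ i) \<notin> N" using not_less_Least [of i "\<lambda>j. y [^] (p ^ j) \<in> N"] i by (simp add: j_def)
    show "(y [^] (p ^ i)) [^] p \<in> N" using j i yc by (simp add: nat_pow_pow mult.commute)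
  qed
qed

end

section \<open>Degrees and cyclic-by-central subgroups\<close>

locale pgroup_char = irr_char G \<phi> + pgroup G p
  for G :: "('a, 'b) monoid_scheme" (structure) and \<phi> :: "'a \<Rightarrow> complex" and p :: nat
begin

lemma center_eq_center_mod: "Z = center_mod K"
  unfolding center_mod_def using center_iff by blast

text \<open>Each product \<phi>(h) \<phi>(h\<inverse>) equals \<phi>(1)^2. The sign of \<phi>(1) is
  not determined by the two identities, which is why degrees are compared through their
  squares.\<close>

lemma deg_sq_if_center_all:
  assumes "Z = carrier G"
  shows "(\<phi> \<one>)\<^sup>2 = 1"
proof -
  have "\<phi> h * \<phi> (inv h) = (\<phi> \<one>)\<^sup>2" if "h \<in> carrier G" for h
  proof -
    have "h \<in> Z" using assms that by simp
    then show ?thesis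
      using center_inv [of h] lam_nonzero [of h]
      by (simp add: char_eq_lam [of h] char_eq_lam [of "inv h"] power2_eq_square)
  qed
  then have "of_nat (card (carrier G)) * (\<phi> \<one>)\<^sup>2 = of_nat (card (carrier G))"
    using norm by simp
  then show ?thesis using card_pos by simp
qed

lemma obtain_clifford:
  assumes "Z \<noteq> carrier G"
  obtains y where "clifford G \<phi> p y" "\<And>g. g \<in> carrier G \<Longrightarrow> commutator g y \<in> Z"
proof -
  have "carrier G \<lhd> G" by (simp add: normal_inv_iff subgroup_self)
  moreover have "Z \<subset> carrier G" using assms by auto
  ultimately obtain y where "y \<in> carrier G" "y \<notin> Z" "y \<in> center_mod Z" "y [^] p \<in> Z"
    using exists_central_mod_prime [OF normal_center] by blast
  then show ?thesis
    by (intro that [of y]) (auto simp: center_mod_def clifford_def clifford_axioms_def irr_char_axioms prime)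
qed

end

lemma (in clifford) pgroup_char_psi:
  assumes "pgroup G p" "t ^ p = lam (y [^] p)"
  shows "pgroup_char (G\<lparr>carrier := M\<rparr>) (psi t) p"
  using assms irr_char_psi pgroup.pgroup_subgroup subgroup_M by (simp add: pgroup_char_def)

lemma (in clifford) center_psi:
  assumes "t ^ p = lam (y [^] p)"
  shows "Z \<subseteq> char_center (G\<lparr>carrier := M\<rparr>) (psi t)" "y \<in> char_center (G\<lparr>carrier := M\<rparr>) (psi t)"
proof -
  interpret psi: irr_char "G\<lparr>carrier := M\<rparr>" "psi t" by (rule irr_char_psi [OF assms])
  show "Z \<subseteq> char_center (G\<lparr>carrier := M\<rparr>) (psi t)"
  proof
    fix z assume z: "z \<in> Z"
    show "z \<in> char_center (G\<lparr>carrier := M\<rparr>) (psi t)"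
      by (rule psi.centerI(1) [of _ "lam z"])
        (use z center_subset_M M_closed psi_mult_center [OF assms] in auto)
  qed
  show "y \<in> char_center (G\<lparr>carrier := M\<rparr>) (psi t)"
    by (rule psi.centerI(1) [of _ t]) (use y_in_M psi_mult_y [OF assms] M_closed in auto)
qed

text \<open>Passing from \<open>\<phi>\<close> to a Clifford constituent on \<open>M\<close> divides the degree and the group order by
  \<open>p\<close> but multiplies the order of the centre by at least \<open>p\<close>.\<close>

lemma pgroup_char_degree:
  assumes "pgroup_char G \<phi> p"
  shows "\<exists>k. (\<phi> \<one>\<^bsub>G\<^esub>)\<^sup>2 = of_nat (p ^ (2 * k)) \<and>
    p ^ (2 * k) * card (char_center G \<phi>) \<le> card (carrier G) \<and>
    (p ^ (2 * k) * card (char_center G \<phi>) = card (carrier G) \<longrightarrow>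
      (\<forall>x\<in>carrier G. \<phi> x \<noteq> 0 \<longrightarrow> x \<in> char_center G \<phi>))"
  using assms
proof (induction "card (carrier G)" arbitrary: G \<phi> rule: less_induct)
  case less
  interpret pgroup_char G \<phi> p by fact
  show ?case
  proof (cases "Z = carrier G")
    case True
    then show ?thesis using deg_sq_if_center_all by (intro exI [of _ 0]) simp
  next
    case False
    obtain y where "clifford G \<phi> p y" and yZ: "\<And>g. g \<in> carrier G \<Longrightarrow> commutator g y \<in> Z"
      using obtain_clifford [OF False] by blast
    then interpret C: clifford G \<phi> p y by simp
    define Zt where "Zt t = char_center (G\<lparr>carrier := C.M\<rparr>) (C.psi t)" for t
    have card_M: "card (carrier (G\<lparr>carrier := C.M\<rparr>)) < card (carrier G)"
      using C.index_M card_pos p_gt_1 by simp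
    have step: "\<exists>k. (\<phi> \<one>\<^bsub>G\<^esub>)\<^sup>2 = of_nat (p ^ (2 * Suc k)) \<and> p ^ (2 * k) * card (Zt t) \<le> card C.M \<and>
        (p ^ (2 * k) * card (Zt t) = card C.M \<longrightarrow> (\<forall>x\<in>C.M. C.psi t x \<noteq> 0 \<longrightarrow> x \<in> Zt t)) \<and>
        p * card Z \<le> card (Zt t) \<and> subgroup (Zt t) G \<and> Z \<subset> Zt t \<and> y \<in> Zt t"
      if t: "t ^ p = lam (y [^]\<^bsub>G\<^esub> p)" for t
    proof -
      interpret psi: pgroup_char "G\<lparr>carrier := C.M\<rparr>" "C.psi t" p
        by (rule C.pgroup_char_psi [OF pgroup_axioms t])
      obtain k where k: "(C.psi t \<one>\<^bsub>G\<^esub>)\<^sup>2 = of_nat (p ^ (2 * k))"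
        "p ^ (2 * k) * card (Zt t) \<le> card C.M"
        "p ^ (2 * k) * card (Zt t) = card C.M \<longrightarrow> (\<forall>x\<in>C.M. C.psi t x \<noteq> 0 \<longrightarrow> x \<in> Zt t)"
        using less.hyps [OF card_M psi.pgroup_char_axioms] by (auto simp: Zt_def)
      have sub: "subgroup (Zt t) G"
        using incl_subgroup [OF C.subgroup_M] normal_imp_subgroup [OF psi.normal_center] by (simp add: Zt_def)
      moreover have ss: "Z \<subset> Zt t" "y \<in> Zt t" using C.center_psi [OF t] C.y by (auto simp: Zt_def)
      moreover have "p * card Z \<le> card (Zt t)"
        by (rule card_proper_subgroup [OF normal_imp_subgroup [OF normal_center] sub ss(1)])
      moreover have "(\<phi> \<one>\<^bsub>G\<^esub>)\<^sup>2 = of_nat (p ^ (2 * Suc k))"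
        using k(1) p_gt_1 by (simp add: C.psi_one field_simps power2_eq_square)
      ultimately show ?thesis using k by blast
    qed
    obtain t0 where t0: "t0 ^ p = lam (y [^]\<^bsub>G\<^esub> p)" using C.obtain_constituents by metis
    obtain k where k: "(\<phi> \<one>\<^bsub>G\<^esub>)\<^sup>2 = of_nat (p ^ (2 * Suc k))" using step [OF t0] by blast
    have step': "p ^ (2 * k) * card (Zt t) \<le> card C.M"
        "p ^ (2 * k) * card (Zt t) = card C.M \<longrightarrow> (\<forall>x\<in>C.M. C.psi t x \<noteq> 0 \<longrightarrow> x \<in> Zt t)"
        "p * card Z \<le> card (Zt t)" "subgroup (Zt t) G" "Z \<subset> Zt t" "y \<in> Zt t"
      if t: "t ^ p = lam (y [^]\<^bsub>G\<^esub> p)" for t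
    proof -
      obtain k' where k': "(\<phi> \<one>\<^bsub>G\<^esub>)\<^sup>2 = of_nat (p ^ (2 * Suc k'))" "p ^ (2 * k') * card (Zt t) \<le> card C.M"
        "p ^ (2 * k') * card (Zt t) = card C.M \<longrightarrow> (\<forall>x\<in>C.M. C.psi t x \<noteq> 0 \<longrightarrow> x \<in> Zt t)"
        "p * card Z \<le> card (Zt t)" "subgroup (Zt t) G" "Z \<subset> Zt t" "y \<in> Zt t"
        using step [OF t] by blast
      \<comment> \<open>The exponent depends on the degree only, so one \<open>k\<close> serves all
        \<open>t\<close>. This matters for equality, where \<open>t\<close> is chosen according to
        \<open>x\<close>.\<close>
      have "p ^ (2 * Suc k) = p ^ (2 * Suc k')" using k k'(1) by (metis of_nat_eq_iff)
      then have "k = k'" using p_gt_1 by (simp add: power_inject_exp del: power_Suc mult_Suc_right)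
      then show "p ^ (2 * k) * card (Zt t) \<le> card C.M"
        "p ^ (2 * k) * card (Zt t) = card C.M \<longrightarrow> (\<forall>x\<in>C.M. C.psi t x \<noteq> 0 \<longrightarrow> x \<in> Zt t)"
        "p * card Z \<le> card (Zt t)" "subgroup (Zt t) G" "Z \<subset> Zt t" "y \<in> Zt t"
        using k' by blast+
    qed
    have chain: "p ^ (2 * Suc k) * card Z \<le> p * (p ^ (2 * k) * card (Zt t))"
        "p * (p ^ (2 * k) * card (Zt t)) \<le> card (carrier G)" if t: "t ^ p = lam (y [^]\<^bsub>G\<^esub> p)" for t
      using step'(1,3) [OF t] C.index_M by simp_all
    \<comment> \<open>Equality passes to every link of the chain: the constituent is itself
      extremal, hence \<open>x\<close> is in \<open>Zt t\<close>, and |Zt t| = p |Z|. As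
      \<open>y\<close> lies in \<open>Zt t\<close> and is central modulo \<open>Z\<close>, there is
      no room left: all of \<open>Zt t\<close> is central modulo \<open>Z\<close>. The commutators
      of \<open>x\<close> are then in \<open>Z\<close>, and \<phi>(x) \<noteq> 0 puts them in
      \<open>K\<close>.\<close>
    have "x \<in> Z" if eq: "p ^ (2 * Suc k) * card Z = card (carrier G)" and x: "x \<in> carrier G" "\<phi> x \<noteq> 0" for x
    proof -
      obtain t where t: "t ^ p = lam (y [^]\<^bsub>G\<^esub> p)" "C.psi t x \<noteq> 0" by (rule C.obtain_constituent [OF x])
      have xM: "x \<in> C.M" using C.vanishes_off_M x by blast
      have "p ^ (2 * k) * card (Zt t) = card C.M"
      proof -
        have "p * (p ^ (2 * k) * card (Zt t)) = p * card C.M"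
          using chain [OF t(1)] eq C.index_M by linarith
        then show ?thesis using p_gt_1 by simp
      qed
      then have xZt: "x \<in> Zt t" using step'(2) [OF t(1)] t(2) xM by blast
      have cZt: "card (Zt t) = p * card Z"
      proof -
        have "p * (p ^ (2 * k) * card (Zt t)) = p * (p ^ (2 * k) * (p * card Z))"
        proof -
          have "p ^ (2 * Suc k) * card Z = p * (p ^ (2 * k) * (p * card Z))" by (simp add: mult_ac)
          then show ?thesis using chain [OF t(1)] eq by linarith
        qed
        then show ?thesis using p_gt_1 by simp
      qed
      define S where "S = Zt t \<inter> center_mod Z"
      have sub_S: "subgroup S G"
        unfolding S_def
        by (rule subgroups_Inter_pair [OF step'(4) [OF t(1)] subgroup_center_mod [OF normal_center]])
      have "Z \<subset> S" using step'(5,6) [OF t(1)] subset_center_mod [OF normal_center] C.y yZ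
        by (auto simp: S_def center_mod_def)
      then have "p * card Z \<le> card S"
        by (rule card_proper_subgroup [OF normal_imp_subgroup [OF normal_center] sub_S])
      then have "S = Zt t"
        using cZt finite_subgroup [OF step'(4) [OF t(1)]] by (intro card_seteq) (auto simp: S_def)
      then have "commutator g x \<in> Z" if "g \<in> carrier G" for g
        using xZt that by (auto simp: S_def center_mod_def)
      then have "\<forall>g\<in>carrier G. commutator g x \<in> K"
        using commutator_ker_if_nonzero [OF x] by simp
      then show ?thesis by (simp only: center_iff x(1) simp_thms)
    qed
    moreover have "p ^ (2 * Suc k) * card Z \<le> card (carrier G)"
      using chain [OF t0] by linarith
    ultimately show ?thesis using k by (intro exI [of _ "Suc k"] conjI impI ballI)
  qed
qed

section \<open>Congruences modulo p and p^2\<close>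

lemma dvd_sum_lessThan_odd:
  fixes p :: nat
  assumes "odd p" shows "p dvd (\<Sum>l<p. l)"
proof -
  obtain m where m: "p = 2 * m + 1" using assms by (auto elim: oddE)
  have "(\<Sum>l<n. l) * 2 = n * (n - 1)" for n :: nat
  proof (induction n)
    case (Suc n)
    then show ?case by (cases n) (auto simp: algebra_simps)
  qed simp
  from this [of p] have "(\<Sum>l<p. l) = p * m" by (simp add: m)
  then show ?thesis by simp
qed

text \<open>With i = p j, the power (1 + i)^l is 1 + l p j modulo p^2, and the sum of the l is a
  multiple of the odd number p. For p = 2 and i = 2 the sum is 4, which is not 2 modulo 4.\<close>

lemma geometric_sum_mod_square:
  fixes p i :: nat
  assumes "odd p" "p dvd i"
  shows "\<exists>q. (\<Sum>l<p. (1 + i) ^ l) = p + p * p * q"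
proof -
  obtain j where i: "i = p * j" using assms by (auto elim: dvdE)
  have "\<exists>q. (1 + i) ^ l = 1 + l * (p * j) + p * p * q" for l
  proof (induction l)
    case (Suc l)
    then obtain q where q: "(1 + i) ^ l = 1 + l * (p * j) + p * p * q" by blast
    have "(1 + i) ^ Suc l = 1 + Suc l * (p * j) + p * p * (l * j * j + q * (1 + p * j))"
      unfolding power_Suc q by (simp add: i algebra_simps)
    then show ?case by blast
  qed simp
  then obtain q where q: "\<And>l. (1 + i) ^ l = 1 + l * (p * j) + p * p * q l" by metis
  obtain m where l: "(\<Sum>l<p. l) = p * m" using dvd_sum_lessThan_odd [OF assms(1)] by (auto elim: dvdE)
  have "(\<Sum>l<p. (1 + i) ^ l) = p + (\<Sum>l<p. l) * (p * j) + p * p * (\<Sum>l<p. q l)"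
    unfolding q by (simp only: sum.distrib sum_distrib_left sum_distrib_right) simp
  then show ?thesis unfolding l by (intro exI [of _ "m * j + (\<Sum>l<p. q l)"]) (simp add: algebra_simps)
qed

text \<open>By Fermat, (1 + i)^p is congruent to 1 + i. The truncated subtraction is exact since the
  power is at least 1.\<close>

lemma prime_dvd_if_dvd_power_minus_1:
  fixes p i :: nat
  assumes p: "Factorial_Ring.prime p" and dvd: "p dvd (1 + i) ^ p - 1"
  shows "p dvd i"
proof -
  have 1: "[(1 + i) ^ p = 1] (mod p)"
    using dvd by (subst cong_altdef_nat) auto
  have "\<not> p dvd 1 + i"
  proof
    assume "p dvd 1 + i"
    then have "p dvd (1 + i) ^ p" using prime_gt_0_nat [OF p] by (meson dvd_power dvd_trans)
    moreover have "(1 + i) ^ p = ((1 + i) ^ p - 1) + 1" by simp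
    ultimately have "p dvd 1" using dvd by (metis dvd_add_right_iff)
    then show False using prime_gt_1_nat [OF p] by simp
  qed
  then have "[(1 + i) ^ (p - 1) * (1 + i) = 1 * (1 + i)] (mod p)"
    by (intro cong_scalar_right fermat_theorem p)
  moreover have "(1 + i) ^ (p - 1) * (1 + i) = (1 + i) ^ p"
    using prime_gt_0_nat [OF p] by (metis Suc_diff_1 power_Suc2)
  ultimately have "[1 + i = 1] (mod p)" using 1 by (metis cong_sym cong_trans mult_1)
  then show ?thesis by (subst (asm) cong_altdef_nat) auto
qed

context group
begin

text \<open>The abelian group <x>Z(G), formed with the centre of the group rather than that of a
  character, so that it commutes on the nose and not just modulo a kernel.\<close>

definition cyclic_center :: "'a \<Rightarrow> 'a set" where
  "cyclic_center x = {x [^] (i::nat) \<otimes> z | i z. z \<in> center_mod {\<one>}}"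

lemma center_mod_one: "z \<in> center_mod {\<one>} \<longleftrightarrow> z \<in> carrier G \<and> (\<forall>g\<in>carrier G. g \<otimes> z = z \<otimes> g)"
proof -
  have "commutator g z = \<one> \<longleftrightarrow> g \<otimes> z = z \<otimes> g" if "g \<in> carrier G" "z \<in> carrier G" for g z
  proof
    assume "commutator g z = \<one>"
    then have "commutator g z \<otimes> (z \<otimes> g) = z \<otimes> g" using that by simp
    then show "g \<otimes> z = z \<otimes> g" using that by (simp add: commutator_def m_assoc)
  next
    assume "g \<otimes> z = z \<otimes> g"
    then show "commutator g z = \<one>" using that by (simp add: commutator_def m_assoc)
  qed
  then show ?thesis by (auto simp: center_mod_def)
qed

lemma center_commute: "z \<in> center_mod {\<one>} \<Longrightarrow> g \<in> carrier G \<Longrightarrow> g \<otimes> z = z \<otimes> g"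
  unfolding center_mod_one by blast

lemma group_centerI:
  "z \<in> carrier G \<Longrightarrow> (\<And>g. g \<in> carrier G \<Longrightarrow> g \<otimes> z = z \<otimes> g) \<Longrightarrow> z \<in> center_mod {\<one>}"
  unfolding center_mod_one by blast

lemma subgroup_group_center: "subgroup (center_mod {\<one>}) G"
  using subgroup_center_mod one_is_normal by blast

lemma subgroup_cyclic_center:
  assumes "finite (carrier G)" "x \<in> carrier G"
  shows "subgroup (cyclic_center x) G"
  unfolding cyclic_center_def
  by (rule subgroup_cyclic_extension)
    (use assms subgroup_group_center center_commute in \<open>auto simp: center_commute\<close>)

lemma mem_cyclic_center:
  assumes "x \<in> carrier G"
  shows "x \<in> cyclic_center x" "z \<in> center_mod {\<one>} \<Longrightarrow> z \<in> cyclic_center x"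
proof -
  interpret Z: subgroup "center_mod {\<one>}" G by (rule subgroup_group_center)
  have "x [^] (1::nat) \<otimes> \<one> \<in> cyclic_center x" unfolding cyclic_center_def using Z.one_closed by blast
  then show "x \<in> cyclic_center x" using assms by simp
  assume z: "z \<in> center_mod {\<one>}"
  have "x [^] (0::nat) \<otimes> z \<in> cyclic_center x" unfolding cyclic_center_def using z by blast
  then show "z \<in> cyclic_center x" using z by simp
qed

end

text \<open>If \<open>\<langle>x\<rangle>Z(G)\<close> were all of \<open>M\<close>, conjugation by \<open>g \<notin> M\<close> would map \<open>x\<close> to \<open>x w\<close> and \<open>w\<close> to \<open>w\<^bsup>1+i\<^esup>\<close>.
  As \<open>g\<^sup>p\<close> centralises \<open>M\<close>, \<open>p\<close> divides \<open>i\<close> and (for odd \<open>p\<close>) \<open>w\<^sup>p = 1\<close>, so \<open>w\<close> is central; but then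
  \<open>\<phi>(x) \<noteq> 0\<close> forces \<open>x\<close>, and with it \<open>M\<close>, into the centre of \<open>\<phi>\<close>.\<close>

lemma (in pgroup_char) card_cyclic_center_le:
  assumes odd: "odd p" and nz: "Z \<noteq> carrier G" and x: "x \<in> carrier G" "\<phi> x \<noteq> 0"
  shows "card (cyclic_center x) * p ^ 2 \<le> card (carrier G)"
proof -
  interpret ZG: subgroup "center_mod {\<one>}" G by (rule subgroup_group_center)
  obtain y where "clifford G \<phi> p y" using obtain_clifford [OF nz] by blast
  then interpret C: clifford G \<phi> p y .
  interpret M: subgroup C.M G by (rule C.subgroup_M)
  have xM: "x \<in> C.M" using C.vanishes_off_M x by blast
  have ZG: "z \<in> Z" if "z \<in> center_mod {\<one>}" for z
    using that by (intro group_center_subset center_commute) auto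
  have UM: "cyclic_center x \<subseteq> C.M"
    using ZG C.center_subset_M pow_mem_subgroup [OF C.subgroup_M xM] by (auto simp: cyclic_center_def)
  have "cyclic_center x \<noteq> C.M"
  proof
    assume U: "cyclic_center x = C.M"
    have xM_comm: "x \<otimes> a = a \<otimes> x" if "a \<in> C.M" for a
    proof -
      have "a \<in> cyclic_center x" using that U by simp
      then obtain i z where a: "a = x [^] (i::nat) \<otimes> z" "z \<in> center_mod {\<one>}" unfolding cyclic_center_def by blast
      have "x \<otimes> x [^] i = x [^] i \<otimes> x" using x by (metis nat_pow_Suc nat_pow_Suc2)
      then have "x \<otimes> a = x [^] i \<otimes> (x \<otimes> z)" using a x by (simp add: m_assoc [symmetric])
      also have "x \<otimes> z = z \<otimes> x" by (rule center_commute [OF a(2) x(1)])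
      finally show ?thesis using a x by (simp add: m_assoc)
    qed
    have M_comm: "a \<otimes> b = b \<otimes> a" if "a \<in> C.M" "b \<in> C.M" for a b
    proof -
      have "a \<in> cyclic_center x" using that U by simp
      then obtain i z where a: "a = x [^] (i::nat) \<otimes> z" "z \<in> center_mod {\<one>}" unfolding cyclic_center_def by blast
      have "x [^] i \<otimes> b = b \<otimes> x [^] i"
        using group_commutes_pow [of x b i] xM_comm [OF that(2)] x that by simp
      moreover have "a \<otimes> b = x [^] i \<otimes> (z \<otimes> b)" using a x that by (simp add: m_assoc)
      moreover have "z \<otimes> b = b \<otimes> z" using center_commute [OF a(2), of b] that by simp
      ultimately have "a \<otimes> b = (b \<otimes> x [^] i) \<otimes> z" using a x that by (simp add: m_assoc [symmetric])
      then show ?thesis using a x that by (simp add: m_assoc)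
    qed
    have "commutator g x \<in> K" if g: "g \<in> carrier G" for g
    proof (cases "g \<in> C.M")
      case True
      then have "commutator g x = \<one>" using M_comm xM x by (simp add: commutator_def m_assoc)
      then show ?thesis by (simp add: ker_iff)
    next
      case False
      define w where "w = inv x \<otimes> (g \<otimes> x \<otimes> inv g)"
      have wM: "w \<in> C.M" using C.M_conj [OF g xM] xM by (simp add: w_def)
      have gx: "g \<otimes> x \<otimes> inv g = x \<otimes> w" using g x by (simp add: w_def)
      have "w \<in> cyclic_center x" using wM U by simp
      then obtain i z where w: "w = x [^] (i::nat) \<otimes> z" "z \<in> center_mod {\<one>}" unfolding cyclic_center_def by blast
      have zc: "z \<in> carrier G" and zM: "z \<in> C.M" using w ZG C.center_subset_M by auto
      \<comment> \<open>Since w = x^i z with \<open>z\<close> central and \<open>M\<close> abelian,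
        conjugation sends \<open>w\<close> to (x w)^i z = w^i (x^i z).\<close>
      have gw: "g \<otimes> w \<otimes> inv g = w [^] (1 + i)"
      proof -
        have "g \<otimes> w \<otimes> inv g = (g \<otimes> x [^] i \<otimes> inv g) \<otimes> (g \<otimes> z \<otimes> inv g)"
          using g x zc by (simp add: w word_simps)
        also have "g \<otimes> z \<otimes> inv g = z" using center_commute [OF w(2) g] g zc by (simp add: m_assoc)
        also have "g \<otimes> x [^] i \<otimes> inv g = (x \<otimes> w) [^] i" using conj_pow [OF g x(1)] gx by simp
        also have "\<dots> = x [^] i \<otimes> w [^] i" using pow_mult_distrib [OF xM_comm [OF wM]] x wM by simp
        also have "x [^] i \<otimes> w [^] i \<otimes> z = (x [^] i \<otimes> z) \<otimes> w [^] i"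
          using M_comm [OF zM pow_mem_subgroup [OF C.subgroup_M wM, of i]] x zc wM by (simp add: m_assoc)
        also have "\<dots> = w [^] (1 + i)" using wM by (simp add: w(1) [symmetric] nat_pow_Suc2 [symmetric] del: nat_pow_Suc)
        finally show ?thesis .
      qed
      have gjw: "g [^] j \<otimes> w \<otimes> inv (g [^] j) = w [^] ((1 + i) ^ j)" for j :: nat
      proof (induction j)
        case (Suc j)
        have "g [^] Suc j \<otimes> w \<otimes> inv (g [^] Suc j) = g [^] j \<otimes> (g \<otimes> w \<otimes> inv g) \<otimes> inv (g [^] j)"
          using g wM by (simp add: word_simps)
        also have "\<dots> = (g [^] j \<otimes> w \<otimes> inv (g [^] j)) [^] (1 + i)"
          unfolding gw by (rule conj_pow) (use g wM in auto)
        also have "\<dots> = w [^] ((1 + i) ^ Suc j)"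
          unfolding Suc.IH using nat_pow_pow [of w "(1 + i) ^ j" "1 + i"] wM by (simp only: power_Suc2 M.mem_carrier)
        finally show ?case .
      qed (use wM in simp)
      have gjx: "g [^] j \<otimes> x \<otimes> inv (g [^] j) = x \<otimes> w [^] (\<Sum>l<j. (1 + i) ^ l)" for j :: nat
      proof (induction j)
        case (Suc j)
        have "g [^] Suc j \<otimes> x \<otimes> inv (g [^] Suc j) = g [^] j \<otimes> (g \<otimes> x \<otimes> inv g) \<otimes> inv (g [^] j)"
          using g x by (simp add: word_simps)
        also have "\<dots> = (g [^] j \<otimes> x \<otimes> inv (g [^] j)) \<otimes> (g [^] j \<otimes> w \<otimes> inv (g [^] j))"
          unfolding gx using g x wM by (simp add: word_simps)
        finally show ?case using Suc gjw [of j] wM x by (simp add: m_assoc nat_pow_mult)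
      qed (use x in simp)
      have cp: "C.c (g [^] j) = C.c g ^ j" for j :: nat
        using g by (induction j) (auto simp: C.c_one C.c_mult)
      have gp: "g [^] p \<in> C.M" unfolding C.M_def using cp [of p] C.c_pow_prime [OF g] g by simp
      have fixp: "g [^] p \<otimes> a \<otimes> inv (g [^] p) = a" if "a \<in> C.M" for a
        using M_comm [OF gp that] that g by (simp add: m_assoc)
      have 1: "w [^] (\<Sum>l<p. (1 + i) ^ l) = \<one>"
        using gjx [of p] fixp [OF xM] x wM l_cancel_one [of x "w [^] (\<Sum>l<p. (1 + i) ^ l)"] by simp
      have 2: "w [^] ((1 + i) ^ p) = w"
        using gjw [of p] fixp [OF wM] by simp
      have d1: "ord w dvd (\<Sum>l<p. (1 + i) ^ l)" using 1 wM by (simp add: pow_eq_id)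
      have d2: "ord w dvd (1 + i) ^ p - 1"
      proof -
        have "w [^] ((1 + i) ^ p - 1) \<otimes> w = w [^] Suc ((1 + i) ^ p - 1)"
          by (rule nat_pow_Suc [symmetric])
        also have "Suc ((1 + i) ^ p - 1) = (1 + i) ^ p" by simp
        finally have "w [^] ((1 + i) ^ p - 1) \<otimes> w = w" using 2 by simp
        then have "w [^] ((1 + i) ^ p - 1) = \<one>"
          using r_cancel_one [of w "w [^] ((1 + i) ^ p - 1)"] wM by simp
        then show ?thesis using pow_eq_id [of w] M.mem_carrier [OF wM] by blast
      qed
      have w_fix: "g \<otimes> w \<otimes> inv g = w"
      proof (cases "w = \<one>")
        case True
        then show ?thesis using g by simp
      next
        case False
        obtain e where e: "ord w = p ^ e" using ord_eq_power [OF M.mem_carrier [OF wM]] by blast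
        have "e \<noteq> 0"
        proof
          assume "e = 0"
          then have "ord w = 1" using e by simp
          then show False using ord_eq_1 [OF M.mem_carrier [OF wM]] False by simp
        qed
        then have "p dvd ord w" using e by simp
        then have "p dvd (1 + i) ^ p - 1" using d2 by (rule dvd_trans)
        then have pi: "p dvd i" by (rule prime_dvd_if_dvd_power_minus_1 [OF prime])
        obtain q where "(\<Sum>l<p. (1 + i) ^ l) = p + p * p * q" using geometric_sum_mod_square [OF odd pi] by blast
        then have d: "p ^ e dvd p + p * p * q" using d1 e by simp
        \<comment> \<open>The order p^e of \<open>w\<close> divides a number congruent to p modulo
          p^2.\<close>
        have "e \<le> 1"
        proof (rule ccontr)
          assume "\<not> e \<le> 1"
          then have "p ^ 2 dvd p ^ e" by (intro le_imp_power_dvd) simp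
          then have "p * p dvd p + p * p * q" using dvd_trans [OF _ d] by (simp add: power2_eq_square)
          then have "p * p dvd p" using dvd_add_left_iff [of "p * p" "p * p * q" p] by simp
          then have "p * p \<le> p" using p_gt_1 by (intro dvd_imp_le) auto
          then show False using p_gt_1 by simp
        qed
        then have "ord w dvd i" using e pi \<open>e \<noteq> 0\<close> by (cases e) auto
        then have "w [^] i = \<one>" using wM by (simp add: pow_eq_id)
        then show ?thesis using gw wM by simp
      qed
      \<comment> \<open>The centralizer of \<open>w\<close> contains \<open>M\<close> and also
        \<open>g\<close> outside \<open>M\<close>. Since \<open>M\<close> has index p, it is the
        whole group.\<close>
      define H where "H = {h \<in> carrier G. \<forall>a\<in>{w}. h \<otimes> a = a \<otimes> h}"
      have "subgroup H G"
        unfolding H_def by (rule subgroup_centralizer) (use wM in simp)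
      moreover have "g \<in> H"
      proof -
        have "(g \<otimes> w \<otimes> inv g) \<otimes> g = w \<otimes> g" using w_fix by simp
        then show ?thesis using g wM by (simp add: H_def m_assoc)
      qed
      moreover have "C.M \<subseteq> H" using M_comm wM by (auto simp: H_def)
      ultimately have "p * card C.M \<le> card H"
        using False by (intro card_proper_subgroup [OF C.subgroup_M]) auto
      then have "H = carrier G"
        using C.index_M fin by (intro card_seteq) (auto simp: H_def)
      then have "w \<in> center_mod {\<one>}" using wM by (intro group_centerI) (auto simp: H_def)
      moreover have "commutator g x = w"
      proof -
        have "commutator g x = x \<otimes> w \<otimes> inv x" using g x gx by (simp add: commutator_def)
        then show ?thesis using xM_comm [OF wM] x wM by (simp add: m_assoc)
      qed
      ultimately show ?thesis using commutator_ker_if_nonzero [OF x g] ZG by simp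
    qed
    then have xZ: "x \<in> Z" unfolding center_iff using x by blast
    have "y \<in> cyclic_center x" using C.y_in_M U by simp
    then obtain i z where "y = x [^] (i::nat) \<otimes> z" "z \<in> center_mod {\<one>}" unfolding cyclic_center_def by blast
    then show False using C.y center_pow(1) [OF xZ] ZG center_m_closed(1) by blast
  qed
  then have "p * card (cyclic_center x) \<le> card C.M"
    using UM by (intro card_proper_subgroup subgroup_cyclic_center C.subgroup_M fin x) auto
  then show ?thesis using C.index_M by (simp add: power2_eq_square mult_ac)
qed

section \<open>A noncentral element of order p in the second centre\<close>

context group
begin

text \<open>\<open>d\<close> is the commutator of \<open>y\<close> and \<open>x\<close>. Collecting
  all factors \<open>x\<close> on the left costs one \<open>d\<close> for each pair of a
  \<open>y\<close> standing before an \<open>x\<close>, n(n-1)/2 in all; the exponent is kept as a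
  sum to match \<open>dvd_sum_lessThan_odd\<close>.\<close>

lemma pow_mult_class2:
  assumes xyd: "x \<in> carrier G" "y \<in> carrier G" "d \<in> carrier G"
    and yx: "y \<otimes> x = d \<otimes> x \<otimes> y" and dx: "d \<otimes> x = x \<otimes> d" and dy: "d \<otimes> y = y \<otimes> d"
  shows "(x \<otimes> y) [^] (n::nat) = x [^] n \<otimes> y [^] n \<otimes> d [^] (\<Sum>l<n. l)"
proof -
  have dxn: "d [^] j \<otimes> x = x \<otimes> d [^] j" for j :: nat
    by (rule group_commutes_pow [OF dx]) (use xyd in auto)
  have dyn: "d [^] j \<otimes> y = y \<otimes> d [^] j" for j :: nat
    by (rule group_commutes_pow [OF dy]) (use xyd in auto)
  have ynx: "y [^] j \<otimes> x = x \<otimes> y [^] j \<otimes> d [^] j" for j :: nat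
  proof (induction j)
    case (Suc j)
    have "y [^] Suc j \<otimes> x = y [^] j \<otimes> (y \<otimes> x)" using xyd by (simp add: m_assoc)
    also have "\<dots> = y [^] j \<otimes> (x \<otimes> d \<otimes> y)" by (simp add: yx dx)
    also have "\<dots> = (y [^] j \<otimes> x) \<otimes> (y \<otimes> d)" using xyd dy by (simp add: m_assoc)
    also have "\<dots> = x \<otimes> y [^] j \<otimes> (d [^] j \<otimes> y) \<otimes> d" unfolding Suc using xyd by (simp add: m_assoc)
    also have "\<dots> = x \<otimes> y [^] Suc j \<otimes> d [^] Suc j" unfolding dyn using xyd by (simp add: m_assoc)
    finally show ?case .
  qed (use xyd in simp)
  show ?thesis
  proof (induction n)
    case (Suc n)
    have dD: "d [^] i \<otimes> d [^] j = d [^] (i + j)" for i j :: nat using xyd by (simp add: nat_pow_mult)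
    let ?s = "\<Sum>l<n. l"
    have "(x \<otimes> y) [^] Suc n = x [^] n \<otimes> y [^] n \<otimes> (d [^] ?s \<otimes> x) \<otimes> y"
      using Suc xyd by (simp add: m_assoc)
    also have "\<dots> = x [^] n \<otimes> (y [^] n \<otimes> x) \<otimes> (d [^] ?s \<otimes> y)" unfolding dxn using xyd by (simp add: m_assoc)
    also have "\<dots> = x [^] n \<otimes> x \<otimes> y [^] n \<otimes> ((d [^] n \<otimes> d [^] ?s) \<otimes> y)"
      unfolding ynx using xyd by (simp add: m_assoc)
    also have "d [^] n \<otimes> d [^] ?s = d [^] (\<Sum>l<Suc n. l)" by (simp add: dD add.commute)
    also have "x [^] n \<otimes> x \<otimes> y [^] n \<otimes> (d [^] (\<Sum>l<Suc n. l) \<otimes> y) = x [^] Suc n \<otimes> y [^] Suc n \<otimes> d [^] (\<Sum>l<Suc n. l)"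
      unfolding dyn using xyd by (simp add: m_assoc)
    finally show ?case .
  qed (use xyd in simp)
qed

lemma pow_mult_class2_odd:
  assumes "x \<in> carrier G" "y \<in> carrier G" "d \<in> carrier G"
    and "y \<otimes> x = d \<otimes> x \<otimes> y" "d \<otimes> x = x \<otimes> d" "d \<otimes> y = y \<otimes> d"
    and "odd p" "d [^] p = \<one>"
  shows "(x \<otimes> y) [^] (p::nat) = x [^] p \<otimes> y [^] p"
proof -
  obtain k where "(\<Sum>l<p. l) = p * k" using dvd_sum_lessThan_odd [OF assms(7)] by (auto elim: dvdE)
  then have "d [^] (\<Sum>l<p. l) = \<one>" using assms by (simp add: nat_pow_pow [symmetric])
  then show ?thesis using pow_mult_class2 [OF assms(1-6), of p] assms(1,2) by simp
qed

end

context pgroup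
begin

text \<open>With a maximal abelian normal subgroup \<open>A\<close> whose elements of order \<open>p\<close> are central, some
  element of order \<open>p\<close> outside \<open>A\<close> is central modulo \<open>A\<close>, and all its conjugates differ from it
  by elements of order \<open>p\<close> of \<open>A\<close>.\<close>

lemma exists_noncentral_order_p:
  assumes odd: "odd p" and nonab: "center_mod {\<one>} \<noteq> carrier G"
    and few: "card {z \<in> center_mod {\<one>}. z [^] p = \<one>} \<le> p"
  obtains e where "e \<in> carrier G" "e \<in> center_mod (center_mod {\<one>})" "e \<notin> center_mod {\<one>}" "e [^] p = \<one>"
proof -
  let ?Z = "center_mod {\<one>}"
  interpret Z: subgroup ?Z G by (rule subgroup_group_center)
  have normal_Z: "?Z \<lhd> G"
  proof -
    have "g \<otimes> z \<otimes> inv g = z" if "g \<in> carrier G" "z \<in> ?Z" for g z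
      using center_commute [OF that(2,1)] that by (simp add: m_assoc)
    then show ?thesis using Z.subgroup_axioms by (simp add: normal_inv_iff)
  qed
  define \<A> where "\<A> = {A. A \<lhd> G \<and> (\<forall>a\<in>A. \<forall>b\<in>A. a \<otimes> b = b \<otimes> a)}"
  have "\<A> \<subseteq> Pow (carrier G)" using normal_imp_subgroup subgroup.subset by (fastforce simp: \<A>_def)
  then have "finite \<A>" using fin by (simp add: finite_subset)
  moreover have "{\<one>} \<in> \<A>" using one_is_normal by (simp add: \<A>_def)
  ultimately obtain A where A: "A \<in> \<A>" and max: "\<And>B. B \<in> \<A> \<Longrightarrow> A \<subseteq> B \<Longrightarrow> A = B"
    using finite_has_maximal [of \<A>] by blast
  have nA: "A \<lhd> G" and abA: "\<And>a b. a \<in> A \<Longrightarrow> b \<in> A \<Longrightarrow> a \<otimes> b = b \<otimes> a"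
    using A by (auto simp: \<A>_def)
  interpret A: normal A G by (rule nA)
  note A_pow = pow_mem_subgroup [OF A.subgroup_axioms]
  define \<Omega> where "\<Omega> = {a \<in> A. a [^] p = \<one>}"
  have sub\<Omega>: "subgroup \<Omega> G"
  proof (rule subgroupI)
    have "\<one> \<in> \<Omega>" by (simp add: \<Omega>_def)
    then show "\<Omega> \<noteq> {}" by blast
    show "a \<otimes> b \<in> \<Omega>" if "a \<in> \<Omega>" "b \<in> \<Omega>" for a b
      using that abA by (auto simp: \<Omega>_def pow_mult_distrib)
  qed (auto simp: \<Omega>_def nat_pow_inv)
  have n\<Omega>: "\<Omega> \<lhd> G"
    using sub\<Omega> normal_conj [OF nA] by (auto simp: normal_inv_iff \<Omega>_def conj_pow [symmetric])
  show ?thesis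
  proof (cases "\<Omega> \<subseteq> ?Z")
    case False
    \<comment> \<open>\<Omega> itself supplies the element: one that is noncentral but central
      modulo \<Omega> \<inter> Z(G).\<close>
    then have "\<Omega> \<inter> ?Z \<subset> \<Omega>" by blast
    moreover have "\<Omega> \<inter> ?Z \<lhd> G" using n\<Omega> normal_Z by (rule normal_subgroup_intersect)
    ultimately obtain y where y: "y \<in> \<Omega>" "y \<notin> \<Omega> \<inter> ?Z" "y \<in> center_mod (\<Omega> \<inter> ?Z)"
      using exists_central_mod n\<Omega> by blast
    then have "y \<in> center_mod ?Z" using center_mod_mono [of "\<Omega> \<inter> ?Z" ?Z] by blast
    then show ?thesis using that [of y] y by (auto simp: \<Omega>_def)
  next
    case True
    define C where "C = {c \<in> carrier G. \<forall>a\<in>A. c \<otimes> a = a \<otimes> c}"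
    have subC: "subgroup C G"
      unfolding C_def by (rule subgroup_centralizer [OF A.subset])
    have nC: "C \<lhd> G"
    proof -
      have "g \<otimes> c \<otimes> inv g \<in> C" if g: "g \<in> carrier G" and c: "c \<in> C" for g c
      proof -
        have cG: "c \<in> carrier G" using c by (simp add: C_def)
        have "g \<otimes> c \<otimes> inv g \<otimes> a = a \<otimes> (g \<otimes> c \<otimes> inv g)" if a: "a \<in> A" for a
        proof -
          have "c \<otimes> (inv g \<otimes> a \<otimes> g) = (inv g \<otimes> a \<otimes> g) \<otimes> c"
            using c A.inv_op_closed1 [OF g a] by (simp add: C_def)
          then have "g \<otimes> (c \<otimes> (inv g \<otimes> a \<otimes> g)) \<otimes> inv g = g \<otimes> ((inv g \<otimes> a \<otimes> g) \<otimes> c) \<otimes> inv g"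
            by simp
          then show ?thesis using g a cG by (simp add: m_assoc)
        qed
        then show ?thesis using g cG by (simp add: C_def)
      qed
      then show ?thesis using subC by (simp add: normal_inv_iff)
    qed
    have "A \<subseteq> C" using abA by (auto simp: C_def)
    \<comment> \<open>An element of the centralizer outside \<open>A\<close>, chosen central modulo
      \<open>A\<close>, would generate with \<open>A\<close> a larger abelian normal
      subgroup.\<close>
    have CA: "C = A"
    proof (rule ccontr)
      assume "C \<noteq> A"
      then have "A \<subset> C" using \<open>A \<subseteq> C\<close> by blast
      then obtain y where y: "y \<in> C" "y \<notin> A" "y \<in> center_mod A"
        using exists_central_mod nA nC by blast
      have yG: "y \<in> carrier G" and yA: "\<And>a. a \<in> A \<Longrightarrow> a \<otimes> y = y \<otimes> a" using y(1) by (auto simp: C_def)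
      define B where "B = {y [^] (i::nat) \<otimes> z | i z. z \<in> A}"
      have subB: "subgroup B G"
        unfolding B_def by (rule subgroup_cyclic_extension [OF fin A.subgroup_axioms yG yA])
      interpret B: subgroup B G by (rule subB)
      have AB: "A \<subseteq> B"
      proof
        fix a assume "a \<in> A"
        then have "y [^] (0::nat) \<otimes> a \<in> B" unfolding B_def by blast
        then show "a \<in> B" using \<open>a \<in> A\<close> by simp
      qed
      have "y [^] (1::nat) \<otimes> \<one> \<in> B" unfolding B_def using A.one_closed by blast
      then have yB: "y \<in> B" using yG by simp
      have "g \<otimes> b \<otimes> inv g \<in> B" if g: "g \<in> carrier G" and b: "b \<in> B" for g b
      proof -
        obtain i z where b: "b = y [^] (i::nat) \<otimes> z" "z \<in> A" using b unfolding B_def by blast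
        have "g \<otimes> b \<otimes> inv g = (g \<otimes> y \<otimes> inv g) [^] i \<otimes> (g \<otimes> z \<otimes> inv g)"
          unfolding conj_pow [OF g yG, symmetric] using b g yG by (simp add: m_assoc)
        moreover have "g \<otimes> y \<otimes> inv g \<in> B"
        proof -
          have "commutator g y \<in> A" using y(3) g unfolding center_mod_def by blast
          then have "commutator g y \<otimes> y \<in> B" using AB yB by blast
          then show ?thesis by (simp only: conj_eq_commutator [OF g yG])
        qed
        moreover have "g \<otimes> z \<otimes> inv g \<in> B" using normal_conj [OF nA g b(2)] AB by blast
        ultimately show ?thesis using pow_mem_subgroup [OF subB] by simp
      qed
      then have "B \<lhd> G" using subB by (simp add: normal_inv_iff)
      moreover have "b \<otimes> b' = b' \<otimes> b" if b: "b \<in> B" "b' \<in> B" for b b'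
      proof -
        obtain i z where b1: "b = y [^] (i::nat) \<otimes> z" "z \<in> A" using b unfolding B_def by blast
        obtain j w where b2: "b' = y [^] (j::nat) \<otimes> w" "w \<in> A" using b unfolding B_def by blast
        have comm: "a \<otimes> y [^] (k::nat) = y [^] k \<otimes> a" if "a \<in> A" for a k
          using group_commutes_pow [of y a k] yA [OF that] that yG by simp
        have "b \<otimes> b' = y [^] i \<otimes> (z \<otimes> y [^] j) \<otimes> w" using b1 b2 yG by (simp add: m_assoc)
        also have "\<dots> = y [^] (i + j) \<otimes> (z \<otimes> w)"
          unfolding comm [OF b1(2)] using b1 b2 yG by (simp add: m_assoc nat_pow_mult [symmetric])
        finally have 1: "b \<otimes> b' = y [^] (i + j) \<otimes> (z \<otimes> w)" .
        have "b' \<otimes> b = y [^] j \<otimes> (w \<otimes> y [^] i) \<otimes> z" using b1 b2 yG by (simp add: m_assoc)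
        also have "\<dots> = y [^] (j + i) \<otimes> (w \<otimes> z)"
          unfolding comm [OF b2(2)] using b1 b2 yG by (simp add: m_assoc nat_pow_mult [symmetric])
        finally show ?thesis using 1 abA [OF b1(2) b2(2)] by (simp add: add.commute)
      qed
      ultimately have "B \<in> \<A>" by (simp add: \<A>_def)
      then have "A = B" using max AB by blast
      then show False using yB y by blast
    qed
    have "carrier G \<lhd> G" by (simp add: normal_inv_iff subgroup_self)
    moreover have "A \<noteq> carrier G"
    proof
      assume "A = carrier G"
      then have "carrier G \<subseteq> ?Z" using abA by (auto intro!: group_centerI)
      then show False using nonab Z.subset by blast
    qed
    ultimately obtain g where g: "g \<in> carrier G" "g \<notin> A" "g \<in> center_mod A" "g [^] p \<in> A"
      using exists_central_mod_prime [OF nA, of "carrier G"] A.subset by blast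
    \<comment> \<open>Commutation with \<open>g\<close> is an endomorphism of \<open>A\<close>,
      because \<open>A\<close> is abelian and normal. It is trivial on \<Omega>, which is central in
      the present case.\<close>
    define \<delta> where "\<delta> a = commutator g a" for a
    have \<delta>A: "\<delta> a \<in> A" if "a \<in> A" for a
      using normal_conj [OF nA g(1) that] that by (simp add: \<delta>_def commutator_def)
    have ga: "g \<otimes> a \<otimes> inv g = a \<otimes> \<delta> a" if a: "a \<in> A" for a
      using conj_eq_commutator [OF g(1), of a] abA [OF \<delta>A [OF a] a] a by (simp add: \<delta>_def)
    have \<delta>_mult: "\<delta> (a \<otimes> b) = \<delta> a \<otimes> \<delta> b" if a: "a \<in> A" and b: "b \<in> A" for a b
    proof -
      have "(a \<otimes> b) \<otimes> \<delta> (a \<otimes> b) = (g \<otimes> a \<otimes> inv g) \<otimes> (g \<otimes> b \<otimes> inv g)"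
        using ga [of "a \<otimes> b"] a b g by (simp add: m_assoc)
      also have "\<dots> = a \<otimes> (\<delta> a \<otimes> b) \<otimes> \<delta> b"
        using a b ga \<delta>A by (simp add: m_assoc)
      also have "\<dots> = (a \<otimes> b) \<otimes> (\<delta> a \<otimes> \<delta> b)"
        unfolding abA [OF \<delta>A [OF a] b] using a b \<delta>A [OF a] \<delta>A [OF b] by (simp add: m_assoc)
      finally show ?thesis using a b \<delta>A [OF a] \<delta>A [OF b] \<delta>A [of "a \<otimes> b"] by simp
    qed
    have \<delta>_pow: "\<delta> (a [^] n) = \<delta> a [^] n" if a: "a \<in> A" for a and n :: nat
    proof (induction n)
      case 0
      then show ?case using g by (simp add: \<delta>_def commutator_def)
    next
      case (Suc n)
      then show ?case using \<delta>_mult [OF A_pow [OF a, of n] a] by simp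
    qed
    have \<delta>\<Omega>: "\<delta> a = \<one>" if "a \<in> \<Omega>" for a
    proof -
      have a: "a \<in> ?Z" using that True by blast
      show ?thesis using center_commute [OF a g(1)] a g by (simp add: \<delta>_def commutator_def m_assoc)
    qed
    have gp: "g [^] p \<otimes> a \<otimes> inv (g [^] p) = a" if "a \<in> A" for a
      using abA [OF g(4) that] g that by (simp add: m_assoc)
    \<comment> \<open>Induction on the exponent of the order of \<open>a\<close>. With d =
      \<delta>(a) and f = \<delta>(d), the hypothesis for a^p puts d^p in \<Omega>, so f^p =
      \<delta>(d^p) = 1 and \<open>g\<close> centralizes \<open>f\<close>. Hence g^j moves
      \<open>a\<close> to a d^j f^(j(j-1)/2). At j = p nothing moves, as g^p lies in the abelian
      group \<open>A\<close>, and the power of \<open>f\<close> is trivial for odd p; so d^p =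
      1.\<close>
    have \<delta>p_aux: "\<delta> a [^] p = \<one>" if "a \<in> A" "a [^] (p ^ n) = \<one>" for a n
      using that
    proof (induction n arbitrary: a)
      case 0
      then show ?case using g by (simp add: \<delta>_def commutator_def)
    next
      case (Suc n)
      have a: "a \<in> A" "a \<in> carrier G" using Suc.prems by auto
      define d where "d = \<delta> a"
      have d: "d \<in> A" "d \<in> carrier G" using \<delta>A [OF a(1)] by (auto simp: d_def)
      define f where "f = \<delta> d"
      have f: "f \<in> A" "f \<in> carrier G" using \<delta>A [OF d(1)] by (auto simp: f_def)
      have "(a [^] p) [^] (p ^ n) = \<one>" using Suc.prems a by (simp add: nat_pow_pow)
      then have "\<delta> (a [^] p) [^] p = \<one>" using Suc.IH A_pow [OF a(1)] by blast
      then have "d [^] p \<in> \<Omega>"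
        using \<delta>_pow [OF a(1)] A_pow [OF d(1)] by (simp add: \<Omega>_def d_def)
      then have "f [^] p = \<one>" using \<delta>\<Omega> [of "d [^] p"] \<delta>_pow [OF d(1), of p] by (simp only: f_def)
      then have "f \<in> \<Omega>" using f by (simp add: \<Omega>_def)
      then have "\<delta> f = \<one>" by (rule \<delta>\<Omega>)
      then have gf: "g \<otimes> f \<otimes> inv g = f" using ga [OF f(1)] f by simp
      have gjd: "g [^] j \<otimes> d \<otimes> inv (g [^] j) = d \<otimes> f [^] j" for j :: nat
      proof (induction j)
        case (Suc j)
        have gjf: "g [^] j \<otimes> f \<otimes> inv (g [^] j) = f" for j :: nat
        proof (induction j)
          case (Suc j)
          have "g [^] Suc j \<otimes> f \<otimes> inv (g [^] Suc j) = g [^] j \<otimes> (g \<otimes> f \<otimes> inv g) \<otimes> inv (g [^] j)"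
            using g f by (simp add: word_simps)
          then show ?case using Suc gf by simp
        qed (use f in simp)
        have "g [^] Suc j \<otimes> d \<otimes> inv (g [^] Suc j) = g [^] j \<otimes> (g \<otimes> d \<otimes> inv g) \<otimes> inv (g [^] j)"
          using g d by (simp add: word_simps)
        also have "\<dots> = (g [^] j \<otimes> d \<otimes> inv (g [^] j)) \<otimes> (g [^] j \<otimes> f \<otimes> inv (g [^] j))"
          unfolding ga [OF d(1)] f_def [symmetric] using g d f by (simp add: word_simps)
        finally show ?case using Suc d f by (simp add: gjf m_assoc)
      qed (use d in simp)
      have gja: "g [^] j \<otimes> a \<otimes> inv (g [^] j) = a \<otimes> (d [^] j \<otimes> f [^] (\<Sum>l<j. l))" for j :: nat
      proof (induction j)
        case (Suc j)
        let ?s = "\<Sum>l<j. l"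
        have "g [^] Suc j \<otimes> a \<otimes> inv (g [^] Suc j) = g [^] j \<otimes> (g \<otimes> a \<otimes> inv g) \<otimes> inv (g [^] j)"
          using g a by (simp add: word_simps)
        also have "\<dots> = (g [^] j \<otimes> a \<otimes> inv (g [^] j)) \<otimes> (g [^] j \<otimes> d \<otimes> inv (g [^] j))"
          unfolding ga [OF a(1)] d_def [symmetric] using g a d by (simp add: word_simps)
        also have "\<dots> = a \<otimes> d [^] j \<otimes> (f [^] ?s \<otimes> d) \<otimes> f [^] j"
          unfolding Suc gjd using a d f by (simp add: m_assoc)
        also have "f [^] ?s \<otimes> d = d \<otimes> f [^] ?s"
          using abA [OF A_pow [OF f(1)] d(1)] .
        finally show ?case using a d f by (simp add: m_assoc nat_pow_mult)
      qed (use a in simp)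
      obtain k where "(\<Sum>l<p. l) = p * k" using dvd_sum_lessThan_odd [OF odd] by (auto elim: dvdE)
      then have "f [^] (\<Sum>l<p. l) = \<one>" using \<open>f [^] p = \<one>\<close> f by (simp add: nat_pow_pow [symmetric])
      then have "a \<otimes> d [^] p = a" using gja [of p] gp [OF a(1)] d by simp
      then show ?case using a d by (simp add: d_def)
    qed
    have \<delta>p: "\<delta> a \<in> \<Omega>" if "a \<in> A" for a
    proof -
      obtain n where "card (carrier G) = p ^ n" using card_eq by blast
      then have "a [^] (p ^ n) = \<one>" using pow_order_eq_1 [of a] that by (simp add: Coset.order_def)
      then show ?thesis using \<delta>p_aux [OF that] \<delta>A [OF that] by (simp add: \<Omega>_def)
    qed
    \<comment> \<open>\<open>D\<close> consists of the elements of \<open>A\<close> fixed by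
      \<open>g\<close>, and \<open>Q\<close> of the p-th powers in \<open>A\<close>. The aim is
      \<open>Q = D\<close>. The inclusion of \<open>Q\<close> in \<open>D\<close> holds because
      \<delta> has values in \<Omega>. For the sizes, \<open>D\<close> has index at least p in
      \<open>A\<close>, while p-th powering on \<open>A\<close> has fibres of at most |\<Omega>| <=
      p elements; the bound \<open>few\<close> enters here.\<close>
    define D where "D = {a \<in> A. \<delta> a = \<one>}"
    define Q where "Q = (\<lambda>a. a [^] p) ` A"
    have "D \<noteq> A"
    proof
      assume "D = A"
      have "g \<otimes> a = a \<otimes> g" if a: "a \<in> A" for a
      proof -
        have "\<delta> a = \<one>" using a \<open>D = A\<close> by (auto simp: D_def)
        then have "g \<otimes> a \<otimes> inv g = a" using ga [OF a] a by simp
        then have "(g \<otimes> a \<otimes> inv g) \<otimes> g = a \<otimes> g" by simp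
        then show ?thesis using g a by (simp add: m_assoc)
      qed
      then have "g \<in> C" using g by (simp add: C_def)
      then show False using CA g by simp
    qed
    have finA: "finite A" using finite_subgroup A.subgroup_axioms by blast
    have subD: "subgroup D G"
    proof (rule subgroupI)
      have "\<delta> \<one> = \<one>" using g by (simp add: \<delta>_def commutator_def)
      then show "D \<noteq> {}" unfolding D_def using A.one_closed by blast
      show "inv a \<in> D" if "a \<in> D" for a
        using that \<delta>_mult [of a "inv a"] \<open>\<delta> \<one> = \<one>\<close> \<delta>A [of "inv a"] by (auto simp: D_def)
    qed (auto simp: D_def \<delta>_mult)
    have "p * card D \<le> card A"
      using \<open>D \<noteq> A\<close> by (intro card_proper_subgroup subD A.subgroup_axioms) (auto simp: D_def)
    moreover have "card A \<le> p * card Q"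
    proof -
      have fiber: "card {a \<in> A. a [^] p = q} \<le> p" if q: "q \<in> Q" for q
      proof -
        obtain a0 where a0: "a0 \<in> A" "q = a0 [^] p" using q by (auto simp: Q_def)
        have "card {a \<in> A. a [^] p = q} \<le> card \<Omega>"
        proof (rule card_inj_on_le [of "\<lambda>a. a \<otimes> inv a0"])
          show "inj_on (\<lambda>a. a \<otimes> inv a0) {a \<in> A. a [^] p = q}" using a0 by (auto simp: inj_on_def)
          show "(\<lambda>a. a \<otimes> inv a0) ` {a \<in> A. a [^] p = q} \<subseteq> \<Omega>"
            using a0 abA by (auto simp: \<Omega>_def pow_mult_distrib nat_pow_inv)
          show "finite \<Omega>" using finA by (simp add: \<Omega>_def)
        qed
        also have "\<dots> \<le> card {z \<in> ?Z. z [^] p = \<one>}"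
          using True finite_subgroup [OF Z.subgroup_axioms] by (intro card_mono) (auto simp: \<Omega>_def)
        finally show ?thesis using few by linarith
      qed
      have "A = (\<Union>q\<in>Q. {a \<in> A. a [^] p = q})" by (auto simp: Q_def)
      then have "card A \<le> (\<Sum>q\<in>Q. card {a \<in> A. a [^] p = q})"
        using card_UN_le [of Q "\<lambda>q. {a \<in> A. a [^] p = q}"] finA by (simp add: Q_def)
      also have "\<dots> \<le> (\<Sum>q\<in>Q. p)" by (rule sum_mono) (rule fiber)
      finally show ?thesis by (simp add: mult.commute)
    qed
    ultimately have "p * card D \<le> p * card Q" by linarith
    then have "card D \<le> card Q" using p_gt_1 by simp
    moreover have "Q \<subseteq> D"
    proof
      fix q assume "q \<in> Q"
      then obtain a where a: "a \<in> A" "q = a [^] p" by (auto simp: Q_def)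
      have "\<delta> q = \<delta> a [^] p" unfolding a(2) by (rule \<delta>_pow [OF a(1)])
      moreover have "\<delta> a [^] p = \<one>" using \<delta>p [OF a(1)] by (simp add: \<Omega>_def)
      moreover have "q \<in> A" unfolding a(2) by (rule A_pow [OF a(1)])
      ultimately show "q \<in> D" by (simp add: D_def)
    qed
    moreover have "finite D" using finA by (simp add: D_def)
    ultimately have QD: "Q = D" by (intro card_seteq) auto
    have "g [^] p \<in> D"
    proof -
      have "g \<otimes> g [^] p \<otimes> inv g = g [^] p" using conj_pow [OF g(1) g(1), of p] g by (simp add: m_assoc)
      then show ?thesis using g by (simp add: D_def \<delta>_def commutator_def)
    qed
    then obtain a0 where a0: "a0 \<in> A" "g [^] p = a0 [^] p" using QD by (auto simp: Q_def)
    \<comment> \<open>As g^p is fixed by \<open>g\<close>, it is a p-th power a0^p in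
      \<open>A\<close>; dividing \<open>g\<close> by \<open>a0\<close> removes it, since p-th powers
      are multiplicative on such products.\<close>
    define b where "b = inv a0 \<otimes> g"
    have b: "b \<in> carrier G" using a0 g by (simp add: b_def)
    have pow: "(a \<otimes> h) [^] p = a [^] p \<otimes> h [^] p" if a: "a \<in> A" and h: "h \<in> carrier G" "h \<otimes> a = a \<otimes> \<delta> a \<otimes> h" for a h
    proof (rule pow_mult_class2_odd)
      have d: "\<delta> a \<in> \<Omega>" "\<delta> a \<in> ?Z" "\<delta> a \<in> A" using \<delta>p [OF a] True \<delta>A [OF a] by auto
      show "\<delta> a [^] p = \<one>" using d by (simp add: \<Omega>_def)
      show "\<delta> a \<otimes> a = a \<otimes> \<delta> a" by (rule abA [OF d(3) a])
      then show "h \<otimes> a = \<delta> a \<otimes> a \<otimes> h" using h by simp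
      show "\<delta> a \<otimes> h = h \<otimes> \<delta> a" using center_commute [OF d(2) h(1)] by simp
    qed (use a h \<delta>A [OF a] odd in auto)
    have ga': "g \<otimes> a = a \<otimes> \<delta> a \<otimes> g" if "a \<in> A" for a
    proof -
      have "(g \<otimes> a \<otimes> inv g) \<otimes> g = a \<otimes> \<delta> a \<otimes> g" using ga [OF that] by simp
      then show ?thesis using g that by (simp add: m_assoc)
    qed
    have ba: "b \<otimes> a = a \<otimes> \<delta> a \<otimes> b" if a: "a \<in> A" for a
    proof -
      have "b \<otimes> a = inv a0 \<otimes> (g \<otimes> a)" using a a0 g by (simp add: b_def m_assoc)
      also have "\<dots> = (inv a0 \<otimes> (a \<otimes> \<delta> a)) \<otimes> g" unfolding ga' [OF a] using a a0 g \<delta>A [OF a] by (simp add: m_assoc)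
      also have "inv a0 \<otimes> (a \<otimes> \<delta> a) = (a \<otimes> \<delta> a) \<otimes> inv a0" using a a0 \<delta>A [OF a] by (intro abA) auto
      finally show ?thesis using a a0 g \<delta>A [OF a] by (simp add: b_def m_assoc)
    qed
    have bp: "b [^] p = \<one>"
      unfolding b_def using pow [of "inv a0" g] ga' a0 g by (simp add: nat_pow_inv)
    have bA: "b \<notin> A"
    proof
      assume "b \<in> A"
      then have "a0 \<otimes> b \<in> A" using a0 by simp
      then show False using a0 g by (simp add: b_def)
    qed
    have "b \<notin> ?Z"
    proof
      assume "b \<in> ?Z"
      then have "b \<in> C" using center_commute [of b] b by (auto simp: C_def)
      then show False using CA bA by simp
    qed
    moreover have "b \<in> center_mod ?Z"
    proof -
      interpret CA: subgroup "center_mod A" G by (rule subgroup_center_mod [OF nA])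
      have "inv a0 \<in> center_mod A" using a0 subset_center_mod [OF nA] by (meson A.m_inv_closed subsetD)
      then have bc: "b \<in> center_mod A" unfolding b_def using g(3) by (rule CA.m_closed)
      \<comment> \<open>The conjugate [h,b] b of \<open>b\<close> also has trivial p-th power, so
        [h,b] is an element of \<open>A\<close> with trivial p-th power, that is, of
        \<Omega>.\<close>
      have "commutator h b \<in> ?Z" if h: "h \<in> carrier G" for h
      proof -
        let ?a = "commutator h b"
        have aA: "?a \<in> A" using bc h unfolding center_mod_def by blast
        have "?a \<otimes> b = h \<otimes> b \<otimes> inv h" by (rule conj_eq_commutator [OF h b, symmetric])
        then have "(?a \<otimes> b) [^] p = h \<otimes> b [^] p \<otimes> inv h" by (simp only: conj_pow [OF h b])
        then have "(?a \<otimes> b) [^] p = \<one>" unfolding bp using h by simp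
        then have "?a [^] p = \<one>" using pow [OF aA b ba [OF aA]] bp aA by simp
        then show ?thesis using aA True by (auto simp: \<Omega>_def)
      qed
      then show ?thesis unfolding center_mod_def [of ?Z] using b by blast
    qed
    ultimately show ?thesis using that b bp by blast
  qed
qed

end

section \<open>Faithful characters of degree at most \<open>p\<^sup>3\<close>\<close>

lemma (in group) card_rcoset_image:
  assumes fin: "finite (carrier G)" and N: "N \<lhd> G"
  shows "(\<Sum>g\<in>carrier G. f (N #> g) :: complex) = of_nat (card N) * (\<Sum>C\<in>carrier (G Mod N). f C)"
proof -
  interpret N: normal N G by (rule N)
  have img: "(\<lambda>g. N #> g) ` carrier G = carrier (G Mod N)" by (simp add: carrier_FactGroup)
  have fiber: "{g \<in> carrier G. N #> g = C} = C" if C: "C \<in> carrier (G Mod N)" for C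
  proof -
    obtain h where h: "h \<in> carrier G" "C = N #> h" using C by (auto simp: carrier_FactGroup)
    show ?thesis
    proof (intro equalityI subsetI)
      fix g assume "g \<in> {g \<in> carrier G. N #> g = C}"
      then show "g \<in> C" using rcos_self [of g N] N.subgroup_axioms by auto
    next
      fix g assume g: "g \<in> C"
      then have "g \<in> N #> h" using h(2) by simp
      then have "N #> h = N #> g" "g \<in> carrier G"
        using repr_independence [OF _ h(1) N.subgroup_axioms] r_coset_subset_G [OF N.subset h(1)] by auto
      then show "g \<in> {g \<in> carrier G. N #> g = C}" using h(2) by simp
    qed
  qed
  have card: "card C = card N" if "C \<in> carrier (G Mod N)" for C
    using card_cosets_equal [of C N] that N.subset by (auto simp: FactGroup_def dest: bij_betw_same_card)
  have "(\<Sum>g\<in>carrier G. f (N #> g))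
      = (\<Sum>C\<in>(\<lambda>g. N #> g) ` carrier G. \<Sum>g\<in>{g \<in> carrier G. N #> g = C}. f (N #> g))"
    by (rule sum.image_gen [OF fin])
  also have "\<dots> = (\<Sum>C\<in>carrier (G Mod N). of_nat (card N) * f C)"
    unfolding img
  proof (rule sum.cong)
    fix C assume C: "C \<in> carrier (G Mod N)"
    have "(\<Sum>g\<in>{g \<in> carrier G. N #> g = C}. f (N #> g)) = (\<Sum>g\<in>{g \<in> carrier G. N #> g = C}. f C)"
      by (rule sum.cong) auto
    then show "(\<Sum>g\<in>{g \<in> carrier G. N #> g = C}. f (N #> g)) = of_nat (card N) * f C"
      using card [OF C] by (simp add: fiber [OF C])
  qed simp
  finally show ?thesis by (simp add: sum_distrib_left)
qed

text \<open>The quotient is handed over as an abstract surjection \<pi> with its kernel, so that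
  later arguments never touch cosets. \<phi>' reads \<phi> at an arbitrary representative, which is
  harmless because \<open>K\<close> does not affect values.\<close>

lemma (in pgroup_char) obtain_faithful_quotient:
  obtains Q :: "'a set monoid" and \<pi> \<phi>' where
    "pgroup_char Q \<phi>' p" "group_hom G Q \<pi>" "\<pi> ` carrier G = carrier Q"
    "\<And>g. g \<in> carrier G \<Longrightarrow> \<pi> g = \<one>\<^bsub>Q\<^esub> \<longleftrightarrow> g \<in> K"
    "\<And>g. g \<in> carrier G \<Longrightarrow> \<phi>' (\<pi> g) = \<phi> g"
    "char_ker Q \<phi>' = {\<one>\<^bsub>Q\<^esub>}"
    "card (carrier Q) * card K = card (carrier G)"
proof -
  interpret K: normal K G by (rule normal_ker)
  let ?Q = "G Mod K"
  define \<pi> where "\<pi> g = K #> g" for g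
  define \<phi>' where "\<phi>' C = \<phi> (SOME g. g \<in> C)" for C
  interpret Q: group ?Q by (rule K.factorgroup_is_group)
  interpret \<pi>: group_hom G ?Q \<pi>
    using K.r_coset_hom_Mod by unfold_locales (simp add: \<pi>_def [abs_def])
  have \<phi>': "\<phi>' (\<pi> g) = \<phi> g" if g: "g \<in> carrier G" for g
  proof -
    have "g \<in> \<pi> g" unfolding \<pi>_def by (rule rcos_self [OF g K.subgroup_axioms])
    then have "(SOME h. h \<in> \<pi> g) \<in> \<pi> g" by (rule someI)
    then obtain k where k: "k \<in> K" "(SOME h. h \<in> \<pi> g) = k \<otimes> g" by (auto simp: \<pi>_def r_coset_def)
    then show ?thesis using center_mult [of k \<one> g] g by (simp add: \<phi>'_def ker_iff)
  qed
  have surj: "\<pi> ` carrier G = carrier ?Q" by (simp add: carrier_FactGroup \<pi>_def)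
  have ker: "\<pi> g = \<one>\<^bsub>?Q\<^esub> \<longleftrightarrow> g \<in> K" if "g \<in> carrier G" for g
    using coset_join1 [OF _ that K.subgroup_axioms] coset_join2 [OF that K.subgroup_axioms] by (auto simp: \<pi>_def)
  have card: "card (carrier ?Q) * card K = card (carrier G)"
    using lagrange [OF K.subgroup_axioms] by (simp add: FactGroup_def Coset.order_def)
  have sum: "(\<Sum>g\<in>carrier G. f (\<pi> g)) = of_nat (card K) * (\<Sum>C\<in>carrier ?Q. f C)" for f :: "'a set \<Rightarrow> complex"
    unfolding \<pi>_def by (rule card_rcoset_image [OF fin normal_ker])
  have cK: "card K > 0"
    using card card_pos by (cases "card K") auto
  have cc: "of_nat (card (carrier G)) = of_nat (card (carrier ?Q)) * (of_nat (card K) :: complex)"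
    unfolding card [symmetric] by (rule of_nat_mult)
  have irr: "irr_char ?Q \<phi>'"
  proof
    show "finite (carrier ?Q)" using surj fin by (metis finite_imageI)
    fix A B assume A: "A \<in> carrier ?Q" and B: "B \<in> carrier ?Q"
    obtain a b where a: "a \<in> carrier G" "A = \<pi> a" and b: "b \<in> carrier G" "B = \<pi> b"
      using A B surj by (metis image_iff)
    have "\<phi>' (\<pi> \<one>) * (of_nat (card K) * (\<Sum>H\<in>carrier ?Q. \<phi>' (A \<otimes>\<^bsub>?Q\<^esub> (H \<otimes>\<^bsub>?Q\<^esub> B \<otimes>\<^bsub>?Q\<^esub> inv\<^bsub>?Q\<^esub> H))))
        = \<phi>' (\<pi> \<one>) * (\<Sum>h\<in>carrier G. \<phi>' (A \<otimes>\<^bsub>?Q\<^esub> (\<pi> h \<otimes>\<^bsub>?Q\<^esub> B \<otimes>\<^bsub>?Q\<^esub> inv\<^bsub>?Q\<^esub> \<pi> h)))"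
      by (rule arg_cong [OF sum [symmetric]])
    also have "\<dots> = \<phi> \<one> * (\<Sum>h\<in>carrier G. \<phi> (a \<otimes> (h \<otimes> b \<otimes> inv h)))"
    proof -
      have "\<phi>' (A \<otimes>\<^bsub>?Q\<^esub> (\<pi> h \<otimes>\<^bsub>?Q\<^esub> B \<otimes>\<^bsub>?Q\<^esub> inv\<^bsub>?Q\<^esub> \<pi> h)) = \<phi> (a \<otimes> (h \<otimes> b \<otimes> inv h))"
        if h: "h \<in> carrier G" for h
      proof -
        have "A \<otimes>\<^bsub>?Q\<^esub> (\<pi> h \<otimes>\<^bsub>?Q\<^esub> B \<otimes>\<^bsub>?Q\<^esub> inv\<^bsub>?Q\<^esub> \<pi> h) = \<pi> (a \<otimes> (h \<otimes> b \<otimes> inv h))"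
          using a b h by (simp only: \<pi>.hom_mult \<pi>.hom_inv m_closed inv_closed)
        then show ?thesis using a(1) b(1) h by (simp only: \<phi>' m_closed inv_closed)
      qed
      then show ?thesis using \<phi>' [OF one_closed] by simp
    qed
    also have "\<dots> = of_nat (card K) * (of_nat (card (carrier ?Q)) * \<phi>' A * \<phi>' B)"
    proof -
      have "\<phi>' A = \<phi> a" "\<phi>' B = \<phi> b" using \<phi>' a b by simp_all
      then show ?thesis unfolding convolution [OF a(1) b(1)] cc by (simp only: mult_ac)
    qed
    finally show "\<phi>' \<one>\<^bsub>?Q\<^esub> * (\<Sum>H\<in>carrier ?Q. \<phi>' (A \<otimes>\<^bsub>?Q\<^esub> (H \<otimes>\<^bsub>?Q\<^esub> B \<otimes>\<^bsub>?Q\<^esub> inv\<^bsub>?Q\<^esub> H)))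
        = of_nat (card (carrier ?Q)) * \<phi>' A * \<phi>' B"
      using cK by (simp only: \<pi>.hom_one) simp
  next
    have "of_nat (card K) * (\<Sum>H\<in>carrier ?Q. \<phi>' H * \<phi>' (inv\<^bsub>?Q\<^esub> H)) = (\<Sum>h\<in>carrier G. \<phi>' (\<pi> h) * \<phi>' (inv\<^bsub>?Q\<^esub> \<pi> h))"
      by (rule sum [symmetric])
    also have "\<dots> = (\<Sum>h\<in>carrier G. \<phi> h * \<phi> (inv h))"
    proof (rule sum.cong)
      fix h assume h: "h \<in> carrier G"
      have "inv\<^bsub>?Q\<^esub> \<pi> h = \<pi> (inv h)" using h by (simp only: \<pi>.hom_inv)
      then show "\<phi>' (\<pi> h) * \<phi>' (inv\<^bsub>?Q\<^esub> \<pi> h) = \<phi> h * \<phi> (inv h)"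
        using h by (simp only: \<phi>' inv_closed)
    qed simp
    also have "\<dots> = of_nat (card K) * of_nat (card (carrier ?Q))" unfolding norm cc by (rule mult.commute)
    finally show "(\<Sum>H\<in>carrier ?Q. \<phi>' H * \<phi>' (inv\<^bsub>?Q\<^esub> H)) = of_nat (card (carrier ?Q))"
      using cK by simp
  qed
  then interpret Q: irr_char ?Q \<phi>' .
  have "pgroup ?Q p"
  proof
    obtain n where "card (carrier G) = p ^ n" using card_eq by blast
    then show "\<exists>n. card (carrier ?Q) = p ^ n"
      using card divides_primepow_nat [OF prime, of "card (carrier ?Q)" n] by (metis dvd_triv_left)
  qed (use Q.fin prime in auto)
  moreover have "char_ker ?Q \<phi>' = {\<one>\<^bsub>?Q\<^esub>}"
  proof -
    have "C = \<one>\<^bsub>?Q\<^esub>" if C: "C \<in> char_ker ?Q \<phi>'" for C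
    proof -
      have "C \<in> carrier ?Q" using Q.ker_closed [OF C] .
      then obtain g where g: "g \<in> carrier G" "C = \<pi> g" using surj by (metis image_iff)
      have "\<phi> (a \<otimes> g) = \<phi> a" if a: "a \<in> carrier G" for a
      proof -
        have "\<phi>' (\<pi> a \<otimes>\<^bsub>?Q\<^esub> C) = \<phi>' (\<pi> a)"
          using C \<pi>.hom_closed [OF a] unfolding char_ker_def by blast
        then have "\<phi>' (\<pi> (a \<otimes> g)) = \<phi>' (\<pi> a)" using a g by (simp only: \<pi>.hom_mult)
        then show ?thesis by (simp only: \<phi>' a g m_closed)
      qed
      then have "g \<in> K" unfolding char_ker_def using g by simp
      then show ?thesis using ker g by blast
    qed
    moreover have "\<one>\<^bsub>?Q\<^esub> \<in> char_ker ?Q \<phi>'" by (simp only: Q.ker_iff Q.one_center simp_thms)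
    ultimately show ?thesis by blast
  qed
  ultimately show ?thesis
    using that [of ?Q \<phi>' \<pi>] irr \<pi>.group_hom_axioms surj ker \<phi>' card by (simp add: pgroup_char_def)
qed

section \<open>Uniqueness of the subgroup of order p\<close>

lemma root_of_unity_eq_power:
  fixes w v :: complex
  assumes p: "Factorial_Ring.prime (p :: nat)" and w: "w ^ p = 1" "w \<noteq> 1" and v: "v ^ p = 1"
  shows "\<exists>i. v = w ^ i"
proof -
  have w0: "w \<noteq> 0" using w prime_gt_0_nat [OF p] by (auto simp: power_0_left)
  have ne: "w ^ i \<noteq> w ^ j" if "i < j" "j < p" for i j
  proof
    assume "w ^ i = w ^ j"
    then have "w ^ i * w ^ (j - i) = w ^ i" using power_add [of w i "j - i"] that by simp
    then have "w ^ (j - i) = 1" using w0 by simp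
    then show False using root_of_unity_power_neq_1 [OF p w, of "j - i"] that by simp
  qed
  have "inj_on (\<lambda>i. w ^ i) {..<p}"
  proof (rule inj_onI)
    fix i j assume "i \<in> {..<p}" "j \<in> {..<p}" "w ^ i = w ^ j"
    then show "i = j" using ne [of i j] ne [of j i] by (cases i j rule: linorder_cases) auto
  qed
  then have "card ((\<lambda>i. w ^ i) ` {..<p}) = p" by (simp add: card_image)
  moreover have "card {v :: complex. v ^ p = 1} = p"
    using card_nth_roots [of 1 p] prime_gt_0_nat [OF p] by simp
  moreover have "(\<lambda>i. w ^ i) ` {..<p} \<subseteq> {v. v ^ p = 1}"
    using w by (auto simp flip: power_mult) (simp add: mult.commute [of _ p] power_mult)
  moreover have "finite {v :: complex. v ^ p = 1}"
    using finite_nth_roots [of p 1] prime_gt_0_nat [OF p] by simp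
  ultimately have "(\<lambda>i. w ^ i) ` {..<p} = {v. v ^ p = 1}" by (intro card_seteq) auto
  then show ?thesis using v by blast
qed

text \<open>A cyclic p-group has just one subgroup of order p. If ord x = p^(n+1), both exponents
  are multiples of p^n, and the cofactor of \<open>a\<close> is invertible modulo p.\<close>

lemma (in pgroup) order_p_in_cyclic:
  assumes x: "x \<in> carrier G"
    and u: "(x [^] (a::nat)) [^] p = \<one>" "x [^] a \<noteq> \<one>" and v: "(x [^] (b::nat)) [^] p = \<one>"
  shows "\<exists>c::nat. x [^] b = (x [^] a) [^] c"
proof -
  obtain m where m: "ord x = p ^ m" using ord_eq_power [OF x] by blast
  have "m \<noteq> 0"
    using u m x pow_eq_id [OF x, of a] by (cases m) auto
  then obtain n where n: "m = Suc n" by (cases m) auto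
  have "p ^ Suc n dvd a * p" "p ^ Suc n dvd b * p"
    using u v x m n by (simp_all add: nat_pow_pow pow_eq_id)
  then have "p ^ n dvd a" "p ^ n dvd b" using p_gt_1 by (simp_all add: mult.commute [of _ p])
  then obtain k l where k: "a = p ^ n * k" and l: "b = p ^ n * l" by (auto elim!: dvdE)
  have "\<not> p dvd k"
  proof
    assume "p dvd k"
    then have "ord x dvd a" using k m n by (simp add: mult.commute mult_dvd_mono)
    then show False using u x by (simp add: pow_eq_id)
  qed
  then have "coprime k p" using prime_imp_coprime [OF prime, of k] by (simp add: coprime_commute)
  moreover have "k \<noteq> 0" using \<open>\<not> p dvd k\<close> by (metis dvd_0_right)
  ultimately obtain r s where rs: "k * r = p * s + 1" using bezout_nat [of k p] by auto
  have "a * (r * l) = p ^ m * (s * l) + b"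
  proof -
    have "a * (r * l) = p ^ n * (k * r) * l" by (simp add: k mult_ac)
    also have "\<dots> = p ^ m * (s * l) + b" unfolding rs by (simp add: n l algebra_simps)
    finally show ?thesis .
  qed
  then have "(x [^] a) [^] (r * l) = (x [^] (p ^ m)) [^] (s * l) \<otimes> x [^] b"
    using x by (simp add: nat_pow_pow nat_pow_mult)
  also have "x [^] (p ^ m) = \<one>" using m x by (metis pow_ord_eq_1)
  finally show ?thesis using x by (metis l_one nat_pow_closed nat_pow_one)
qed

locale faithful_pgroup_char = pgroup_char +
  assumes ker_trivial: "char_ker G \<phi> = {\<one>}"
begin

lemma center_eq: "Z = center_mod {\<one>}"
  using center_eq_center_mod ker_trivial by simp

lemma center_comm: "z \<in> Z \<Longrightarrow> g \<in> carrier G \<Longrightarrow> g \<otimes> z = z \<otimes> g"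
  using center_commute center_eq by simp

lemma lam_inj:
  assumes "a \<in> Z" "b \<in> Z" "lam a = lam b" shows "a = b"
proof -
  have "a \<otimes> inv b \<in> K"
    using assms lam_nonzero [of b] by (simp add: ker_iff center_m_closed center_inv)
  then have "a \<otimes> inv b = \<one>" using ker_trivial by simp
  then have "(a \<otimes> inv b) \<otimes> b = b" using assms by simp
  then show ?thesis using assms by (simp add: m_assoc)
qed

text \<open>\<open>lam\<close> embeds \<open>Z\<close> in the multiplicative group of the complex
  numbers, where the p-th roots of unity are the powers of any nontrivial one.\<close>

lemma center_order_p_power:
  assumes "z \<in> Z" "z [^] p = \<one>" "z \<noteq> \<one>" "z' \<in> Z" "z' [^] p = \<one>"
  shows "\<exists>i::nat. z' = z [^] i"
proof -
  have "lam z ^ p = 1" "lam z' ^ p = 1" using assms center_pow by (metis one_center(2))+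
  moreover have "lam z \<noteq> 1" using lam_inj [of z \<one>] assms by auto
  ultimately obtain i where "lam z' = lam z ^ i" using root_of_unity_eq_power [OF prime] by blast
  then have "z' = z [^] i" using assms center_pow by (intro lam_inj) auto
  then show ?thesis ..
qed

lemma few_central_order_p: "card {z \<in> center_mod {\<one>}. z [^] p = \<one>} \<le> p"
proof -
  have "card {z \<in> center_mod {\<one>}. z [^] p = \<one>} \<le> card {w :: complex. w ^ p = 1}"
  proof (rule card_inj_on_le)
    show "inj_on lam {z \<in> center_mod {\<one>}. z [^] p = \<one>}"
      by (rule inj_onI) (use lam_inj center_eq in auto)
    show "lam ` {z \<in> center_mod {\<one>}. z [^] p = \<one>} \<subseteq> {w. w ^ p = 1}"
      using center_pow center_eq by (auto simp flip: center_pow(2))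
    show "finite {w :: complex. w ^ p = 1}"
      using finite_nth_roots [of p 1] p_gt_1 by simp
  qed
  also have "\<dots> = p" using card_nth_roots [of 1 p] p_gt_1 by simp
  finally show ?thesis .
qed

lemma obtain_central_order_p:
  assumes "carrier G \<noteq> {\<one>}"
  obtains z where "z \<in> Z" "z [^] p = \<one>" "z \<noteq> \<one>"
proof -
  have 1: "carrier G \<lhd> G" by (simp add: normal_inv_iff subgroup_self)
  have 2: "{\<one>} \<subset> carrier G" using assms by auto
  obtain z where "z \<notin> {\<one>}" "z \<in> center_mod {\<one>}" "z [^] p \<in> {\<one>}"
    by (rule exists_central_mod_prime [OF one_is_normal 1 2])
  then show ?thesis by (intro that [of z]) (simp_all add: center_eq)
qed

lemma obtain_noncentral_order_p:
  assumes "odd p" "Z \<noteq> carrier G"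
  obtains e where "e \<in> carrier G" "e \<in> center_mod Z" "e \<notin> Z" "e [^] p = \<one>"
proof -
  have "center_mod {\<one>} \<noteq> carrier G" using assms(2) by (simp add: center_eq)
  then obtain e where "e \<in> carrier G" "e \<in> center_mod (center_mod {\<one>})" "e \<notin> center_mod {\<one>}" "e [^] p = \<one>"
    by (rule exists_noncentral_order_p [OF assms(1) _ few_central_order_p])
  then show ?thesis by (intro that [of e]) (simp_all add: center_eq)
qed

lemma clifford_if_center_mod:
  assumes "y \<in> center_mod Z" "y \<notin> Z" "y [^] p \<in> Z"
  shows "clifford G \<phi> p y"
  using assms by (simp add: center_mod_def clifford_def clifford_axioms_def irr_char_axioms prime)

lemma clifford_commute:
  assumes "clifford G \<phi> p y" "m \<in> clifford.M G \<phi> y"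
  shows "m \<otimes> y = y \<otimes> m"
proof -
  interpret C: clifford G \<phi> p y by fact
  have m: "m \<in> carrier G" "lam (commutator m y) = 1"
    using assms(2) unfolding C.M_def C.c_def by auto
  then have "commutator m y \<in> K" using C.comm_y by (simp add: ker_iff)
  then have "commutator m y = \<one>" using ker_trivial by simp
  then have "commutator m y \<otimes> (y \<otimes> m) = y \<otimes> m" using m C.y by simp
  then show ?thesis using m C.y by (simp add: commutator_def m_assoc)
qed

text \<open>\<open>H\<close> is <x>Z(M) for the group \<open>M\<close> attached to \<open>y\<close>.
  The key bound, applied to a constituent on \<open>M\<close> that is nonzero at \<open>x\<close>,
  gives p^2 and the index of \<open>M\<close> the third p. Degree p is excluded, as the constituent
  would be linear. By faithfulness \<open>M\<close> centralizes \<open>y\<close>, which places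
  \<open>y\<close> in \<open>H\<close>.\<close>

lemma obtain_cyclic_center_bound:
  assumes odd: "odd p" and deg: "(\<phi> \<one>)\<^sup>2 \<noteq> of_nat (p ^ 2)"
    and y: "y \<in> center_mod Z" "y \<notin> Z" "y [^] p \<in> Z"
    and x: "x \<in> carrier G" "\<phi> x \<noteq> 0"
  obtains H where "subgroup H G" "x \<in> H" "y \<in> H" "Z \<subseteq> H" "p ^ 3 * card H \<le> card (carrier G)"
proof -
  have cl: "clifford G \<phi> p y" by (rule clifford_if_center_mod [OF y])
  then interpret C: clifford G \<phi> p y .
  obtain t where t: "t ^ p = lam (y [^] p)" "C.psi t x \<noteq> 0" by (rule C.obtain_constituent [OF x])
  interpret psi: pgroup_char "G\<lparr>carrier := C.M\<rparr>" "C.psi t" p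
    by (rule C.pgroup_char_psi [OF pgroup_axioms t(1)])
  have xM: "x \<in> C.M" using C.vanishes_off_M x by blast
  have "(C.psi t \<one>)\<^sup>2 \<noteq> 1"
    using deg p_gt_1 by (auto simp: C.psi_one field_simps)
  then have nz: "psi.Z \<noteq> carrier (G\<lparr>carrier := C.M\<rparr>)" using psi.deg_sq_if_center_all by auto
  define H where "H = psi.cyclic_center x"
  have bound: "card H * p ^ 2 \<le> card C.M"
    using psi.card_cyclic_center_le [OF odd nz] xM t by (simp add: H_def)
  have "subgroup H (G\<lparr>carrier := C.M\<rparr>)"
    unfolding H_def by (rule psi.subgroup_cyclic_center) (use psi.fin xM in auto)
  then have "subgroup H G" by (rule incl_subgroup [OF C.subgroup_M])
  moreover have "x \<in> H" unfolding H_def using psi.mem_cyclic_center(1) xM by simp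
  moreover have "y \<in> H"
  proof -
    have "y \<in> psi.center_mod {\<one>}"
      using psi.group_centerI [of y] C.y_in_M clifford_commute [OF cl] by simp
    then show ?thesis unfolding H_def using psi.mem_cyclic_center(2) [of x y] xM by simp
  qed
  moreover have "Z \<subseteq> H"
  proof
    fix z assume z: "z \<in> Z"
    then have "z \<in> C.M" using C.center_subset_M by blast
    moreover have "g \<otimes> z = z \<otimes> g" if "g \<in> C.M" for g using center_comm [OF z C.M_closed [OF that]] .
    ultimately have "z \<in> psi.center_mod {\<one>}" using psi.group_centerI [of z] by simp
    then show "z \<in> H" unfolding H_def using psi.mem_cyclic_center(2) [of x z] xM by simp
  qed
  moreover have "p ^ 3 * card H \<le> card (carrier G)"
    using bound C.index_M by (simp add: power3_eq_cube power2_eq_square mult_ac)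
  ultimately show ?thesis using that by blast
qed

lemma generate_singleton: "x \<in> carrier G \<Longrightarrow> generate G {x} = range (\<lambda>i::nat. x [^] i)"
  using generate_pow_on_finite_carrier [OF fin] by auto

lemma ord_less_card_subgroup:
  assumes "x \<in> carrier G" "subgroup H G" "x \<in> H" "h \<in> H" "\<And>i::nat. h \<noteq> x [^] i"
  shows "p * ord x \<le> card H"
proof -
  have "subgroup (generate G {x}) G" using assms by (intro generate_is_subgroup) auto
  moreover have "generate G {x} \<subset> H"
    using assms pow_mem_subgroup [OF assms(2,3)] by (auto simp: generate_singleton)
  ultimately show ?thesis
    using card_proper_subgroup [OF _ assms(2)] generate_pow_card [OF assms(1)] by simp
qed

lemma center_neq_carrier:
  assumes "(\<phi> \<one>)\<^sup>2 = of_nat (p ^ k)" "k > 0"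
  shows "Z \<noteq> carrier G"
proof
  assume "Z = carrier G"
  then have "of_nat (p ^ k) = (1 :: complex)" using assms(1) deg_sq_if_center_all by simp
  then have "p ^ k = 1" by (metis of_nat_1 of_nat_eq_iff)
  then show False using p_gt_1 assms(2) by simp
qed

lemma ord_bound_degree_p2:
  assumes odd: "odd p" and deg: "(\<phi> \<one>)\<^sup>2 = of_nat (p ^ 4)" and x: "x \<in> carrier G" "\<phi> x \<noteq> 0"
  shows "ord x * p ^ 4 \<le> card (carrier G)"
proof -
  have nz: "Z \<noteq> carrier G" using center_neq_carrier [OF deg] by simp
  obtain e where e: "e \<in> carrier G" "e \<in> center_mod Z" "e \<notin> Z" "e [^] p = \<one>"
    by (rule obtain_noncentral_order_p [OF odd nz])
  have "e \<noteq> \<one>" using e by auto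
  then obtain z where z: "z \<in> Z" "z [^] p = \<one>" "z \<noteq> \<one>" using obtain_central_order_p e(1) by blast
  have "p ^ 4 \<noteq> p ^ 2" using p_gt_1 by simp
  then have "(\<phi> \<one>)\<^sup>2 \<noteq> of_nat (p ^ 2)" unfolding deg by (metis of_nat_eq_iff)
  then obtain H where H: "subgroup H G" "x \<in> H" "e \<in> H" "Z \<subseteq> H" "p ^ 3 * card H \<le> card (carrier G)"
    using obtain_cyclic_center_bound [OF odd _ e(2,3) _ x] e(4) one_center(1) by metis
  have "p * ord x \<le> card H"
  proof (cases "\<exists>a::nat. e = x [^] a")
    case False
    then show ?thesis using ord_less_card_subgroup [OF x(1) H(1-3)] by blast
  next
    case True
    then obtain a where a: "e = x [^] (a::nat)" by blast
    \<comment> \<open>Otherwise \<open>e\<close> and \<open>z\<close> would generate the same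
      subgroup of order p, making \<open>e\<close> central. So \<open>z\<close> witnesses that <x>
      is a proper subgroup of \<open>H\<close>, which yields the fourth p.\<close>
    have "z \<noteq> x [^] b" for b :: nat
    proof
      assume b: "z = x [^] b"
      then obtain c where "x [^] a = (x [^] b) [^] (c::nat)"
        using order_p_in_cyclic [OF x(1), of b a] z e a by auto
      then have "e \<in> Z" using center_pow(1) [OF z(1)] a b by simp
      then show False using e by simp
    qed
    then show ?thesis using ord_less_card_subgroup [OF x(1) H(1,2), of z] H(4) z(1) by blast
  qed
  then have "p ^ 3 * (p * ord x) \<le> p ^ 3 * card H" by simp
  then have "p ^ 3 * (p * ord x) \<le> card (carrier G)" using H(5) by linarith
  then show ?thesis by (simp add: power_numeral_reduce mult_ac)
qed

end

context faithful_pgroup_char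
begin

text \<open>A squeeze around \<open>U\<close> = <x>Z: a central element of order p is not a power of
  \<open>x\<close>, so |U| >= p ord x, while every group \<open>H\<close> obtained above has at most
  p ord x elements. Hence \<open>H = U\<close> contains each eligible \<open>y\<close>, and
  \<open>U\<close> is the direct product of <x> with \<open>Z\<close> of order p. Writing y = x^i
  z', the power y^p lies in both <x> and \<open>Z\<close>, so is trivial. The element
  \<open>e\<close> of order p splits likewise, and its <x>-part proves the last claim.\<close>

lemma degree_p2_tight:
  assumes odd: "odd p" and deg: "(\<phi> \<one>)\<^sup>2 = of_nat (p ^ 4)" and x: "x \<in> carrier G" "\<phi> x \<noteq> 0"
    and tight: "card (carrier G) \<le> ord x * p ^ 4"
    and triv: "\<And>j::nat. x [^] j \<in> Z \<Longrightarrow> x [^] j = \<one>"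
  shows "z \<in> Z \<Longrightarrow> z [^] p = \<one>"
    and "y \<in> center_mod Z \<Longrightarrow> y [^] p \<in> Z \<Longrightarrow> y [^] p = \<one>"
    and "\<exists>i::nat. x [^] i \<in> center_mod Z \<and> x [^] i \<noteq> \<one> \<and> (x [^] i) [^] p = \<one>"
proof -
  interpret Z: subgroup Z G by (rule normal_imp_subgroup [OF normal_center])
  interpret CZ: subgroup "center_mod Z" G by (rule subgroup_center_mod [OF normal_center])
  have nz: "Z \<noteq> carrier G" using center_neq_carrier [OF deg] by simp
  have "p ^ 4 \<noteq> p ^ 2" using p_gt_1 by simp
  then have deg': "(\<phi> \<one>)\<^sup>2 \<noteq> of_nat (p ^ 2)" unfolding deg by (metis of_nat_eq_iff)
  define U where "U = cyclic_center x"
  have subU: "subgroup U G" unfolding U_def by (rule subgroup_cyclic_center [OF fin x(1)])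
  have UE: "\<exists>(i::nat) z. u = x [^] i \<otimes> z \<and> z \<in> Z" if "u \<in> U" for u
    using that unfolding U_def cyclic_center_def center_eq by blast
  have xU: "x \<in> U" and ZU: "Z \<subseteq> U"
    using mem_cyclic_center [OF x(1)] by (auto simp: U_def center_eq)
  obtain e where e: "e \<in> carrier G" "e \<in> center_mod Z" "e \<notin> Z" "e [^] p = \<one>"
    by (rule obtain_noncentral_order_p [OF odd nz])
  have "e \<noteq> \<one>" using e by auto
  then have "carrier G \<noteq> {\<one>}" using e(1) by blast
  then obtain z where z: "z \<in> Z" "z [^] p = \<one>" "z \<noteq> \<one>" by (rule obtain_central_order_p)
  have ord_le: "p * ord x \<le> card U"
  proof (rule ord_less_card_subgroup [OF x(1) subU xU, of z])
    show "z \<in> U" using z ZU by blast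
    show "z \<noteq> x [^] i" for i :: nat using triv [of i] z by auto
  qed
  have inU: "y \<in> U" and cardU: "card U \<le> p * ord x"
    if y: "y \<in> center_mod Z" "y \<notin> Z" "y [^] p \<in> Z" for y
  proof -
    obtain H where H: "subgroup H G" "x \<in> H" "y \<in> H" "Z \<subseteq> H" "p ^ 3 * card H \<le> card (carrier G)"
      by (rule obtain_cyclic_center_bound [OF odd deg' y x])
    have "p ^ 3 * card H \<le> p ^ 3 * (p * ord x)"
    proof -
      have "p ^ 3 * (p * ord x) = ord x * p ^ 4" by (simp add: power_numeral_reduce mult_ac)
      then show ?thesis using H(5) tight by linarith
    qed
    then have cH: "card H \<le> p * ord x" using p_gt_1 by simp
    have UH: "U \<subseteq> H"
    proof
      fix u assume "u \<in> U"
      then obtain i z' where "u = x [^] (i::nat) \<otimes> z'" "z' \<in> Z" using UE by blast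
      then show "u \<in> H"
        using pow_mem_subgroup [OF H(1,2), of i] H(4) subgroup.m_closed [OF H(1)] by blast
    qed
    have "U = H"
      by (rule card_seteq) (use finite_subgroup [OF H(1)] UH cH ord_le in auto)
    then show "y \<in> U" "card U \<le> p * ord x" using H cH by auto
  qed
  have e': "e [^] p \<in> Z" using e(4) by simp
  note cU = cardU [OF e(2,3) e']
  have ord_pos: "ord x > 0" using ord_ge_1 [OF fin x(1)] by simp
  have cZ: "card Z \<le> p"
  proof -
    \<comment> \<open>Multiplication is injective here because <x> and \<open>Z\<close> meet
      trivially by \<open>triv\<close>. This turns |U| <= p ord x into |Z| <= p.\<close>
    have "card (generate G {x} \<times> Z) \<le> card U"
    proof (rule card_inj_on_le)
      have gen: "inv a \<otimes> b \<in> range (\<lambda>i::nat. x [^] i)" if "a \<in> generate G {x}" "b \<in> generate G {x}" for a b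
      proof -
        interpret X: subgroup "generate G {x}" G using x(1) by (intro generate_is_subgroup) auto
        have "inv a \<otimes> b \<in> generate G {x}" using that by blast
        then show ?thesis by (simp only: generate_singleton [OF x(1)])
      qed
      show "inj_on (\<lambda>(a, z). a \<otimes> z) (generate G {x} \<times> Z)"
      proof (rule inj_onI, clarify)
        fix a z a' z'
        assume a: "a \<in> generate G {x}" "a' \<in> generate G {x}" and z: "z \<in> Z" "z' \<in> Z" and eq: "a \<otimes> z = a' \<otimes> z'"
        have ac: "a \<in> carrier G" "a' \<in> carrier G"
          using a generate_incl [of "{x}"] x(1) by auto
        have "inv a \<otimes> a' = inv a \<otimes> (a' \<otimes> z') \<otimes> inv z'" using ac z by (simp add: m_assoc)
        also have "\<dots> = z \<otimes> inv z'" using ac z by (simp add: eq [symmetric])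
        finally have az: "inv a \<otimes> a' = z \<otimes> inv z'" .
        then have "inv a \<otimes> a' \<in> Z" using z by simp
        moreover obtain i where "inv a \<otimes> a' = x [^] (i::nat)" using gen [OF a] by blast
        ultimately have one: "inv a \<otimes> a' = \<one>" using triv by simp
        then have "a \<otimes> (inv a \<otimes> a') = a" using ac by simp
        moreover have "(z \<otimes> inv z') \<otimes> z' = z'" using one az z by simp
        ultimately show "a = a' \<and> z = z'" using ac z by (simp add: m_assoc)
      qed
      show "(\<lambda>(a, z). a \<otimes> z) ` (generate G {x} \<times> Z) \<subseteq> U"
        using pow_mem_subgroup [OF subU xU] ZU subgroup.m_closed [OF subU] by (auto simp: generate_singleton [OF x(1)])
      show "finite U" by (rule finite_subgroup [OF subU])
    qed
    then have "ord x * card Z \<le> card U"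
      by (simp only: card_cartesian_product generate_pow_card [OF x(1)])
    then have "ord x * card Z \<le> ord x * p" using cU mult.commute [of p "ord x"] by linarith
    then show ?thesis using ord_pos by simp
  qed
  show zp: "z \<in> Z \<Longrightarrow> z [^] p = \<one>" for z
  proof -
    assume z: "z \<in> Z"
    have zc: "z \<in> carrier G" using z by simp
    have "generate G {z} \<subseteq> Z" using z Z.subgroup_axioms generate_subgroup_incl [of "{z}" Z] by simp
    then have "ord z \<le> p"
      using generate_pow_card [OF zc] card_mono [of Z "generate G {z}"] finite_subgroup [OF Z.subgroup_axioms] cZ by simp
    moreover obtain k where k: "ord z = p ^ k" using ord_eq_power [OF zc] by blast
    ultimately have "p ^ k \<le> p ^ 1" by simp
    then have "k \<le> 1" using p_gt_1 power_le_imp_le_exp by blast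
    then have "ord z dvd p" using k by (cases k) auto
    then show "z [^] p = \<one>" using pow_eq_id [OF zc] by simp
  qed
  show "y \<in> center_mod Z \<Longrightarrow> y [^] p \<in> Z \<Longrightarrow> y [^] p = \<one>"
  proof (cases "y \<in> Z")
    case False
    assume y: "y \<in> center_mod Z" "y [^] p \<in> Z"
    obtain i z' where yz: "y = x [^] (i::nat) \<otimes> z'" "z' \<in> Z" using UE [OF inU [OF y(1) False y(2)]] by blast
    have "y [^] p = (x [^] i) [^] p \<otimes> z' [^] p"
      unfolding yz(1) by (rule pow_mult_distrib) (use x yz center_comm in auto)
    then have "y [^] p = x [^] (i * p)" using zp [OF yz(2)] x by (simp add: nat_pow_pow)
    then show ?thesis using triv y(2) by simp
  qed (rule zp)
  show "\<exists>i::nat. x [^] i \<in> center_mod Z \<and> x [^] i \<noteq> \<one> \<and> (x [^] i) [^] p = \<one>"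
  proof -
    obtain i z' where ez: "e = x [^] (i::nat) \<otimes> z'" "z' \<in> Z" using UE [OF inU [OF e(2,3) e']] by blast
    have xi: "x [^] i = e \<otimes> inv z'" using ez x by (simp add: m_assoc)
    have z'C: "inv z' \<in> center_mod Z" using ez(2) subset_center_mod [OF normal_center] by blast
    have "x [^] i \<in> center_mod Z" unfolding xi using e(2) z'C by blast
    moreover have "x [^] i \<noteq> \<one>"
    proof
      assume "x [^] i = \<one>"
      then show False using ez e(3) by simp
    qed
    moreover have "(x [^] i) [^] p = \<one>"
    proof -
      have "(e \<otimes> inv z') [^] p = e [^] p \<otimes> inv z' [^] p"
        by (rule pow_mult_distrib) (use e(1) ez(2) center_comm [of "inv z'" e] in auto)
      then show ?thesis unfolding xi using e(4) zp [OF ez(2)] ez(2) by (simp add: nat_pow_inv)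
    qed
    ultimately show ?thesis by blast
  qed
qed

lemma ord_bound_degree_p3:
  assumes odd: "odd p" and deg: "(\<phi> \<one>)\<^sup>2 = of_nat (p ^ 6)" and x: "x \<in> carrier G" "\<phi> x \<noteq> 0"
  shows "ord x * p ^ 6 \<le> card (carrier G)"
proof (rule ccontr)
  assume contra: "\<not> ord x * p ^ 6 \<le> card (carrier G)"
  interpret ZG: subgroup Z G by (rule normal_imp_subgroup [OF normal_center])
  interpret CZ: subgroup "center_mod Z" G by (rule subgroup_center_mod [OF normal_center])
  obtain m where m: "ord x = p ^ m" using ord_eq_power [OF x(1)] by blast
  \<comment> \<open>Both sides of the assumed violation are powers of p, so a strict inequality
    gains a full factor p.\<close>
  have small: "card (carrier G) \<le> p ^ (m + 5)"
  proof -
    obtain n where n: "card (carrier G) = p ^ n" using card_eq by blast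
    have "p ^ n < p ^ (m + 6)" using contra m n by (simp add: power_add)
    then have "n < m + 6" using p_gt_1 power_less_imp_less_exp by blast
    then show ?thesis unfolding n using p_gt_1 by (intro power_increasing) auto
  qed
  have nz: "Z \<noteq> carrier G" using center_neq_carrier [OF deg] by simp
  obtain e0 where e0: "e0 \<in> carrier G" "e0 \<in> center_mod Z" "e0 \<notin> Z" "e0 [^] p = \<one>"
    by (rule obtain_noncentral_order_p [OF odd nz])
  have "e0 \<noteq> \<one>" using e0 by auto
  then have "carrier G \<noteq> {\<one>}" using e0(1) by blast
  then obtain z where z: "z \<in> Z" "z [^] p = \<one>" "z \<noteq> \<one>" by (rule obtain_central_order_p)
  have zc: "z \<in> carrier G" using z by simp
  have cl: "clifford G \<phi> p e0" by (rule clifford_if_center_mod) (use e0 in auto)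
  interpret C: clifford G \<phi> p e0 by (rule cl)
  interpret M: subgroup C.M G by (rule C.subgroup_M)
  obtain t where t: "t ^ p = lam (e0 [^] p)" "C.psi t x \<noteq> 0" by (rule C.obtain_constituent [OF x])
  have tp: "t ^ p = 1" using t(1) e0(4) by simp
  have t0: "t \<noteq> 0" by (rule C.t_nonzero [OF t(1)])
  note M_pow_mem = pow_mem_subgroup [OF C.subgroup_M]
  let ?M = "G\<lparr>carrier := C.M\<rparr>"
  interpret psi: pgroup_char ?M "C.psi t" p by (rule C.pgroup_char_psi [OF pgroup_axioms t(1)])
  have xM: "x \<in> C.M" using C.vanishes_off_M x by blast
  have ZM: "Z \<subseteq> C.M" by (rule C.center_subset_M)
  define K0 where "K0 = psi.K"
  have lamz: "lam z ^ p = 1" "lam z \<noteq> 1"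
    using center_pow(2) [OF z(1), of p] z(2) lam_inj [of z \<one>] z by auto
  have psi_lam: "a \<in> K0 \<longleftrightarrow> lam a = 1" if a: "a \<in> Z" for a
  proof -
    have aM: "a \<in> C.M" using a ZM by blast
    have *: "C.psi t (u \<otimes> a) = lam a * C.psi t u" if "u \<in> C.M" for u
      using C.psi_mult_center [OF t(1) M.mem_carrier [OF that] a] .
    show ?thesis
    proof
      assume "lam a = 1"
      then show "a \<in> K0" unfolding K0_def char_ker_def using * aM by simp
    next
      assume "a \<in> K0"
      then have "\<forall>u\<in>C.M. C.psi t (u \<otimes> a) = C.psi t u" unfolding K0_def char_ker_def by simp
      then have "C.psi t (\<one> \<otimes> a) = C.psi t \<one>" using M.one_closed by blast
      then show "lam a = 1" using * [OF M.one_closed] psi.deg_nonzero by simp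
    qed
  qed
  \<comment> \<open>In the chosen constituent \<open>e0\<close> acts as the p-th root of unity
    \<open>t\<close>. A power of the central element \<open>z\<close> acts as its inverse, so the
    product \<open>e\<close> lands in the kernel and keeps order p outside \<open>Z\<close>.\<close>
  obtain k where k: "inverse t = lam z ^ k"
    using root_of_unity_eq_power [OF prime lamz, of "inverse t"] tp by (auto simp: power_inverse)
  define e where "e = e0 \<otimes> z [^] k"
  have zk: "z [^] k \<in> Z" by (rule center_pow(1) [OF z(1)])
  have ec: "e \<in> carrier G" using e0(1) zc by (simp add: e_def)
  have e_mod: "e \<in> center_mod Z"
    unfolding e_def using e0(2) subset_center_mod [OF normal_center] zk by blast
  have eZ: "e \<notin> Z"
  proof
    assume "e \<in> Z"
    then have "e \<otimes> inv (z [^] k) \<in> Z" using zk by blast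
    then show False using e0(1,3) zc by (simp add: e_def m_assoc)
  qed
  have ep: "e [^] p = \<one>"
  proof -
    have "e [^] p = e0 [^] p \<otimes> (z [^] k) [^] p"
      unfolding e_def by (rule pow_mult_distrib) (use e0(1) zc center_comm [OF zk e0(1)] in auto)
    also have "(z [^] k) [^] p = (z [^] p) [^] k" using zc by (simp add: nat_pow_pow mult.commute)
    finally show ?thesis using e0(4) z(2) by simp
  qed
  have eM: "e \<in> C.M" unfolding e_def using C.y_in_M zk ZM by blast
  have eK0: "e \<in> K0"
  proof -
    have "C.psi t (u \<otimes> e) = C.psi t u" if "u \<in> C.M" for u
    proof -
      have uc: "u \<in> carrier G" using that by simp
      have "C.psi t (u \<otimes> e) = C.psi t (u \<otimes> e0 \<otimes> z [^] k)" using uc e0(1) zc by (simp add: e_def m_assoc)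
      also have "\<dots> = lam (z [^] k) * (t * C.psi t u)"
        using C.psi_mult_center [OF t(1) _ zk, of "u \<otimes> e0"] C.psi_mult_y [OF t(1) uc] uc e0(1) by simp
      also have "lam (z [^] k) = inverse t" using center_pow(2) [OF z(1)] k by simp
      finally show ?thesis using t0 by simp
    qed
    then show ?thesis unfolding K0_def char_ker_def using eM by simp
  qed
  obtain Q :: "'a set monoid" and \<pi> \<phi>' where
    Q: "pgroup_char Q \<phi>' p" and hom: "group_hom ?M Q \<pi>" and surj: "\<pi> ` carrier ?M = carrier Q"
    and \<pi>_one: "\<And>g. g \<in> carrier ?M \<Longrightarrow> \<pi> g = \<one>\<^bsub>Q\<^esub> \<longleftrightarrow> g \<in> psi.K"
    and \<phi>': "\<And>g. g \<in> carrier ?M \<Longrightarrow> \<phi>' (\<pi> g) = C.psi t g"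
    and kerQ: "char_ker Q \<phi>' = {\<one>\<^bsub>Q\<^esub>}" and cardQ: "card (carrier Q) * card psi.K = card (carrier ?M)"
    by (rule psi.obtain_faithful_quotient) blast
  interpret Q: faithful_pgroup_char Q \<phi>' p
    using Q kerQ by (simp add: faithful_pgroup_char_def faithful_pgroup_char_axioms_def)
  interpret \<pi>: group_hom ?M Q \<pi> by (rule hom)
  have M_pow: "a [^]\<^bsub>?M\<^esub> (n::nat) = a [^] n" for a n
    by (rule nat_pow_consistent [symmetric])
  have \<pi>_pow: "\<pi> (a [^] (n::nat)) = \<pi> a [^]\<^bsub>Q\<^esub> n" if "a \<in> C.M" for a n
    using \<pi>.hom_nat_pow [of a n] that by (simp add: M_pow)
  have \<pi>_mult: "\<pi> (a \<otimes> b) = \<pi> a \<otimes>\<^bsub>Q\<^esub> \<pi> b" if "a \<in> C.M" "b \<in> C.M" for a b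
    using \<pi>.hom_mult [of a b] that by simp
  have \<pi>_inv: "\<pi> (inv a) = inv\<^bsub>Q\<^esub> \<pi> a" if "a \<in> C.M" for a
    using \<pi>.hom_inv [of a] that m_inv_consistent [OF C.subgroup_M that] by simp
  have \<pi>_c: "\<pi> a \<in> carrier Q" if "a \<in> C.M" for a using \<pi>.hom_closed [of a] that by simp
  have \<pi>1: "\<pi> a = \<one>\<^bsub>Q\<^esub> \<longleftrightarrow> a \<in> K0" if "a \<in> C.M" for a
    using \<pi>_one [of a] that by (simp add: K0_def)
  have \<pi>_comm: "\<pi> (commutator a b) = Q.commutator (\<pi> a) (\<pi> b)" if "a \<in> C.M" "b \<in> C.M" for a b
    using that by (simp add: commutator_def Q.commutator_def \<pi>_mult \<pi>_inv)
  have \<pi>_Z: "\<pi> a \<in> Q.Z" if a: "a \<in> Z" for a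
  proof -
    have aM: "a \<in> C.M" using a ZM by blast
    have "q \<otimes>\<^bsub>Q\<^esub> \<pi> a = \<pi> a \<otimes>\<^bsub>Q\<^esub> q" if q: "q \<in> carrier Q" for q
    proof -
      obtain b where b: "b \<in> C.M" "q = \<pi> b" using q surj by auto
      show ?thesis using center_comm [OF a, of b] \<pi>_mult [OF b(1) aM] \<pi>_mult [OF aM b(1)] b by simp
    qed
    then show ?thesis unfolding Q.center_eq using \<pi>_c [OF aM] by (rule Q.group_centerI [rotated])
  qed
  have zM: "z \<in> C.M" using z(1) ZM by blast
  have zK0: "z \<notin> K0" using psi_lam [OF z(1)] lamz by simp
  have degQ: "(\<phi>' \<one>\<^bsub>Q\<^esub>)\<^sup>2 = of_nat (p ^ 4)"
  proof -
    have "\<phi>' \<one>\<^bsub>Q\<^esub> = \<phi> \<one> / of_nat p"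
      using \<phi>' [of \<one>] \<pi>.hom_one C.psi_one by simp
    then have "(\<phi>' \<one>\<^bsub>Q\<^esub>)\<^sup>2 = of_nat (p ^ 6) / (of_nat p)\<^sup>2" by (simp only: power_divide deg)
    also have "of_nat (p ^ 6) = (of_nat p)\<^sup>2 * (of_nat (p ^ 4) :: complex)" by (simp flip: power_add)
    also have "\<dots> / (of_nat p)\<^sup>2 = of_nat (p ^ 4)"
      by (rule nonzero_mult_div_cancel_left) (use p_gt_1 in simp)
    finally show ?thesis .
  qed
  define xb where "xb = \<pi> x"
  have xb: "xb \<in> carrier Q" "\<phi>' xb \<noteq> 0" using \<pi>_c [OF xM] \<phi>' [of x] xM t(2) by (auto simp: xb_def)
  obtain \<mu> where \<mu>: "Q.ord xb = p ^ \<mu>" using Q.ord_eq_power [OF xb(1)] by blast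
  have xb_pow: "xb [^]\<^bsub>Q\<^esub> (n::nat) = \<one>\<^bsub>Q\<^esub> \<longleftrightarrow> x [^] n \<in> K0" for n
    using \<pi>_pow [OF xM, of n] \<pi>1 [of "x [^] n"] M_pow_mem [OF xM] by (simp add: xb_def)
  have x\<mu>K0: "x [^] (p ^ \<mu>) \<in> K0" using xb_pow \<mu> Q.pow_ord_eq_1 [OF xb(1)] by simp
  have subK0: "subgroup K0 G"
    using incl_subgroup [OF C.subgroup_M] normal_imp_subgroup [OF psi.normal_ker] by (simp add: K0_def)
  interpret K0: subgroup K0 G by (rule subK0)
  have boundQ: "p ^ \<mu> * p ^ 4 \<le> card (carrier Q)"
    using Q.ord_bound_degree_p2 [OF odd degQ xb] \<mu> by simp
  have cardM: "card (carrier Q) * card K0 \<le> p ^ m * p ^ 4"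
  proof -
    have "p * (card (carrier Q) * card K0) \<le> p * p ^ (m + 4)"
    proof -
      have "p ^ (m + 5) = p * p ^ (m + 4)" using power_Suc [of p "m + 4"] by (simp only: add_Suc_right [symmetric]) simp
      moreover have "p * (card (carrier Q) * card K0) = card (carrier G)"
        using cardQ C.index_M by (simp add: K0_def)
      ultimately show ?thesis using small by linarith
    qed
    then show ?thesis using p_gt_1 by (simp add: power_add)
  qed
  have "x [^] (p ^ m) = \<one>" using m x by (metis pow_ord_eq_1)
  then have "x [^] (p ^ m) \<in> K0" by simp
  then have "Q.ord xb dvd p ^ m" using xb_pow [of "p ^ m"] Q.pow_eq_id [OF xb(1)] by simp
  then have \<mu>m: "\<mu> \<le> m" using \<mu> p_gt_1 by (metis power_dvd_imp_le)
  have mm: "p ^ m = p ^ \<mu> * p ^ (m - \<mu>)" using \<mu>m by (simp flip: power_add)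
  define c where "c = x [^] (p ^ \<mu>)"
  have cc: "c \<in> carrier G" using x by (simp add: c_def)
  have ordc: "ord c = p ^ (m - \<mu>)"
  proof -
    have "ord c = p ^ m div gcd (p ^ m) (p ^ \<mu>)"
      using ord_pow_gen [OF x(1), of "p ^ \<mu>"] m p_gt_1 by (simp add: c_def)
    also have "gcd (p ^ m) (p ^ \<mu>) = p ^ \<mu>" using \<mu>m by (simp add: le_imp_power_dvd gcd_nat.absorb2)
    finally show ?thesis using \<mu>m p_gt_1 by (simp add: power_diff)
  qed
  have cgenK0: "generate G {c} \<subseteq> K0"
    using generate_subgroup_incl [of "{c}" K0] subK0 x\<mu>K0 by (simp add: c_def)
  \<comment> \<open>The degree p^2 bound for \<open>Q\<close> and the assumed smallness of
    \<open>G\<close> leave at most p^(m - \<mu>) elements for \<open>K0\<close>, which is already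
    the order of its element \<open>c\<close>.\<close>
  have K0c: "K0 = generate G {c}"
  proof (rule sym, rule card_seteq)
    show "finite K0" by (rule finite_subgroup [OF subK0])
    have "p ^ \<mu> * p ^ 4 * card K0 \<le> card (carrier Q) * card K0"
      by (rule mult_right_mono [OF boundQ]) simp
    also have "\<dots> \<le> p ^ m * p ^ 4" by (rule cardM)
    also have "\<dots> = p ^ \<mu> * p ^ 4 * p ^ (m - \<mu>)" by (simp only: mm mult_ac)
    finally show "card K0 \<le> card (generate G {c})"
      using p_gt_1 generate_pow_card [OF cc] ordc by simp
  qed (rule cgenK0)
  have K0E: "\<exists>s::nat. a = x [^] (p ^ \<mu> * s)" if "a \<in> K0" for a
    using that generate_singleton [OF cc] x by (auto simp: K0c c_def nat_pow_pow)
  have tightQ: "card (carrier Q) \<le> Q.ord xb * p ^ 4"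
  proof -
    have "card K0 = p ^ (m - \<mu>)" using K0c ordc generate_pow_card [OF cc] by simp
    then have "card (carrier Q) * p ^ (m - \<mu>) \<le> p ^ \<mu> * p ^ 4 * p ^ (m - \<mu>)"
      using cardM by (simp only: mm mult_ac)
    then show ?thesis using \<mu> p_gt_1 by simp
  qed
  have z_not_pow: "z \<noteq> x [^] b" for b :: nat
  proof
    assume b: "z = x [^] b"
    obtain a where a: "e = x [^] (a::nat)" using K0E [OF eK0] by blast
    obtain d where "x [^] a = (x [^] b) [^] (d::nat)"
      using order_p_in_cyclic [OF x(1), of b a] z ep a b by auto
    then show False using center_pow(1) [OF z(1), of d] a b eZ by simp
  qed
  \<comment> \<open>A nontrivial central power of \<open>xb\<close> has a power generating the only
    central subgroup of order p of \<open>Q\<close>, which contains the image of \<open>z\<close>.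
    Pulling back along the kernel \<open>K0\<close>, itself inside <x>, would make \<open>z\<close>
    a power of \<open>x\<close>.\<close>
  have trivQ: "xb [^]\<^bsub>Q\<^esub> j = \<one>\<^bsub>Q\<^esub>" if j: "xb [^]\<^bsub>Q\<^esub> (j::nat) \<in> Q.Z" for j
  proof (rule ccontr)
    assume ne: "xb [^]\<^bsub>Q\<^esub> j \<noteq> \<one>\<^bsub>Q\<^esub>"
    define v where "v = xb [^]\<^bsub>Q\<^esub> j"
    have v: "v \<in> carrier Q" "v \<in> Q.Z" using xb(1) j by (simp_all add: v_def)
    obtain r where r: "Q.ord v = p ^ r" using Q.ord_eq_power [OF v(1)] by blast
    have "r \<noteq> 0"
    proof
      assume "r = 0"
      then have "Q.ord v = 1" using r by simp
      then show False using Q.ord_eq_1 [OF v(1)] ne by (simp add: v_def)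
    qed
    then obtain r' where r': "r = Suc r'" by (cases r) auto
    define v' where "v' = v [^]\<^bsub>Q\<^esub> (p ^ r')"
    have "v' \<in> Q.Z" unfolding v'_def by (rule Q.center_pow(1) [OF v(2)])
    moreover have "v' [^]\<^bsub>Q\<^esub> p = \<one>\<^bsub>Q\<^esub>"
      using r r' v(1) Q.pow_ord_eq_1 [OF v(1)] by (simp add: v'_def Q.nat_pow_pow mult.commute)
    moreover have "v' \<noteq> \<one>\<^bsub>Q\<^esub>"
    proof
      assume "v' = \<one>\<^bsub>Q\<^esub>"
      then have "p ^ r dvd p ^ r'" using Q.pow_eq_id [OF v(1)] r by (simp add: v'_def)
      then show False using r' p_gt_1 by (metis power_dvd_imp_le Suc_n_not_le_n)
    qed
    moreover have "\<pi> z \<in> Q.Z" by (rule \<pi>_Z [OF z(1)])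
    moreover have "\<pi> z [^]\<^bsub>Q\<^esub> p = \<one>\<^bsub>Q\<^esub>" using \<pi>_pow [OF zM, of p] z(2) \<pi>.hom_one by simp
    ultimately obtain i where "\<pi> z = v' [^]\<^bsub>Q\<^esub> (i::nat)" using Q.center_order_p_power by blast
    then have "\<pi> z = xb [^]\<^bsub>Q\<^esub> (j * p ^ r' * i)" using xb(1) by (simp add: v'_def v_def Q.nat_pow_pow)
    then have "\<pi> z = \<pi> (x [^] (j * p ^ r' * i))" using \<pi>_pow [OF xM] by (simp add: xb_def)
    moreover define w where "w = x [^] (j * p ^ r' * i)"
    ultimately have eq: "\<pi> z = \<pi> w" by simp
    have wM: "w \<in> C.M" unfolding w_def by (rule M_pow_mem [OF xM])
    have "\<pi> (z \<otimes> inv w) = \<one>\<^bsub>Q\<^esub>"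
      using eq zM wM \<pi>_c [OF wM] by (simp add: \<pi>_mult \<pi>_inv)
    then have "z \<otimes> inv w \<in> K0" using \<pi>1 [of "z \<otimes> inv w"] zM wM by simp
    then obtain s where s: "z \<otimes> inv w = x [^] (p ^ \<mu> * s)" using K0E by blast
    have "z = (z \<otimes> inv w) \<otimes> w" using zc wM by (simp add: m_assoc)
    also have "\<dots> = x [^] (p ^ \<mu> * s + j * p ^ r' * i)" unfolding s using x by (simp add: w_def nat_pow_mult)
    finally show False using z_not_pow by blast
  qed
  have tight1: "w [^]\<^bsub>Q\<^esub> p = \<one>\<^bsub>Q\<^esub>" if "w \<in> Q.Z" for w
    by (rule Q.degree_p2_tight(1) [OF odd degQ xb tightQ]) (use trivQ that in blast)+
  have tight2: "w [^]\<^bsub>Q\<^esub> p = \<one>\<^bsub>Q\<^esub>" if "w \<in> Q.center_mod Q.Z" "w [^]\<^bsub>Q\<^esub> p \<in> Q.Z" for w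
    by (rule Q.degree_p2_tight(2) [OF odd degQ xb tightQ]) (use trivQ that in blast)+
  have tight3: "\<exists>i::nat. xb [^]\<^bsub>Q\<^esub> i \<in> Q.center_mod Q.Z \<and> xb [^]\<^bsub>Q\<^esub> i \<noteq> \<one>\<^bsub>Q\<^esub> \<and>
      (xb [^]\<^bsub>Q\<^esub> i) [^]\<^bsub>Q\<^esub> p = \<one>\<^bsub>Q\<^esub>"
    by (rule Q.degree_p2_tight(3) [OF odd degQ xb tightQ]) (use trivQ in blast)
  obtain i where i: "xb [^]\<^bsub>Q\<^esub> (i::nat) \<in> Q.center_mod Q.Z" "xb [^]\<^bsub>Q\<^esub> i \<noteq> \<one>\<^bsub>Q\<^esub>"
    "(xb [^]\<^bsub>Q\<^esub> i) [^]\<^bsub>Q\<^esub> p = \<one>\<^bsub>Q\<^esub>"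
    using tight3 by blast
  have "\<mu> \<noteq> 0"
  proof
    assume "\<mu> = 0"
    then have "Q.ord xb = 1" using \<mu> by simp
    then have "xb = \<one>\<^bsub>Q\<^esub>" using Q.ord_eq_1 [OF xb(1)] by simp
    then show False using i(2) by simp
  qed
  then obtain \<nu> where \<nu>: "\<mu> = Suc \<nu>" by (cases \<mu>) auto
  \<comment> \<open>Chosen so that the n-th power of \<open>xb\<close> generates the subgroup of
    order p of <xb>. As \<open>tight3\<close> puts a generator of that subgroup in the second
    centre, this power lies there too, and x^(n p) generates \<open>K0\<close>.\<close>
  define n where "n = p ^ \<nu>"
  have n\<mu>: "p ^ \<mu> = n * p" by (simp add: n_def \<nu>)
  have fn: "xb [^]\<^bsub>Q\<^esub> n \<in> Q.center_mod Q.Z" "(xb [^]\<^bsub>Q\<^esub> n) [^]\<^bsub>Q\<^esub> p = \<one>\<^bsub>Q\<^esub>"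
  proof -
    show *: "(xb [^]\<^bsub>Q\<^esub> n) [^]\<^bsub>Q\<^esub> p = \<one>\<^bsub>Q\<^esub>"
      using xb(1) \<mu> n\<mu> Q.pow_ord_eq_1 [OF xb(1)] by (simp add: Q.nat_pow_pow)
    obtain d where d: "xb [^]\<^bsub>Q\<^esub> n = (xb [^]\<^bsub>Q\<^esub> i) [^]\<^bsub>Q\<^esub> (d::nat)"
      using Q.order_p_in_cyclic [OF xb(1) i(3,2) *] by blast
    show "xb [^]\<^bsub>Q\<^esub> n \<in> Q.center_mod Q.Z"
      unfolding d by (rule Q.pow_mem_subgroup [OF Q.subgroup_center_mod [OF Q.normal_center] i(1)])
  qed
  \<comment> \<open>In \<open>Q\<close> the commutator is central with trivial p-th power, hence a
    power of the image of \<open>z\<close>. Lifting it to \<open>M\<close> costs an element of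
    \<open>K0\<close>, that is, a power of x^(n p).\<close>
  have comm_f: "\<exists>s j::nat. g \<otimes> x [^] n \<otimes> inv g = (x [^] n) [^] (1 + p * s) \<otimes> z [^] j"
    if g: "g \<in> C.M" for g
  proof -
    let ?f = "x [^] n"
    have fM: "?f \<in> C.M" by (rule M_pow_mem [OF xM])
    have gc: "g \<in> carrier G" using g by simp
    let ?q = "Q.commutator (\<pi> g) (\<pi> ?f)"
    have \<pi>f: "\<pi> ?f = xb [^]\<^bsub>Q\<^esub> n" using \<pi>_pow [OF xM] by (simp add: xb_def)
    have qZ: "?q \<in> Q.Z" using fn(1) \<pi>_c [OF g] unfolding Q.center_mod_def \<pi>f by blast
    have "\<pi> z \<in> Q.Z" "\<pi> z [^]\<^bsub>Q\<^esub> p = \<one>\<^bsub>Q\<^esub>" "\<pi> z \<noteq> \<one>\<^bsub>Q\<^esub>"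
      using \<pi>_Z [OF z(1)] \<pi>_pow [OF zM, of p] z(2) \<pi>.hom_one \<pi>1 [OF zM] zK0 by auto
    then obtain j where "?q = \<pi> z [^]\<^bsub>Q\<^esub> (j::nat)"
      using Q.center_order_p_power qZ tight1 [OF qZ] by blast
    then have eq: "\<pi> (commutator g ?f) = \<pi> (z [^] j)" using \<pi>_comm [OF g fM] \<pi>_pow [OF zM] by simp
    have zjM: "z [^] j \<in> C.M" by (rule M_pow_mem [OF zM])
    have cM: "commutator g ?f \<in> C.M" using g fM by (simp add: commutator_def)
    have "\<pi> (commutator g ?f \<otimes> inv (z [^] j)) = \<one>\<^bsub>Q\<^esub>"
      using eq cM zjM \<pi>_c [OF zjM] \<pi>_mult [OF cM, of "inv (z [^] j)"] by (simp add: \<pi>_inv)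
    then have "commutator g ?f \<otimes> inv (z [^] j) \<in> K0"
      using \<pi>1 [of "commutator g ?f \<otimes> inv (z [^] j)"] cM zjM by simp
    then obtain s where s: "commutator g ?f \<otimes> inv (z [^] j) = x [^] (p ^ \<mu> * s)" using K0E by blast
    have xs: "x [^] (p ^ \<mu> * s) = ?f [^] (p * s)" using x by (simp add: n\<mu> nat_pow_pow mult.assoc)
    have "g \<otimes> ?f \<otimes> inv g = commutator g ?f \<otimes> ?f" by (rule conj_eq_commutator [OF gc]) (use x in simp)
    also have "\<dots> = (commutator g ?f \<otimes> inv (z [^] j)) \<otimes> (z [^] j \<otimes> ?f)"
      using gc x zc by (simp add: m_assoc)
    also have "z [^] j \<otimes> ?f = ?f \<otimes> z [^] j"
      using center_comm [OF center_pow(1) [OF z(1)], of ?f j] x by simp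
    also have "(commutator g ?f \<otimes> inv (z [^] j)) \<otimes> (?f \<otimes> z [^] j) = ?f [^] (p * s) \<otimes> ?f \<otimes> z [^] j"
      unfolding s xs using x zc by (simp add: m_assoc)
    also have "?f [^] (p * s) \<otimes> ?f = ?f [^] (1 + p * s)" by simp
    finally show ?thesis by blast
  qed
  have \<mu>_lt: "\<mu> < m"
  proof (rule ccontr)
    assume "\<not> \<mu> < m"
    then have "c = \<one>" using ordc ord_eq_1 [OF cc] by simp
    then have "e = \<one>" using eK0 K0c generate_singleton [OF cc] by auto
    then show False using eZ by simp
  qed
  obtain a where a: "e = x [^] (a::nat)" using K0E [OF eK0] by blast
  obtain q where q: "m = Suc (Suc (\<nu> + q))" using \<mu>_lt \<nu> by (metis less_iff_Suc_add add_Suc)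
  \<comment> \<open>The exponent equals p^(m-2): \<open>h\<close> has order p^2, and
    \<open>e1\<close> = h^p generates the same subgroup of order p as \<open>e\<close>.\<close>
  define h where "h = x [^] (n * p ^ q)"
  have hM: "h \<in> C.M" unfolding h_def by (rule M_pow_mem [OF xM])
  have hc: "h \<in> carrier G" using hM by simp
  define e1 where "e1 = h [^] p"
  have e1c: "e1 \<in> carrier G" using hc by (simp add: e1_def)
  have e1x: "e1 = x [^] (p ^ (m - 1))"
    using x by (simp add: e1_def h_def nat_pow_pow n_def q power_add mult_ac)
  have e1p: "e1 [^] p = \<one>"
  proof -
    have "e1 [^] p = x [^] (p ^ m)" using x by (simp add: e1x nat_pow_pow q mult_ac)
    then show ?thesis using \<open>x [^] (p ^ m) = \<one>\<close> by simp
  qed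
  have e1_ne: "e1 \<noteq> \<one>"
  proof
    assume "e1 = \<one>"
    then have "p ^ m dvd p ^ (m - 1)" using pow_eq_id [OF x(1)] m by (simp add: e1x)
    then have "m \<le> m - 1" using p_gt_1 power_dvd_imp_le by blast
    then show False using q by simp
  qed
  have "e \<noteq> \<one>" using eZ by auto
  have e1_mod: "e1 \<in> center_mod Z"
  proof -
    obtain d where "e1 = e [^] (d::nat)"
      using order_p_in_cyclic [OF x(1), of a "p ^ (m - 1)"] ep \<open>e \<noteq> \<one>\<close> e1p by (auto simp: a e1x)
    then show ?thesis using pow_mem_subgroup [OF CZ.subgroup_axioms e_mod] by simp
  qed
  have e1Z: "e1 \<notin> Z"
  proof
    assume "e1 \<in> Z"
    moreover obtain d where "e = e1 [^] (d::nat)"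
      using order_p_in_cyclic [OF x(1), of "p ^ (m - 1)" a] ep e1_ne e1p by (auto simp: a e1x)
    ultimately show False using center_pow(1) eZ by simp
  qed
  have e1K0: "e1 \<in> K0"
  proof -
    have "m - 1 = \<mu> + q" using q \<nu> by simp
    then have "e1 = c [^] (p ^ q)" using x by (simp add: e1x c_def nat_pow_pow power_add)
    then show ?thesis using pow_mem_subgroup [OF subK0] x\<mu>K0 by (simp add: c_def)
  qed
  have comm_h: "\<exists>(s::nat) (j::nat). commutator g h = e1 [^] s \<otimes> z [^] j" if g: "g \<in> C.M" for g
  proof -
    have gc: "g \<in> carrier G" using g by simp
    obtain s j where sj: "g \<otimes> x [^] n \<otimes> inv g = (x [^] n) [^] (1 + p * s) \<otimes> z [^] (j::nat)"
      using comm_f [OF g] by blast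
    have hn: "h = (x [^] n) [^] (p ^ q)" using x by (simp add: h_def nat_pow_pow)
    have "g \<otimes> h \<otimes> inv g = (g \<otimes> x [^] n \<otimes> inv g) [^] (p ^ q)"
      unfolding hn by (rule conj_pow) (use gc x in auto)
    also have "\<dots> = ((x [^] n) [^] (1 + p * s)) [^] (p ^ q) \<otimes> (z [^] j) [^] (p ^ q)"
      unfolding sj
      by (rule pow_mult_distrib) (use x zc center_comm [OF center_pow(1) [OF z(1)], of "(x [^] n) [^] (1 + p * s)" j] in auto)
    also have "((x [^] n) [^] (1 + p * s)) [^] (p ^ q) = h [^] (1 + p * s)"
      using nat_pow_pow [of "x [^] n" "1 + p * s" "p ^ q"] nat_pow_pow [of "x [^] n" "p ^ q" "1 + p * s"] x
      by (simp only: hn mult.commute nat_pow_closed)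
    also have "h [^] (1 + p * s) = e1 [^] s \<otimes> h" using hc by (simp add: e1_def nat_pow_pow)
    also have "(z [^] j) [^] (p ^ q) = z [^] (j * p ^ q)" using zc by (simp add: nat_pow_pow)
    finally have "g \<otimes> h \<otimes> inv g = e1 [^] s \<otimes> (h \<otimes> z [^] (j * p ^ q))" using e1c hc zc by (simp add: m_assoc)
    also have "h \<otimes> z [^] (j * p ^ q) = z [^] (j * p ^ q) \<otimes> h"
      by (rule center_comm [OF center_pow(1) [OF z(1)] hc])
    finally have "g \<otimes> h \<otimes> inv g \<otimes> inv h = e1 [^] s \<otimes> z [^] (j * p ^ q)"
      using e1c hc zc by (simp add: m_assoc)
    then show ?thesis unfolding commutator_def by blast
  qed
  \<comment> \<open>This \<open>g\<close> lies in the whole group. \<open>M\<close> centralizes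
    \<open>e1\<close>, whereas \<open>g\<close> moves it by a nontrivial central \<zeta>, which
    survives in \<open>Q\<close> because \<open>K0\<close> meets \<open>Z\<close> trivially. Thus
    conjugation by \<open>g\<close> takes h^p out of the kernel.\<close>
  obtain g where g: "g \<in> carrier G" "commutator g e1 \<noteq> \<one>"
    using e1Z e1c unfolding center_eq center_mod_def by blast
  define \<zeta> where "\<zeta> = commutator g e1"
  have \<zeta>Z: "\<zeta> \<in> Z" using e1_mod g(1) unfolding center_mod_def \<zeta>_def by blast
  have \<zeta>M: "\<zeta> \<in> C.M" using \<zeta>Z ZM by blast
  have \<zeta>K0: "\<zeta> \<notin> K0"
    using psi_lam [OF \<zeta>Z] lam_inj [of \<zeta> \<one>] \<zeta>Z g(2) by (auto simp: \<zeta>_def)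
  have e1M: "e1 \<in> C.M" unfolding e1_def by (rule M_pow_mem [OF hM])
  have ge1: "g \<otimes> e1 \<otimes> inv g = \<zeta> \<otimes> e1" using conj_eq_commutator [OF g(1) e1c] by (simp add: \<zeta>_def)
  have \<pi>ge1: "\<pi> (g \<otimes> e1 \<otimes> inv g) = \<pi> \<zeta>"
    using \<pi>_mult [OF \<zeta>M e1M] \<pi>1 [OF e1M] e1K0 \<pi>_c [OF \<zeta>M] by (simp add: ge1)
  define h1 where "h1 = g \<otimes> h \<otimes> inv g"
  have h1M: "h1 \<in> C.M" unfolding h1_def by (rule C.M_conj [OF g(1) hM])
  define l where "l = \<pi> h1"
  have lp: "l [^]\<^bsub>Q\<^esub> p = \<pi> \<zeta>"
  proof -
    have "h1 [^] p = g \<otimes> e1 \<otimes> inv g" unfolding h1_def e1_def by (rule conj_pow [OF g(1) hc, symmetric])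
    then show ?thesis using \<pi>_pow [OF h1M, of p] \<pi>ge1 by (simp add: l_def)
  qed
  \<comment> \<open>Normality of \<open>M\<close> lets a commutator of \<open>h1\<close> with b in
    \<open>M\<close> be conjugated back to one of \<open>h\<close>, a product of powers of
    \<open>e1\<close> and \<open>z\<close>. Conjugating forward again replaces \<open>e1\<close> by
    \<zeta> e1, whose image is the central \<pi>(\<zeta>).\<close>
  have "l \<in> Q.center_mod Q.Z"
  proof -
    have "Q.commutator r l \<in> Q.Z" if r: "r \<in> carrier Q" for r
    proof -
      obtain b where b: "b \<in> C.M" "r = \<pi> b" using r surj by auto
      have bc: "b \<in> carrier G" using b by simp
      have b': "inv g \<otimes> b \<otimes> g \<in> C.M" using C.M_conj [of "inv g" b] g b by simp
      obtain s j where sj: "commutator (inv g \<otimes> b \<otimes> g) h = e1 [^] (s::nat) \<otimes> z [^] (j::nat)"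
        using comm_h [OF b'] by blast
      have "commutator b h1 = g \<otimes> commutator (inv g \<otimes> b \<otimes> g) h \<otimes> inv g"
        using g(1) bc hc by (simp add: commutator_def h1_def word_simps)
      also have "\<dots> = (g \<otimes> e1 [^] s \<otimes> inv g) \<otimes> (g \<otimes> z [^] j \<otimes> inv g)"
        unfolding sj using g(1) e1c zc by (simp add: m_assoc)
      also have "g \<otimes> z [^] j \<otimes> inv g = z [^] j"
        using center_comm [OF center_pow(1) [OF z(1)] g(1), of j] g(1) zc by (simp add: m_assoc)
      also have "g \<otimes> e1 [^] s \<otimes> inv g = (g \<otimes> e1 \<otimes> inv g) [^] s" by (rule conj_pow [OF g(1) e1c])
      finally have eq: "commutator b h1 = (g \<otimes> e1 \<otimes> inv g) [^] s \<otimes> z [^] j" .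
      have ge1M: "g \<otimes> e1 \<otimes> inv g \<in> C.M" by (rule C.M_conj [OF g(1) e1M])
      have "Q.commutator r l = \<pi> (commutator b h1)" using \<pi>_comm [OF b(1) h1M] b by (simp add: l_def)
      also have "\<dots> = \<pi> \<zeta> [^]\<^bsub>Q\<^esub> s \<otimes>\<^bsub>Q\<^esub> \<pi> z [^]\<^bsub>Q\<^esub> j"
        unfolding eq
        using \<pi>_mult [OF M_pow_mem [OF ge1M, of s] M_pow_mem [OF zM, of j]]
          \<pi>_pow [OF ge1M, of s] \<pi>_pow [OF zM, of j] \<pi>ge1 by simp
      also have "\<dots> \<in> Q.Z"
        by (intro Q.center_m_closed(1) Q.center_pow(1) \<pi>_Z \<zeta>Z z(1))
      finally show ?thesis .
    qed
    then show ?thesis unfolding Q.center_mod_def using \<pi>_c [OF h1M] by (simp add: l_def)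
  qed
  moreover have "l [^]\<^bsub>Q\<^esub> p \<in> Q.Z" unfolding lp by (rule \<pi>_Z [OF \<zeta>Z])
  ultimately have "l [^]\<^bsub>Q\<^esub> p = \<one>\<^bsub>Q\<^esub>" by (rule tight2)
  then show False using lp \<pi>1 [OF \<zeta>M] \<zeta>K0 by simp
qed

end

lemma (in faithful_pgroup_char) ord_bound_faithful:
  assumes odd: "odd p" and deg: "(\<phi> \<one>)\<^sup>2 = of_nat (p ^ (2 * k))" "k \<le> 3"
    and x: "x \<in> carrier G" "\<phi> x \<noteq> 0"
  shows "ord x * p ^ (2 * k) \<le> card (carrier G)"
proof -
  consider "k = 0" | "k = 1" | "k = 2" | "k = 3" using deg(2) by linarith
  then show ?thesis
  proof cases
    case 1
    then show ?thesis using ord_le_group_order [OF fin x(1)] by (simp add: Coset.order_def)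
  next
    case 2
    have nz: "Z \<noteq> carrier G" using center_neq_carrier [OF deg(1)] 2 by simp
    have sub: "subgroup (cyclic_center x) G" by (rule subgroup_cyclic_center [OF fin x(1)])
    have "generate G {x} \<subseteq> cyclic_center x"
      using generate_subgroup_incl [OF _ sub, of "{x}"] mem_cyclic_center(1) [OF x(1)] by simp
    then have "ord x \<le> card (cyclic_center x)"
      using generate_pow_card [OF x(1)] finite_subgroup [OF sub] by (simp add: card_mono)
    then have "ord x * p ^ 2 \<le> card (cyclic_center x) * p ^ 2" by (rule mult_right_mono) simp
    also have "\<dots> \<le> card (carrier G)" by (rule card_cyclic_center_le [OF odd nz x])
    finally show ?thesis using 2 by simp
  next
    case 3
    then show ?thesis using ord_bound_degree_p2 [OF odd _ x] deg(1) by simp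
  next
    case 4
    then show ?thesis using ord_bound_degree_p3 [OF odd _ x] deg(1) by simp
  qed
qed

text \<open>Lifting from G/K is free: the order of \<open>x\<close> divides the order of its image
  times |K|, and the group order grows by exactly |K|.\<close>

lemma (in pgroup_char) ord_bound:
  assumes odd: "odd p" and deg: "(\<phi> \<one>)\<^sup>2 = of_nat (p ^ (2 * k))" "k \<le> 3"
    and x: "x \<in> carrier G" "\<phi> x \<noteq> 0"
  shows "ord x * p ^ (2 * k) \<le> card (carrier G)"
proof -
  obtain Q :: "'a set monoid" and \<pi> \<phi>' where
    Q: "pgroup_char Q \<phi>' p" and hom: "group_hom G Q \<pi>" and surj: "\<pi> ` carrier G = carrier Q"
    and \<pi>1: "\<And>g. g \<in> carrier G \<Longrightarrow> \<pi> g = \<one>\<^bsub>Q\<^esub> \<longleftrightarrow> g \<in> K"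
    and \<phi>': "\<And>g. g \<in> carrier G \<Longrightarrow> \<phi>' (\<pi> g) = \<phi> g"
    and kerQ: "char_ker Q \<phi>' = {\<one>\<^bsub>Q\<^esub>}" and cardQ: "card (carrier Q) * card K = card (carrier G)"
    by (rule obtain_faithful_quotient) blast
  interpret Q: faithful_pgroup_char Q \<phi>' p
    using Q kerQ by (simp add: faithful_pgroup_char_def faithful_pgroup_char_axioms_def)
  interpret \<pi>: group_hom G Q \<pi> by (rule hom)
  have subK: "subgroup K G" by (rule normal_imp_subgroup [OF normal_ker])
  let ?n = "Q.ord (\<pi> x)"
  have \<pi>x: "\<pi> x \<in> carrier Q" "\<phi>' (\<pi> x) \<noteq> 0" using x \<phi>' by auto
  have "\<phi>' \<one>\<^bsub>Q\<^esub> = \<phi> \<one>" using \<phi>' [OF one_closed] \<pi>.hom_one by simp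
  then have bound: "?n * p ^ (2 * k) \<le> card (carrier Q)"
    using Q.ord_bound_faithful [OF odd _ deg(2) \<pi>x] deg(1) by simp
  define w where "w = x [^] ?n"
  have "\<pi> w = \<one>\<^bsub>Q\<^esub>" using \<pi>.hom_nat_pow [OF x(1), of ?n] Q.pow_ord_eq_1 [OF \<pi>x(1)] by (simp add: w_def)
  then have wK: "w \<in> K" using \<pi>1 [of w] x by (simp add: w_def)
  have wc: "w \<in> carrier G" using x by (simp add: w_def)
  have "generate G {w} \<subseteq> K" using generate_subgroup_incl [OF _ subK, of "{w}"] wK by simp
  moreover have "subgroup (generate G {w}) G" using wc by (intro generate_is_subgroup) simp
  ultimately have "ord w dvd card K"
    using card_subgroup_dvd [OF _ subK] generate_pow_card [OF wc] by simp
  then have "w [^] card K = \<one>" using pow_eq_id [OF wc] by simp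
  then have "x [^] (?n * card K) = \<one>" using x by (simp add: w_def nat_pow_pow)
  then have "ord x dvd ?n * card K" using pow_eq_id [OF x(1)] by simp
  moreover have "?n * card K > 0"
    using Q.ord_ge_1 [OF Q.fin \<pi>x(1)] cardQ card_pos by (cases "card K") auto
  ultimately have "ord x \<le> ?n * card K" by (rule dvd_imp_le)
  then have "ord x * p ^ (2 * k) \<le> (?n * p ^ (2 * k)) * card K" by (simp add: mult_ac)
  also have "\<dots> \<le> card (carrier Q) * card K" by (rule mult_right_mono [OF bound]) simp
  finally show ?thesis using cardQ by simp
qed

section \<open>Characters of irreducible representations\<close>

lemma mat_mult_entry:
  assumes "A \<in> carrier_mat n n" "B \<in> carrier_mat n n" "i < n" "j < n"
  shows "(A * B) $$ (i, j) = (\<Sum>m<n. A $$ (i, m) * B $$ (m, j))"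
  using assms by (auto simp: scalar_prod_def atLeast0LessThan intro!: sum.cong)

text \<open>Schur's lemma: an eigenspace of \<open>A\<close> is invariant and nonzero, so it is the
  whole space.\<close>

lemma schur_scalar:
  assumes G: "group G" and irr: "irreducible_rep G n \<rho>" and A: "A \<in> carrier_mat n n"
    and comm: "\<And>g. g \<in> carrier G \<Longrightarrow> A * \<rho> g = \<rho> g * A"
  shows "\<exists>c. A = c \<cdot>\<^sub>m 1\<^sub>m n"
proof -
  have n: "n > 0" and \<rho>: "\<And>g. g \<in> carrier G \<Longrightarrow> \<rho> g \<in> carrier_mat n n"
    and sub: "\<And>W. invariant_subspace G n \<rho> W \<Longrightarrow> W = {0\<^sub>v n} \<or> W = carrier_vec n"
    using irr hom_GL_iff [OF G, of \<rho> n] by (auto simp: irreducible_rep_def)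
  obtain c where "c \<in> spectrum A" using spectrum_non_empty [OF A n] by blast
  then obtain v where v: "v \<in> carrier_vec n" "v \<noteq> 0\<^sub>v n" "A *\<^sub>v v = c \<cdot>\<^sub>v v"
    using A by (auto simp: spectrum_def eigenvalue_def eigenvector_def)
  define W where "W = {w \<in> carrier_vec n. A *\<^sub>v w = c \<cdot>\<^sub>v w}"
  have "invariant_subspace G n \<rho> W"
    unfolding invariant_subspace_def
  proof (intro conjI ballI)
    have vs: "vectorspace class_ring (module_vec TYPE(complex) n)" by (rule vec_vs)
    have "LinearCombinations.submodule class_ring W (module_vec TYPE(complex) n)"
    proof (rule LinearCombinations.submodule.intro)
      show "Module.module class_ring (module_vec TYPE(complex) n)" by (rule vec_module)
      show "W \<subseteq> carrier (module_vec TYPE(complex) n)" by (auto simp: W_def module_vec_simps)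
      show "u \<oplus>\<^bsub>module_vec TYPE(complex) n\<^esub> w \<in> W" if "u \<in> W" "w \<in> W" for u w
        using that A by (auto simp: W_def module_vec_simps mult_add_distrib_mat_vec [OF A] smult_add_distrib_vec)
      show "\<zero>\<^bsub>module_vec TYPE(complex) n\<^esub> \<in> W"
        using A by (auto simp: W_def module_vec_simps)
      show "a \<odot>\<^bsub>module_vec TYPE(complex) n\<^esub> w \<in> W" if "a \<in> carrier class_ring" "w \<in> W" for a w
        using that A by (auto simp: W_def module_vec_simps mult_mat_vec [OF A] smult_smult_assoc mult.commute)
    qed
    then show "VectorSpace.subspace class_ring W (module_vec TYPE(complex) n)"
      using vs by (simp add: VectorSpace.subspace_def)
  next
    fix g w assume g: "g \<in> carrier G" and w: "w \<in> W"
    have wc: "w \<in> carrier_vec n" and Aw: "A *\<^sub>v w = c \<cdot>\<^sub>v w" using w by (auto simp: W_def)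
    have "A *\<^sub>v (\<rho> g *\<^sub>v w) = (A * \<rho> g) *\<^sub>v w" using A \<rho> [OF g] wc by simp
    also have "\<dots> = \<rho> g *\<^sub>v (A *\<^sub>v w)" using comm [OF g] A \<rho> [OF g] wc by simp
    also have "\<dots> = c \<cdot>\<^sub>v (\<rho> g *\<^sub>v w)" unfolding Aw using \<rho> [OF g] wc by (simp add: mult_mat_vec)
    finally show "\<rho> g *\<^sub>v w \<in> W" using \<rho> [OF g] wc by (auto simp: W_def)
  qed
  moreover have "v \<in> W" using v by (simp add: W_def)
  ultimately have W: "W = carrier_vec n" using sub v(2) by blast
  have "A = c \<cdot>\<^sub>m 1\<^sub>m n"
  proof (rule eq_matI)
    fix i j assume "i < dim_row (c \<cdot>\<^sub>m 1\<^sub>m n)" "j < dim_col (c \<cdot>\<^sub>m 1\<^sub>m n)"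
    then have ij: "i < n" "j < n" by auto
    have "unit_vec n j \<in> W" using W by simp
    then have "(A *\<^sub>v unit_vec n j) $ i = (c \<cdot>\<^sub>v unit_vec n j) $ i" by (simp add: W_def)
    moreover have "(A *\<^sub>v unit_vec n j) $ i = A $$ (i, j)"
      using A ij scalar_prod_right_unit [of j n "row A i"] by simp
    ultimately show "A $$ (i, j) = (c \<cdot>\<^sub>m 1\<^sub>m n) $$ (i, j)" using ij by (simp add: unit_vec_def)
  qed (use A in auto)
  then show ?thesis ..
qed

lemma (in group) sum_translate_left:
  assumes "c \<in> carrier G"
  shows "(\<Sum>h\<in>carrier G. f (c \<otimes> h)) = (\<Sum>h\<in>carrier G. f h)"
  by (rule sum.reindex_bij_witness [where i = "\<lambda>h. inv c \<otimes> h" and j = "\<lambda>h. c \<otimes> h"])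
    (use assms in auto)

text \<open>The matrix \<open>T\<close> is the sum of \<rho>(h) E \<rho>(h\<inverse>) over the
  group, where E is the matrix unit at (i, j). It commutes with the representation, so it is scalar,
  and its trace |G| tr E determines the scalar.\<close>

lemma schur_relations:
  fixes G :: "('a, 'b) monoid_scheme" (structure)
  assumes G: "group G" and irr: "irreducible_rep G n \<rho>"
    and "i < n" "j < n" "k < n" "l < n"
  shows "of_nat n * (\<Sum>h\<in>carrier G. \<rho> h $$ (k, i) * \<rho> (inv h) $$ (j, l))
    = (if i = j \<and> k = l then of_nat (card (carrier G)) else 0)"
proof -
  interpret group G by (rule G)
  have \<rho>: "\<And>g. g \<in> carrier G \<Longrightarrow> \<rho> g \<in> carrier_mat n n" and one: "\<rho> \<one> = 1\<^sub>m n"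
    and mult: "\<And>x y. x \<in> carrier G \<Longrightarrow> y \<in> carrier G \<Longrightarrow> \<rho> (x \<otimes> y) = \<rho> x * \<rho> y"
    using irr hom_GL_iff [OF G, of \<rho> n] by (auto simp: irreducible_rep_def)
  have entry: "\<rho> (x \<otimes> y) $$ (r, s) = (\<Sum>m<n. \<rho> x $$ (r, m) * \<rho> y $$ (m, s))"
    if "x \<in> carrier G" "y \<in> carrier G" "r < n" "s < n" for x y r s
    using that by (simp add: mult mat_mult_entry [OF \<rho> \<rho>])
  define T where "T = mat n n (\<lambda>(k, l). \<Sum>h\<in>carrier G. \<rho> h $$ (k, i) * \<rho> (inv h) $$ (j, l))"
  have T: "T \<in> carrier_mat n n" by (simp add: T_def)
  have "T * \<rho> g = \<rho> g * T" if g: "g \<in> carrier G" for g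
  proof (rule eq_matI)
    fix r s assume "r < dim_row (\<rho> g * T)" "s < dim_col (\<rho> g * T)"
    then have rs: "r < n" "s < n" using \<rho> [OF g] T by auto
    have "(\<rho> g * T) $$ (r, s) = (\<Sum>m<n. \<rho> g $$ (r, m) * (\<Sum>h\<in>carrier G. \<rho> h $$ (m, i) * \<rho> (inv h) $$ (j, s)))"
      using rs by (simp add: mat_mult_entry [OF \<rho> [OF g] T]) (simp add: T_def)
    also have "\<dots> = (\<Sum>h\<in>carrier G. \<rho> (g \<otimes> h) $$ (r, i) * \<rho> (inv h) $$ (j, s))"
      using g rs assms by (simp add: entry sum_distrib_left sum_distrib_right mult.assoc)
        (rule sum.swap)
    also have "\<dots> = (\<Sum>h\<in>carrier G. \<rho> (g \<otimes> h) $$ (r, i) * \<rho> (inv (g \<otimes> h) \<otimes> g) $$ (j, s))"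
      by (rule sum.cong) (use g in \<open>auto simp: word_simps\<close>)
    also have "\<dots> = (\<Sum>h\<in>carrier G. \<rho> h $$ (r, i) * \<rho> (inv h \<otimes> g) $$ (j, s))"
      by (rule sum_translate_left [OF g])
    also have "\<dots> = (\<Sum>m<n. (\<Sum>h\<in>carrier G. \<rho> h $$ (r, i) * \<rho> (inv h) $$ (j, m)) * \<rho> g $$ (m, s))"
      using g rs assms by (simp add: entry sum_distrib_left sum_distrib_right mult.assoc)
        (rule sum.swap)
    also have "\<dots> = (T * \<rho> g) $$ (r, s)"
      using rs by (simp add: mat_mult_entry [OF T \<rho> [OF g]]) (simp add: T_def)
    finally show "(T * \<rho> g) $$ (r, s) = (\<rho> g * T) $$ (r, s)" by simp
  qed (use \<rho> [OF g] T in auto)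
  then obtain c where c: "T = c \<cdot>\<^sub>m 1\<^sub>m n" using schur_scalar [OF G irr T] by blast
  have T_entry: "T $$ (r, s) = (if r = s then c else 0)" if "r < n" "s < n" for r s
    using that by (simp add: c)
  have T_entry': "T $$ (r, s) = (\<Sum>h\<in>carrier G. \<rho> h $$ (r, i) * \<rho> (inv h) $$ (j, s))" if "r < n" "s < n" for r s
    using that by (simp add: T_def)
  have "of_nat n * c = (\<Sum>m<n. T $$ (m, m))" by (simp add: T_entry)
  also have "\<dots> = (\<Sum>h\<in>carrier G. \<Sum>m<n. \<rho> (inv h) $$ (j, m) * \<rho> h $$ (m, i))"
    by (simp add: T_entry' mult.commute) (rule sum.swap)
  also have "\<dots> = (\<Sum>h\<in>carrier G. \<rho> (inv h \<otimes> h) $$ (j, i))"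
  proof (rule sum.cong)
    fix h assume h: "h \<in> carrier G"
    show "(\<Sum>m<n. \<rho> (inv h) $$ (j, m) * \<rho> h $$ (m, i)) = \<rho> (inv h \<otimes> h) $$ (j, i)"
      by (rule entry [symmetric]) (use h assms in auto)
  qed simp
  also have "\<dots> = (\<Sum>h\<in>carrier G. if i = j then 1 else 0)"
    by (rule sum.cong) (use assms one in auto)
  finally have "of_nat n * c = (if i = j then of_nat (card (carrier G)) else 0)" by simp
  then show ?thesis using T_entry [of k l] T_entry' [of k l] assms by auto
qed

text \<open>Both identities come from expanding traces into matrix entries and applying the Schur
  relations termwise. The inverse in place of complex conjugation avoids choosing a unitary form of
  \<rho>.\<close>

lemma irr_char_character:
  fixes G :: "('a, 'b) monoid_scheme" (structure)
  assumes G: "group G" and fin: "finite (carrier G)" and irr: "irreducible_rep G n \<rho>"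
  shows "irr_char G (character G \<rho>)"
proof -
  interpret group G by (rule G)
  have n: "n > 0" and \<rho>: "\<And>g. g \<in> carrier G \<Longrightarrow> \<rho> g \<in> carrier_mat n n"
    and mult: "\<And>x y. x \<in> carrier G \<Longrightarrow> y \<in> carrier G \<Longrightarrow> \<rho> (x \<otimes> y) = \<rho> x * \<rho> y"
    using irr hom_GL_iff [OF G, of \<rho> n] by (auto simp: irreducible_rep_def)
  have entry: "\<rho> (x \<otimes> y) $$ (r, s) = (\<Sum>m<n. \<rho> x $$ (r, m) * \<rho> y $$ (m, s))"
    if "x \<in> carrier G" "y \<in> carrier G" "r < n" "s < n" for x y r s
    using that by (simp add: mult mat_mult_entry [OF \<rho> \<rho>])
  let ?\<chi> = "character G \<rho>" and ?c = "of_nat (card (carrier G)) :: complex"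
  have \<chi>: "?\<chi> g = (\<Sum>i<n. \<rho> g $$ (i, i))" if "g \<in> carrier G" for g
    using that \<rho> [OF that] by (auto simp: character_def mat_trace_def)
  let ?S = "\<lambda>k i j l. \<Sum>h\<in>carrier G. \<rho> h $$ (k, i) * \<rho> (inv h) $$ (j, l)"
  have S: "of_nat n * ?S k i j l = (if i = j \<and> k = l then ?c else 0)" if "i < n" "j < n" "k < n" "l < n" for i j k l
    using schur_relations [OF G irr that] .
  show ?thesis
  proof
    fix a b assume a: "a \<in> carrier G" and b: "b \<in> carrier G"
    have "(\<Sum>h\<in>carrier G. ?\<chi> (a \<otimes> (h \<otimes> b \<otimes> inv h)))
        = (\<Sum>h\<in>carrier G. \<Sum>r<n. \<Sum>k<n. \<Sum>j<n. \<Sum>i<n.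
            \<rho> a $$ (r, k) * \<rho> b $$ (i, j) * (\<rho> h $$ (k, i) * \<rho> (inv h) $$ (j, r)))"
      by (rule sum.cong)
        (use a b in \<open>auto simp: \<chi> entry sum_distrib_left sum_distrib_right mult_ac intro!: sum.cong\<close>)
    also have "\<dots> = (\<Sum>r<n. \<Sum>k<n. \<Sum>j<n. \<Sum>i<n. \<rho> a $$ (r, k) * \<rho> b $$ (i, j) * ?S k i j r)"
      by (simp add: sum.swap [of _ _ "carrier G"] sum_distrib_left)
    finally have "of_nat n * (\<Sum>h\<in>carrier G. ?\<chi> (a \<otimes> (h \<otimes> b \<otimes> inv h)))
        = (\<Sum>r<n. \<Sum>k<n. \<Sum>j<n. \<Sum>i<n. \<rho> a $$ (r, k) * \<rho> b $$ (i, j) * (of_nat n * ?S k i j r))"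
      by (simp only: sum_distrib_left mult_ac)
    also have "\<dots> = (\<Sum>r<n. \<Sum>k<n. \<Sum>j<n. \<Sum>i<n. \<rho> a $$ (r, k) * \<rho> b $$ (i, j) * (if i = j \<and> k = r then ?c else 0))"
      using S by (intro sum.cong refl) simp
    also have "\<dots> = (\<Sum>r<n. \<Sum>k<n. if k = r then \<rho> a $$ (r, k) * (\<Sum>j<n. \<rho> b $$ (j, j)) * ?c else 0)"
    proof (intro sum.cong refl)
      fix r k
      have "(\<Sum>i<n. \<rho> a $$ (r, k) * \<rho> b $$ (i, j) * (if i = j \<and> k = r then ?c else 0))
          = (\<Sum>i<n. if i = j then (if k = r then \<rho> a $$ (r, k) * \<rho> b $$ (j, j) * ?c else 0) else 0)" for j
        by (rule sum.cong) auto
      then show "(\<Sum>j<n. \<Sum>i<n. \<rho> a $$ (r, k) * \<rho> b $$ (i, j) * (if i = j \<and> k = r then ?c else 0))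
          = (if k = r then \<rho> a $$ (r, k) * (\<Sum>j<n. \<rho> b $$ (j, j)) * ?c else 0)"
        by (simp add: sum_distrib_left sum_distrib_right)
    qed
    also have "\<dots> = ?c * ?\<chi> a * ?\<chi> b"
      using a b by (simp add: \<chi> sum_distrib_left sum_distrib_right mult_ac)
    finally show "?\<chi> \<one> * (\<Sum>h\<in>carrier G. ?\<chi> (a \<otimes> (h \<otimes> b \<otimes> inv h)))
        = of_nat (card (carrier G)) * ?\<chi> a * ?\<chi> b"
      using character_one [OF G irr] by simp
  next
    have "(\<Sum>h\<in>carrier G. ?\<chi> h * ?\<chi> (inv h))
        = (\<Sum>h\<in>carrier G. \<Sum>k<n. \<Sum>j<n. \<rho> h $$ (k, k) * \<rho> (inv h) $$ (j, j))"
      by (rule sum.cong) (auto simp: \<chi> sum_product)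
    also have "\<dots> = (\<Sum>k<n. \<Sum>j<n. ?S k k j j)"
      by (simp add: sum.swap [of _ _ "carrier G"])
    finally have "of_nat n * (\<Sum>h\<in>carrier G. ?\<chi> h * ?\<chi> (inv h)) = (\<Sum>k<n. \<Sum>j<n. of_nat n * ?S k k j j)"
      by (simp only: sum_distrib_left)
    also have "\<dots> = (\<Sum>k<n. \<Sum>j<n. if k = j then ?c else 0)"
      using S by (intro sum.cong refl) simp
    also have "\<dots> = of_nat n * ?c" by simp
    finally show "(\<Sum>h\<in>carrier G. ?\<chi> h * ?\<chi> (inv h)) = ?c" using n by simp
  qed (rule fin)
qed

theorem theoremC:
  fixes p :: nat and P :: "('a, 'b) monoid_scheme" and \<chi> :: "'a \<Rightarrow> complex"
  assumes "Factorial_Ring.prime p" and "odd p"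
    and "p_group p P"
    and "\<chi> \<in> Irr P"
    and "\<exists>x\<in>Supp P \<chi>. \<not> (group.ord P x dvd\<^sub>\<nat> of_nat (Coset.order P) / (\<chi> \<one>\<^bsub>P\<^esub>)\<^sup>2)"
  shows "(p ^ 4 dvd\<^sub>\<nat> \<chi> \<one>\<^bsub>P\<^esub>) \<and> p ^ 10 dvd Coset.order P"
proof -
  let ?N = "of_nat (Coset.order P) / (\<chi> \<one>\<^bsub>P\<^esub>)\<^sup>2"
  have G: "group P" and finP: "finite (carrier P)" using assms(3) by (auto simp: p_group_def)
  obtain N where N: "Coset.order P = p ^ N" using assms(3) by (auto simp: p_group_def)
  obtain n \<rho> where \<chi>: "\<chi> = character P \<rho>" and irr: "irreducible_rep P n \<rho>"
    using assms(4) by (auto simp: Irr_def)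
  have "irr_char P \<chi>" unfolding \<chi> by (rule irr_char_character [OF G finP irr])
  moreover have "pgroup P p"
    using G finP N assms(1) by (auto simp: pgroup_def pgroup_axioms_def Coset.order_def)
  ultimately interpret pgroup_char P \<chi> p by (simp add: pgroup_char_def)
  have cardP: "card (carrier P) = p ^ N" using N by (simp add: Coset.order_def)
  have one: "\<chi> \<one>\<^bsub>P\<^esub> = of_nat n" unfolding \<chi> by (rule character_one [OF G irr])
  obtain k where k: "(\<chi> \<one>\<^bsub>P\<^esub>)\<^sup>2 = of_nat (p ^ (2 * k))"
    "p ^ (2 * k) * card Z \<le> card (carrier P)"
    "p ^ (2 * k) * card Z = card (carrier P) \<longrightarrow> (\<forall>x\<in>carrier P. \<chi> x \<noteq> 0 \<longrightarrow> x \<in> Z)"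
    using pgroup_char_degree [OF pgroup_char_axioms] by blast
  have "of_nat (n ^ 2) = (of_nat (p ^ (2 * k)) :: complex)" using k(1) by (simp add: one)
  then have "n ^ 2 = (p ^ k) ^ 2"
    by (simp only: of_nat_eq_iff power_mult [symmetric] mult.commute [of k])
  then have n: "n = p ^ k" by (rule power2_eq_imp_eq) auto
  obtain x where "x \<in> Supp P \<chi>" and ndvd: "\<not> (ord x dvd\<^sub>\<nat> ?N)" using assms(5) by blast
  then have x: "x \<in> carrier P" "\<chi> x \<noteq> 0" by (auto simp: Supp_def)
  obtain a where a: "ord x = p ^ a" using ord_eq_power [OF x(1)] by blast
  \<comment> \<open>The truncated difference N - 2k is exact under this hypothesis, so the complex
    quotient really is the natural number p^(N - 2k).\<close>
  have quot: "ord x dvd\<^sub>\<nat> ?N" if "a + 2 * k \<le> N"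
  proof -
    have "(of_nat (p ^ N) :: complex) = of_nat (p ^ (N - 2 * k)) * of_nat (p ^ (2 * k))"
      using that by (simp flip: of_nat_mult power_add)
    then have "?N = of_nat (p ^ (N - 2 * k))"
      using p_gt_1 unfolding N k(1) by simp
    moreover have "ord x dvd p ^ (N - 2 * k)" unfolding a using that by (intro le_imp_power_dvd) simp
    ultimately show ?thesis unfolding nat_dvd_complex_def by blast
  qed
  have "\<not> a + 2 * k \<le> N" using quot ndvd by blast
  have k4: "4 \<le> k"
  proof (rule ccontr)
    assume "\<not> 4 \<le> k"
    then have "ord x * p ^ (2 * k) \<le> card (carrier P)" by (intro ord_bound assms(2) k(1) x) simp
    then have "p ^ (a + 2 * k) \<le> p ^ N" unfolding a cardP by (simp add: power_add)
    then have "a + 2 * k \<le> N" using p_gt_1 power_le_imp_le_exp by blast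
    then show False using \<open>\<not> a + 2 * k \<le> N\<close> by blast
  qed
  have subZ: "subgroup Z P" by (rule normal_imp_subgroup [OF normal_center])
  obtain c where c: "card Z = p ^ c" using card_subgroup [OF subZ] by blast
  have "p ^ (2 * k + c) \<le> p ^ N" using k(2) unfolding c cardP by (simp add: power_add)
  then have kcN: "2 * k + c \<le> N" using p_gt_1 power_le_imp_le_exp by blast
  have "c \<noteq> 0"
  proof
    assume "c = 0"
    have 1: "carrier P \<lhd> P" by (simp add: normal_inv_iff subgroup_self)
    have "card (carrier P) \<noteq> 1" unfolding cardP using kcN k4 p_gt_1 by simp
    then have "carrier P \<noteq> {\<one>\<^bsub>P\<^esub>}" by auto
    then have 2: "{\<one>\<^bsub>P\<^esub>} \<subset> carrier P" by auto
    obtain z where z: "z \<in> carrier P" "z \<notin> {\<one>\<^bsub>P\<^esub>}" "z \<in> center_mod {\<one>\<^bsub>P\<^esub>}"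
      by (rule exists_central_mod [OF one_is_normal 1 2])
    have "z \<in> Z" by (rule group_center_subset [OF z(1) center_commute [OF z(3)]])
    moreover have "Z = {\<one>\<^bsub>P\<^esub>}"
      using c \<open>c = 0\<close> one_center(1) card_1_singletonE [of Z] by (metis power_0 singletonD)
    ultimately show False using z(2) by blast
  qed
  \<comment> \<open>From 2k + c <= N with k >= 4 and c >= 1, failure leaves only k = 4, c = 1, N =
    9. That is the equality case of the degree bound, so \<open>x\<close> lies in \<open>Z\<close>
    of order p, and a + 2k <= 9 contradicts the choice of \<open>x\<close>.\<close>
  have "10 \<le> N"
  proof (rule ccontr)
    assume "\<not> 10 \<le> N"
    then have eq: "k = 4" "c = 1" "N = 9" using kcN k4 \<open>c \<noteq> 0\<close> by linarith+
    have "p ^ (2 * k) * card Z = card (carrier P)" unfolding c cardP eq by (simp flip: power_Suc2)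
    then have xZ: "x \<in> Z" using k(3) x by blast
    have "generate P {x} \<subseteq> Z" using generate_subgroup_incl [OF _ subZ, of "{x}"] xZ by simp
    then have "ord x \<le> p"
      using generate_pow_card [OF x(1)] card_mono [OF finite_subgroup [OF subZ]] c eq by (metis power_one_right)
    then have "p ^ a \<le> p ^ 1" using a by simp
    then have "a \<le> 1" using p_gt_1 power_le_imp_le_exp by blast
    then show False using \<open>\<not> a + 2 * k \<le> N\<close> eq by simp
  qed
  then have "p ^ 10 dvd Coset.order P" unfolding N by (rule le_imp_power_dvd)
  moreover have "p ^ 4 dvd\<^sub>\<nat> \<chi> \<one>\<^bsub>P\<^esub>"
    unfolding nat_dvd_complex_def one n using le_imp_power_dvd [OF k4, of p] by blast
  ultimately show ?thesis by blast
qed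

end
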